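(* Assume the setting in the context and fix positive integers $m,D,L$. For every $\delta\in(0,1)$ and $n\ge1$, with probability at least $1-\delta$ over the choice of the i.i.d. sample $\mathcal S$ of size $n$, simultaneously for all families $\Theta=\{\theta(a)\}_{a\in A}$ in which each $f(\cdot,\theta(a))$ is a residual network of size $(d,m,D,L)$, $$\big|\mathcal R_{\mathcal D}(\Theta)-\mathcal R_{\mathcal S}(\Theta)\big|\le\frac{(\|\Theta\|_{\mathcal P}+1)^2}{\sqrt n}\Big(36|A|^3\sqrt{2\ln(2d)}+\frac92\Big(\ln\big(4(\|\Theta\|_{\mathcal P}+1)\big)+\ln(|A|/\delta)\Big)\Big).$$
   Context: Residual networks: for positive integers $d,m,D,L$, a residual network of size $(d,m,D,L)$ is a function $f(\cdot,\theta):\mathbb R^d\to\mathbb R$, $f(x,\theta)=u^{\top}h^{[L]}$, where $h^{[0]}=Vx$ and $h^{[l]}=h^{[l-1]}+U^{[l]}\sigma(W^{[l]}h^{[l-1]})$ for $l=1,\dots,L$, with $V\in\mathbb R^{D\times d}$, $W^{[l]}\in\mathbb R^{m\times D}$, $U^{[l]}\in\mathbb R^{D\times m}$, $u\in\mathbb R^D$, $\sigma(z)=\max(z,0)$ applied entrywise, and $\theta=(u,V,\{W^{[l]}\}_{l=1}^L,\{U^{[l]}\}_{l=1}^L)$. Its weighted path norm is $\|\theta\|_{\mathcal P}=\big\||u|^{\top}(I+3|U^{[L]}||W^{[L]}|)\cdots(I+3|U^{[1]}||W^{[1]}|)|V|\big\|_1$, where $|\cdot|$ of a matrix/vector is entrywise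 absolute value and $I$ is the $D\times D$ identity. For a family $\Theta=\{\theta(a)\}_{a\in A}$ of parameters (one network per action, all of the same size), $f(s,\theta(a))$ denotes the $a$-th network and $\|\Theta\|_{\mathcal P}=\sum_{a\in A}\|\theta(a)\|_{\mathcal P}$. Setting: $S\subseteq[0,1]^d$ is compact with positive Lebesgue measure (state space); $A$ is a finite action set with $|A|=2^{\alpha}$, $\alpha\ge 0$ an integer, identified with $\{1,\dots,2^\alpha\}$; $\gamma\in(0,1)$. The reward $r:S\times A\to\mathbb R$ satisfies: each $r(\cdot,a)$ is continuous and $|r(s,a)|\le 1$ for all $(s,a)$. The transition is a map $\tilde g:S\times A\times[0,\infty)\to S$, and a time step $\Delta t\in(0,1)$ is fixed. $\mathcal D$ is the uniform distribution on $S$ and $\mathcal U$ the uniform distribution on $A$. Losses: the Bellman optimal loss is $\mathcal R_{\mathcal D}(\Theta)=\frac12\mathbb E_{s\sim\mathcal D,a\sim\mathcal U}\big(f(s,\theta(a))-r(s,a)-\gamma\max_{a'\in A}f(s',\theta(a'))\big)^2$ with $s'=\tilde g(s,a,\Delta t)$. A sample $\mathcal S=\{(s_i,a_i,s_i')\}_{i=1}^n$ consists of i.i.d. pairs $s_i\sim\mathcal D$, $a_i\sim\mathcal U$ (independent) with $s_i'=\tilde g(s_i,a_i,\Delta t)$; the empirical loss is $\mathcal R_{\mathcal S}(\Theta)=\frac1{2n}\sum_{i=1}^n\big(f(s_i,\theta(a_i))-r(s_i,a_i)-\gamma\max_{a'\in A}f(s_i',\theta(a'))\big)^2$. *)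

theory Defs
  imports "HOL-Analysis.Analysis" "HOL-Probability.Probability"
begin

text \<open>Parameters of a residual network of size (d,m,D,L):
  (u, V, [(W1,U1), ..., (WL,UL)]) with u in R^D, V in R^(D x d),
  W_l in R^(m x D), U_l in R^(D x m).  Here d = CARD('d), m = CARD('m),
  D = CARD('D), and L is the length of the layer list.\<close>
type_synonym ('d, 'm, 'D) rparams =
  "(real^'D) \<times> (real^'d^'D) \<times> ((real^'D^'m) \<times> (real^'m^'D)) list"

definition relu_vec :: "real^'m \<Rightarrow> real^'m" where
  "relu_vec z = (\<chi> i. max (z $ i) 0)"

definition absv :: "real^'n \<Rightarrow> real^'n" where
  "absv v = (\<chi> i. \<bar>v $ i\<bar>)"

definition absm :: "real^'n^'m \<Rightarrow> real^'n^'m" where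
  "absm M = (\<chi> i j. \<bar>M $ i $ j\<bar>)"

definition rlayers :: "('d::finite, 'm::finite, 'D::finite) rparams \<Rightarrow> ((real^'D^'m) \<times> (real^'m^'D)) list" where
  "rlayers \<theta> = snd (snd \<theta>)"

definition resnet :: "('d::finite, 'm::finite, 'D::finite) rparams \<Rightarrow> real^'d \<Rightarrow> real" where
  "resnet \<theta> x = (case \<theta> of (u, V, Ls) \<Rightarrow>
     u \<bullet> fold (\<lambda>(W, U) h. h + U *v relu_vec (W *v h)) Ls (V *v x))"

definition path_norm :: "('d::finite, 'm::finite, 'D::finite) rparams \<Rightarrow> real" where
  "path_norm \<theta> = (case \<theta> of (u, V, Ls) \<Rightarrow>
     (\<Sum>j\<in>UNIV. \<bar>((absv u v* foldr (\<lambda>(W, U) P. P ** (mat 1 + 3 *\<^sub>R (absm U ** absm W))) Ls (mat 1))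
                    v* absm V) $ j\<bar>))"

definition family_path_norm :: "nat set \<Rightarrow> (nat \<Rightarrow> ('d::finite, 'm::finite, 'D::finite) rparams) \<Rightarrow> real" where
  "family_path_norm A \<Theta> = (\<Sum>a\<in>A. path_norm (\<Theta> a))"

definition state_dist :: "(real^'d::finite) set \<Rightarrow> (real^'d) measure" where
  "state_dist S = uniform_measure (restrict_space lebesgue S) S"

definition pair_dist :: "(real^'d::finite) set \<Rightarrow> nat set \<Rightarrow> ((real^'d) \<times> nat) measure" where
  "pair_dist S A = state_dist S \<Otimes>\<^sub>M uniform_count_measure A"

definition bellman_sq ::
  "nat set \<Rightarrow> (real^'d::finite \<Rightarrow> nat \<Rightarrow> real) \<Rightarrow> (real^'d \<Rightarrow> nat \<Rightarrow> real \<Rightarrow> real^'d) \<Rightarrow> real \<Rightarrow> real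
   \<Rightarrow> (nat \<Rightarrow> ('d, 'm::finite, 'D::finite) rparams) \<Rightarrow> (real^'d) \<times> nat \<Rightarrow> real" where
  "bellman_sq A r g dt \<gamma> \<Theta> sa = (case sa of (s, a) \<Rightarrow>
     (resnet (\<Theta> a) s - r s a - \<gamma> * Max ((\<lambda>a'. resnet (\<Theta> a') (g s a dt)) ` A))\<^sup>2)"

definition bellman_risk ::
  "(real^'d::finite) set \<Rightarrow> nat set \<Rightarrow> (real^'d \<Rightarrow> nat \<Rightarrow> real) \<Rightarrow> (real^'d \<Rightarrow> nat \<Rightarrow> real \<Rightarrow> real^'d)
   \<Rightarrow> real \<Rightarrow> real \<Rightarrow> (nat \<Rightarrow> ('d, 'm::finite, 'D::finite) rparams) \<Rightarrow> real" where
  "bellman_risk S A r g dt \<gamma> \<Theta> = 1/2 * (\<integral>sa. bellman_sq A r g dt \<gamma> \<Theta> sa \<partial>pair_dist S A)"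

definition empirical_risk ::
  "nat set \<Rightarrow> (real^'d::finite \<Rightarrow> nat \<Rightarrow> real) \<Rightarrow> (real^'d \<Rightarrow> nat \<Rightarrow> real \<Rightarrow> real^'d)
   \<Rightarrow> real \<Rightarrow> real \<Rightarrow> nat \<Rightarrow> (nat \<Rightarrow> (real^'d) \<times> nat) \<Rightarrow> (nat \<Rightarrow> ('d, 'm::finite, 'D::finite) rparams) \<Rightarrow> real" where
  "empirical_risk A r g dt \<gamma> n smp \<Theta> = 1 / (2 * real n) * (\<Sum>i<n. bellman_sq A r g dt \<gamma> \<Theta> (smp i))"

definition sample_dist :: "(real^'d::finite) set \<Rightarrow> nat set \<Rightarrow> nat \<Rightarrow> (nat \<Rightarrow> (real^'d) \<times> nat) measure" where
  "sample_dist S A n = PiM {..<n} (\<lambda>_. pair_dist S A)"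

end

theory Submission
  imports Defs
begin

text \<open>For a class of networks whose path norms sum to at most $q$, bound the exponential moment of the
  largest deviation between risk and empirical risk; no bounded-difference inequality is needed.
  Symmetrization reduces it to signed sums of losses at fixed sample points.  Each loss is a function
  of finitely many network outputs that is Lipschitz in the maximum norm; as
  $\max_j |x_j| \<le> E |\sum_j \sigma_j x_j|$ for random signs, the exponential contraction principle
  holds with an independent sign for every output, and the maximum over the actions costs no further
  factor.  What remains are signed sums of single networks of path norm 1, where the factor 3 in the
  path norm makes the recursion over the layers contracting, down to signed sums of coordinates.
  Markov's inequality gives the tail bound for fixed $q$; the levels $q = (j + 1)/2$ with failure
  probabilities $\delta / ((j+1)(j+2))$ give all path norms at once, and density of a countable set of
  parameters handles the uncountable class.\<close>

subsection \<open>Averages over signed sums\<close>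

text \<open>The loss depends on \<open>card A + 1\<close> network outputs at once, so contraction
  for functions of a single output does not apply directly. Complexity and confidence are not
  treated separately either: one exponential moment with one parameter \<open>lam\<close> yields
  both. Taking \<open>lam\<close> proportional to sqrt (ln (2d)) / (sqrt n (q + 1/2)^2) makes the
  exponent in the moment bound a multiple of ln (2d) that depends neither on n nor on q. The 1 added
  to the path norm in the bound is spent in two halves: rounding the norm up to a grid of mesh 1/2
  costs at most 1/2, and the constant feature 1/2 that carries the reward costs the rest. Of the
  factor 36, the moment consumes 33; the remaining 3, together with the factor 9/2, absorbs
  numerical constants and the logarithms of the level index. Signs are averaged over explicit finite
  lists, so suprema over uncountable classes of networks raise no question of measurability there;
  only the suprema integrated over the sample need a countable index set.\<close>

lemma exp_add_exp_minus_le: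
  fixes x :: real
  shows "(exp x + exp (- x)) / 2 \<le> exp (x\<^sup>2 / 2)"
proof -
  have *: "(exp y + exp (- y)) / 2 \<le> exp (y\<^sup>2 / 2)" if "0 \<le> y" for y :: real
  proof -
    \<comment> \<open>The auxiliary inequality behind Hoeffding's lemma at probability 1/2 and step
      2y; its right-hand side is y^2 / 2. Multiplying by e^(-y) afterwards recovers the hyperbolic
      cosine.\<close>
    have "- (2 * y) * (1/2) + ln (1 + (1/2) * (exp (2 * y) - 1)) \<le> (2 * y)\<^sup>2 / 8"
      using that by (intro Hoeffdings_lemma_aux) auto
    then have "ln ((1 + exp (2 * y)) / 2) \<le> y + y\<^sup>2 / 2"
      by (simp add: power2_eq_square field_simps)
    moreover have "0 < (1 + exp (2 * y)) / 2"
      by (simp add: add_pos_pos)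
    ultimately have "(1 + exp (2 * y)) / 2 \<le> exp (y + y\<^sup>2 / 2)"
      by (metis exp_le_cancel_iff exp_ln)
    then have "exp (- y) * ((1 + exp (2 * y)) / 2) \<le> exp (- y) * exp (y + y\<^sup>2 / 2)"
      by (intro mult_left_mono) auto
    moreover have "exp (- y) * exp (2 * y) = exp y"
      by (simp flip: exp_add)
    ultimately show ?thesis
      by (simp add: distrib_left flip: exp_add)
  qed
  show ?thesis
    using *[of x] *[of "- x"] by (cases "0 \<le> x") (auto simp: add.commute)
qed

text \<open>Random signs without a probability space: every sign pattern contributes one entry. It
  is a list and not a set so that coinciding sums keep their multiplicity.\<close>

fun signed_sums :: "('t \<Rightarrow> real) list \<Rightarrow> ('t \<Rightarrow> real) list" where
  "signed_sums [] = [\<lambda>_. 0]"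
| "signed_sums (v # vs) =
     map (\<lambda>u t. u t + v t) (signed_sums vs) @ map (\<lambda>u t. u t - v t) (signed_sums vs)"

text \<open>The Rademacher expectation. \<open>\<Phi>\<close> receives the whole signed sum as a
  function of \<open>t\<close>, so that it may contain a supremum over \<open>t\<close>.\<close>

definition rad_avg :: "(('t \<Rightarrow> real) \<Rightarrow> real) \<Rightarrow> ('t \<Rightarrow> real) list \<Rightarrow> real" where
  "rad_avg \<Phi> vs = sum_list (map \<Phi> (signed_sums vs)) / 2 ^ length vs"

lemma length_signed_sums: "length (signed_sums vs) = 2 ^ length vs"
  by (induction vs) auto

lemma rad_avg_Nil [simp]: "rad_avg \<Phi> [] = \<Phi> (\<lambda>_. 0)"
  by (simp add: rad_avg_def)

lemma rad_avg_Cons: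
  "rad_avg \<Phi> (v # vs) =
     (rad_avg (\<lambda>u. \<Phi> (\<lambda>t. u t + v t)) vs + rad_avg (\<lambda>u. \<Phi> (\<lambda>t. u t - v t)) vs) / 2"
  by (simp add: rad_avg_def comp_def add_divide_distrib)

lemma rad_avg_mono:
  assumes "\<And>u. u \<in> set (signed_sums vs) \<Longrightarrow> \<Phi> u \<le> \<Psi> u"
  shows "rad_avg \<Phi> vs \<le> rad_avg \<Psi> vs"
  unfolding rad_avg_def using assms by (intro divide_right_mono sum_list_mono) auto

lemma rad_avg_add: "rad_avg (\<lambda>u. \<Phi> u + \<Psi> u) vs = rad_avg \<Phi> vs + rad_avg \<Psi> vs"
  by (simp add: rad_avg_def sum_list_addf add_divide_distrib)

lemma rad_avg_cmult: "rad_avg (\<lambda>u. c * \<Phi> u) vs = c * rad_avg \<Phi> vs"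
  by (simp add: rad_avg_def sum_list_const_mult)

lemma rad_avg_divide: "rad_avg (\<lambda>u. \<Phi> u / c) vs = rad_avg \<Phi> vs / c"
  using rad_avg_cmult[of "inverse c" \<Phi> vs] by (simp add: field_simps)

lemma rad_avg_const: "rad_avg (\<lambda>u. c) vs = c"
  by (simp add: rad_avg_def map_replicate_const sum_list_replicate length_signed_sums)

lemma rad_avg_sum: "rad_avg (\<lambda>u. \<Sum>i\<in>I. \<Phi> i u) vs = (\<Sum>i\<in>I. rad_avg (\<Phi> i) vs)"
proof (induction I rule: infinite_finite_induct)
  case (insert x F)
  then show ?case by (simp add: rad_avg_add)
qed (simp_all add: rad_avg_const)

lemma rad_avg_nonneg: "(\<And>u. 0 \<le> \<Phi> u) \<Longrightarrow> 0 \<le> rad_avg \<Phi> vs"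
  using rad_avg_mono[of vs "\<lambda>_. 0" \<Phi>] by (simp add: rad_avg_const)

text \<open>Independence of the signs of the two blocks, in the form of an iterated average.\<close>

lemma rad_avg_append:
  "rad_avg \<Phi> (vs @ ws) = rad_avg (\<lambda>u. rad_avg (\<lambda>u'. \<Phi> (\<lambda>t. u t + u' t)) ws) vs"
proof (induction vs arbitrary: \<Phi>)
  case (Cons v vs)
  show ?case
    by (simp add: rad_avg_Cons Cons algebra_simps)
qed simp

lemma rad_avg_swap:
  "rad_avg (\<lambda>u. rad_avg (\<lambda>u'. \<Phi> u u') ws) vs = rad_avg (\<lambda>u'. rad_avg (\<lambda>u. \<Phi> u u') vs) ws"
proof (induction vs arbitrary: \<Phi>)
  case (Cons v vs)
  show ?case
    by (simp add: rad_avg_Cons Cons rad_avg_add rad_avg_divide add_divide_distrib)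
qed simp

lemma rad_avg_minus:
  "rad_avg (\<lambda>u. \<Phi> (\<lambda>t. - u t)) vs = rad_avg \<Phi> vs"
proof (induction vs arbitrary: \<Phi>)
  case (Cons v vs)
  show ?case
    using Cons[of "\<lambda>u. \<Phi> (\<lambda>t. u t + v t)"] Cons[of "\<lambda>u. \<Phi> (\<lambda>t. u t - v t)"]
    by (simp add: rad_avg_Cons)
qed simp

text \<open>Change of index set. It turns losses indexed by parameters into signed sums of
  evaluation functionals, and these into functionals on a single class of networks.\<close>

lemma rad_avg_map:
  "rad_avg \<Phi> (map (\<lambda>w s. c * w (h s)) ws) = rad_avg (\<lambda>u. \<Phi> (\<lambda>s. c * u (h s))) ws"
proof (induction ws arbitrary: \<Phi>)
  case (Cons w ws)
  show ?case
    by (simp add: rad_avg_Cons Cons algebra_simps)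
qed simp

lemma signed_sums_repr:
  assumes "u \<in> set (signed_sums vs)"
  shows "\<exists>\<epsilon>::nat \<Rightarrow> real. (\<forall>i. \<bar>\<epsilon> i\<bar> = 1) \<and> u = (\<lambda>t. \<Sum>i<length vs. \<epsilon> i * (vs ! i) t)"
  using assms
proof (induction vs arbitrary: u)
  case Nil
  then show ?case by (auto intro!: exI[of _ "\<lambda>_. 1"])
next
  case (Cons v vs)
  then obtain u' and s :: real where u': "u' \<in> set (signed_sums vs)" "\<bar>s\<bar> = 1"
    "u = (\<lambda>t. u' t + s * v t)"
    by (auto, metis (no_types) abs_1 mult_1, metis (no_types, lifting) abs_1 abs_minus_cancel
        mult_minus1 uminus_add_conv_diff add.commute)
  obtain \<epsilon> where \<epsilon>: "\<forall>i. \<bar>\<epsilon> i\<bar> = (1::real)" "u' = (\<lambda>t. \<Sum>i<length vs. \<epsilon> i * (vs ! i) t)"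
    using Cons.IH[OF u'(1)] by auto
  show ?case
    using \<epsilon> u'(2,3)
    by (intro exI[of _ "case_nat s \<epsilon>"])
       (auto simp: lessThan_Suc_eq_insert_0 sum.reindex split: nat.split)
qed

text \<open>Averaging over all signs but one can only decrease a convex function; for two terms this
  is (|a + b| + |a - b|) / 2 >= max |a| |b|. Hence a function that is Lipschitz in the maximum norm
  of finitely many features is dominated by their random signed sum. \<open>F\<close> stands for
  evaluation at one index or for the difference of two evaluations.\<close>

lemma abs_le_rad_avg:
  assumes add: "\<And>u v. F (\<lambda>t. u t + v t) = F u + (F v :: real)"
    and diff: "\<And>u v. F (\<lambda>t. u t - v t) = F u - F v"
    and w: "w \<in> set ws"
  shows "\<bar>F w\<bar> \<le> rad_avg (\<lambda>u. \<bar>F u\<bar>) ws"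
  using w
proof (induction ws)
  case (Cons v vs)
  have eq: "rad_avg (\<lambda>u. \<bar>F u\<bar>) (v # vs) = rad_avg (\<lambda>u. (\<bar>F u + F v\<bar> + \<bar>F u - F v\<bar>) / 2) vs"
    by (simp add: rad_avg_Cons add diff rad_avg_add rad_avg_divide)
  have "\<bar>F v\<bar> \<le> rad_avg (\<lambda>u. \<bar>F u\<bar>) (v # vs)"
    using rad_avg_mono[of vs "\<lambda>_. \<bar>F v\<bar>" "\<lambda>u. (\<bar>F u + F v\<bar> + \<bar>F u - F v\<bar>) / 2"]
    unfolding eq rad_avg_const by force
  moreover have "rad_avg (\<lambda>u. \<bar>F u\<bar>) vs \<le> rad_avg (\<lambda>u. \<bar>F u\<bar>) (v # vs)"
    unfolding eq
  proof (rule rad_avg_mono)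
    fix u
    show "\<bar>F u\<bar> \<le> (\<bar>F u + F v\<bar> + \<bar>F u - F v\<bar>) / 2"
      using abs_triangle_ineq[of "F u + F v" "F u - F v"] by simp
  qed
  ultimately show ?case
    using Cons by fastforce
qed simp

text \<open>The signs are independent, so the moment is a product of hyperbolic cosines, one for
  each list entry.\<close>

lemma rad_avg_exp:
  assumes "\<And>v. v \<in> set vs \<Longrightarrow> \<bar>v t\<bar> \<le> 1"
  shows "rad_avg (\<lambda>u. exp (c * u t)) vs \<le> exp (c\<^sup>2 / 2 * length vs)"
  using assms
proof (induction vs)
  case (Cons v vs)
  have "rad_avg (\<lambda>u. exp (c * u t)) (v # vs)
      = (exp (c * v t) + exp (- (c * v t))) / 2 * rad_avg (\<lambda>u. exp (c * u t)) vs"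
    using rad_avg_cmult[of "exp (c * v t)" "\<lambda>u. exp (c * u t)" vs]
      rad_avg_cmult[of "exp (- (c * v t))" "\<lambda>u. exp (c * u t)" vs]
    by (simp add: rad_avg_Cons algebra_simps exp_diff exp_add exp_minus field_simps)
  also have "\<dots> \<le> exp ((c * v t)\<^sup>2 / 2) * exp (c\<^sup>2 / 2 * length vs)"
    using Cons by (intro mult_mono exp_add_exp_minus_le rad_avg_nonneg) auto
  also have "\<dots> \<le> exp (c\<^sup>2 / 2) * exp (c\<^sup>2 / 2 * length vs)"
  proof -
    have "(v t)\<^sup>2 \<le> 1" using Cons.prems[of v] by (simp add: abs_square_le_1)
    then have "(c * v t)\<^sup>2 \<le> c\<^sup>2" by (simp add: power_mult_distrib mult_left_le)
    then show ?thesis by (intro mult_right_mono) auto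
  qed
  finally show ?case by (simp add: field_simps flip: exp_add)
qed simp

lemma rad_avg_exp_abs:
  assumes "\<And>v. v \<in> set vs \<Longrightarrow> \<bar>v t\<bar> \<le> 1"
  shows "rad_avg (\<lambda>u. exp (c * \<bar>u t\<bar>)) vs \<le> 2 * exp (c\<^sup>2 / 2 * length vs)"
proof -
  have "rad_avg (\<lambda>u. exp (c * \<bar>u t\<bar>)) vs
      \<le> rad_avg (\<lambda>u. exp (c * u t) + exp ((- c) * u t)) vs"
    by (rule rad_avg_mono) (auto simp: abs_if)
  also have "\<dots> \<le> 2 * exp (c\<^sup>2 / 2 * length vs)"
    unfolding rad_avg_add using rad_avg_exp[of vs t c] rad_avg_exp[of vs t "- c"] assms
    by simp
  finally show ?thesis .
qed

subsection \<open>Contraction\<close>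

lemma bounded_signed_sums:
  assumes "u \<in> set (signed_sums vs)" "\<And>v. v \<in> set vs \<Longrightarrow> bounded (v ` T)"
  shows "bounded (u ` T)"
  using assms
proof (induction vs arbitrary: u)
  case Nil
  then show ?case by (simp add: image_constant_conv)
next
  case (Cons v vs)
  then show ?case
    by (auto intro!: bounded_plus_comp bounded_minus_comp)
qed

lemma bounded_imp_le_cSUP:
  fixes u :: "'t \<Rightarrow> real"
  assumes "bounded (u ` T)" "t \<in> T"
  shows "u t \<le> (SUP t\<in>T. u t)"
  using assms by (intro cSUP_upper bounded_imp_bdd_above)

lemma exp_cSUP_le:
  fixes f :: "'t \<Rightarrow> real"
  assumes "T \<noteq> {}" "\<And>t. t \<in> T \<Longrightarrow> exp (f t) \<le> C"
  shows "exp (SUP t\<in>T. f t) \<le> C"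
proof -
  have "0 < C"
    using assms by (meson all_not_in_conv exp_gt_zero less_le_trans)
  have "(SUP t\<in>T. f t) \<le> ln C"
  proof (rule cSUP_least)
    fix t assume "t \<in> T"
    then show "f t \<le> ln C"
      using assms(2)[of t] \<open>0 < C\<close> by (simp add: ln_ge_iff)
  qed fact
  then show ?thesis
    using \<open>0 < C\<close> by (simp add: ln_ge_iff)
qed

lemma exp_tangent: "exp a * (1 + (x - a)) \<le> exp (x::real)"
  using mult_left_mono[OF exp_ge_add_one_self[of "x - a"], of "exp a"] by (simp flip: exp_add)

text \<open>With $X = \sup (\psi + u)$ and $Y = \sup (\psi - u)$, the pair $(\max, \min)$ of $X, Y$
  dominates on average a given pair of competitors $(a, b)$ in the sense of weak majorization.
  The tangents of the exponential function at $a$ and $b$ turn this into an inequality between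
  exponential moments.\<close>
lemma contraction_pair:
  fixes \<psi> \<phi> :: "'t \<Rightarrow> real"
  assumes t: "t \<in> T" "t' \<in> T"
    and bdd: "bounded (\<psi> ` T)" "\<And>w. w \<in> set ws \<Longrightarrow> bounded (w ` T)"
    and diff: "\<bar>\<phi> t - \<phi> t'\<bar> \<le> rad_avg (\<lambda>u. \<bar>u t - u t'\<bar>) ws"
    and abs: "\<bar>\<phi> t\<bar> \<le> rad_avg (\<lambda>u. \<bar>u t\<bar>) ws"
    and le: "\<psi> t' - \<phi> t' \<le> \<psi> t + \<phi> t"
  shows "exp (\<psi> t + \<phi> t) + exp (\<psi> t' - \<phi> t') \<le> 2 * rad_avg (\<lambda>u. exp (SUP t\<in>T. \<psi> t + u t)) ws"
proof -
  define a b where "a = \<psi> t + \<phi> t" and "b = \<psi> t' - \<phi> t'"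
  define M where "M u = (SUP t\<in>T. \<psi> t + u t)" for u
  \<comment> \<open>The tangents of \<open>exp\<close> at \<open>a\<close> and \<open>b\<close>,
    regrouped as \<open>exp b\<close> times X + Y plus \<open>exp a - exp b\<close> times X, with X
    + Y and X replaced by lower bounds. Both coefficients are nonnegative, and the result is affine
    in \<open>\<bar>u t - u t'\<bar>\<close> and \<open>\<bar>u t\<bar>\<close>, so it can be
    averaged term by term.\<close>
  define low where "low u = exp a + exp b + exp b * (\<psi> t + \<psi> t' - a - b + \<bar>u t - u t'\<bar>)
      + (exp a - exp b) * (\<psi> t - a + \<bar>u t\<bar>)" for u
  have "b \<le> a" using le by (simp add: a_def b_def)
  have M_ge: "\<psi> s + u s \<le> M u" if "bounded (u ` T)" "s \<in> T" for u s
    unfolding M_def using bounded_imp_le_cSUP[OF bounded_plus_comp[OF bdd(1) that(1)] that(2)] .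
  have low: "low u \<le> exp (M u) + exp (M (\<lambda>t. - u t))" if "u \<in> set (signed_sums ws)" for u
  proof -
    have "bounded (u ` T)" by (rule bounded_signed_sums[OF that bdd(2)])
    then have "bounded ((\<lambda>t. - u t) ` T)"
      using bounded_uminus[of "u ` T"] by (simp add: image_image)
    note M = M_ge[OF \<open>bounded (u ` T)\<close>] M_ge[OF this]
    define X Y where "X = max (M u) (M (\<lambda>t. - u t))" and "Y = min (M u) (M (\<lambda>t. - u t))"
    \<comment> \<open>Using \<open>t\<close> as competitor for \<open>u\<close> and
      \<open>t'\<close> for \<open>- u\<close> gives the difference with one sign; exchanging the
      roles of \<open>t\<close> and \<open>t'\<close> gives the other sign.\<close>
    have 1: "\<psi> t + \<psi> t' + \<bar>u t - u t'\<bar> \<le> X + Y"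
      using M t unfolding X_def Y_def by (smt (verit, best))
    have 2: "\<psi> t + \<bar>u t\<bar> \<le> X"
      using M t unfolding X_def by (smt (verit, best))
    have "low u \<le> exp a + exp b + exp b * (X + Y - a - b) + (exp a - exp b) * (X - a)"
      unfolding low_def using 1 2 \<open>b \<le> a\<close> by (intro add_mono mult_left_mono) auto
    also have "\<dots> = exp a * (1 + (X - a)) + exp b * (1 + (Y - b))"
      by (simp add: algebra_simps)
    also have "\<dots> \<le> exp X + exp Y"
      by (intro add_mono exp_tangent)
    also have "\<dots> = exp (M u) + exp (M (\<lambda>t. - u t))"
      by (auto simp: X_def Y_def max_def min_def)
    finally show ?thesis .
  qed
  \<comment> \<open>Both added terms are nonnegative by hypothesis:
    \<open>\<psi> t + \<psi> t' - a - b\<close> equals \<open>- (\<phi> t - \<phi> t')\<close>, and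
    \<open>\<psi> t - a\<close> equals \<open>- \<phi> t\<close>.\<close>
  have "exp a + exp b \<le> exp a + exp b
      + exp b * (\<psi> t + \<psi> t' - a - b + rad_avg (\<lambda>u. \<bar>u t - u t'\<bar>) ws)
      + (exp a - exp b) * (\<psi> t - a + rad_avg (\<lambda>u. \<bar>u t\<bar>) ws)"
    using diff abs \<open>b \<le> a\<close>
    by (simp add: add_nonneg_nonneg a_def b_def)
  also have "\<dots> = rad_avg low ws"
    unfolding low_def by (simp add: rad_avg_add rad_avg_const rad_avg_cmult)
  also have "\<dots> \<le> rad_avg (\<lambda>u. exp (M u) + exp (M (\<lambda>t. - u t))) ws"
    by (rule rad_avg_mono) (rule low)
  also have "\<dots> = 2 * rad_avg (\<lambda>u. exp (M u)) ws"
    using rad_avg_minus[of "\<lambda>u. exp (M u)" ws] by (simp add: rad_avg_add)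
  finally show ?thesis by (simp add: a_def b_def M_def)
qed

text \<open>Trades the single sign in front of \<open>\<phi>\<close> for independent signs on
  \<open>ws\<close>. The two signs of \<open>\<phi>\<close> give two suprema over separate
  variables, so it is enough to bound every pair of competitors; the suprema are then pulled out of
  \<open>exp\<close> one after the other.\<close>

lemma contraction_step:
  fixes \<psi> \<phi> :: "'t \<Rightarrow> real"
  assumes T: "T \<noteq> {}"
    and bdd: "bounded (\<psi> ` T)" "\<And>w. w \<in> set ws \<Longrightarrow> bounded (w ` T)"
    and diff: "\<And>t t'. t \<in> T \<Longrightarrow> t' \<in> T \<Longrightarrow> \<bar>\<phi> t - \<phi> t'\<bar> \<le> rad_avg (\<lambda>u. \<bar>u t - u t'\<bar>) ws"
    and abs: "\<And>t. t \<in> T \<Longrightarrow> \<bar>\<phi> t\<bar> \<le> rad_avg (\<lambda>u. \<bar>u t\<bar>) ws"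
  shows "rad_avg (\<lambda>u. exp (SUP t\<in>T. \<psi> t + u t)) [\<phi>] \<le> rad_avg (\<lambda>u. exp (SUP t\<in>T. \<psi> t + u t)) ws"
proof -
  define R where "R = rad_avg (\<lambda>u. exp (SUP t\<in>T. \<psi> t + u t)) ws"
  have pair: "exp (\<psi> t + \<phi> t) + exp (\<psi> t' - \<phi> t') \<le> 2 * R" if "t \<in> T" "t' \<in> T" for t t'
  proof (cases "\<psi> t' - \<phi> t' \<le> \<psi> t + \<phi> t")
    case True
    then show ?thesis
      unfolding R_def by (intro contraction_pair) (use assms that in auto)
  next
    case False
    \<comment> \<open>The opposite order of the two values is the first case for
      \<open>- \<phi>\<close> with \<open>t\<close> and \<open>t'\<close> exchanged.\<close>
    have "exp (\<psi> t' + - \<phi> t') + exp (\<psi> t - - \<phi> t) \<le> 2 * R"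
      unfolding R_def
    proof (intro contraction_pair)
      show "\<bar>- \<phi> t' - - \<phi> t\<bar> \<le> rad_avg (\<lambda>u. \<bar>u t' - u t\<bar>) ws"
        using diff[OF that(2,1)] by simp
    qed (use assms that False in auto)
    then show ?thesis by simp
  qed
  have "exp (SUP t\<in>T. \<psi> t + \<phi> t) + exp (\<psi> t' - \<phi> t') \<le> 2 * R" if "t' \<in> T" for t'
    using exp_cSUP_le[OF T, of "\<lambda>t. \<psi> t + \<phi> t" "2 * R - exp (\<psi> t' - \<phi> t')"] pair that
    by (smt (verit, best))
  then have "exp (SUP t\<in>T. \<psi> t - \<phi> t) \<le> 2 * R - exp (SUP t\<in>T. \<psi> t + \<phi> t)"
    by (intro exp_cSUP_le T) (simp add: algebra_simps)
  then show ?thesis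
    by (simp add: rad_avg_Cons R_def)
qed

text \<open>The signs are exchanged one function at a time. Conditioning on the other signs adds
  their signed sum to \<open>\<psi>\<close>, which is why \<open>\<psi>\<close> is an arbitrary
  bounded function and is generalized in the induction.\<close>

lemma rad_avg_contraction:
  fixes \<phi> :: "'x \<Rightarrow> 't \<Rightarrow> real" and W :: "'x \<Rightarrow> ('t \<Rightarrow> real) list"
  assumes T: "T \<noteq> {}"
    and "bounded (\<psi> ` T)"
    and "\<And>x. x \<in> set xs \<Longrightarrow> bounded (\<phi> x ` T)"
    and "\<And>x w. x \<in> set xs \<Longrightarrow> w \<in> set (W x) \<Longrightarrow> bounded (w ` T)"
    and "\<And>x t t'. x \<in> set xs \<Longrightarrow> t \<in> T \<Longrightarrow> t' \<in> T \<Longrightarrow>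
           \<bar>\<phi> x t - \<phi> x t'\<bar> \<le> rad_avg (\<lambda>u. \<bar>u t - u t'\<bar>) (W x)"
    and "\<And>x t. x \<in> set xs \<Longrightarrow> t \<in> T \<Longrightarrow> \<bar>\<phi> x t\<bar> \<le> rad_avg (\<lambda>u. \<bar>u t\<bar>) (W x)"
  shows "rad_avg (\<lambda>u. exp (SUP t\<in>T. \<psi> t + u t)) (map \<phi> xs)
    \<le> rad_avg (\<lambda>u. exp (SUP t\<in>T. \<psi> t + u t)) (concat (map W xs))"
  using assms(2-)
proof (induction xs arbitrary: \<psi>)
  case (Cons x xs)
  let ?vs = "concat (map W xs)"
  have IH: "rad_avg (\<lambda>u. exp (SUP t\<in>T. \<psi>' t + u t)) (map \<phi> xs)
      \<le> rad_avg (\<lambda>u. exp (SUP t\<in>T. \<psi>' t + u t)) ?vs" if "bounded (\<psi>' ` T)" for \<psi>'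
    using Cons.prems by (intro Cons.IH that) auto
  have bdd: "bounded (\<phi> x ` T)" using Cons.prems(2) by simp
  have "rad_avg (\<lambda>u. exp (SUP t\<in>T. \<psi> t + u t)) (map \<phi> (x # xs))
      = (rad_avg (\<lambda>u. exp (SUP t\<in>T. (\<psi> t + \<phi> x t) + u t)) (map \<phi> xs)
       + rad_avg (\<lambda>u. exp (SUP t\<in>T. (\<psi> t - \<phi> x t) + u t)) (map \<phi> xs)) / 2"
    by (simp add: rad_avg_Cons algebra_simps)
  also have "\<dots> \<le> (rad_avg (\<lambda>u. exp (SUP t\<in>T. (\<psi> t + \<phi> x t) + u t)) ?vs
       + rad_avg (\<lambda>u. exp (SUP t\<in>T. (\<psi> t - \<phi> x t) + u t)) ?vs) / 2"
    by (intro divide_right_mono add_mono IH bounded_plus_comp bounded_minus_comp bdd Cons.prems(1)) simp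
  also have "\<dots> = rad_avg (\<lambda>u. rad_avg (\<lambda>v. exp (SUP t\<in>T. (\<psi> t + u t) + v t)) [\<phi> x]) ?vs"
    by (simp add: rad_avg_Cons rad_avg_add rad_avg_divide algebra_simps)
  also have "\<dots> \<le> rad_avg (\<lambda>u. rad_avg (\<lambda>v. exp (SUP t\<in>T. (\<psi> t + u t) + v t)) (W x)) ?vs"
  proof (rule rad_avg_mono)
    fix u assume u: "u \<in> set (signed_sums ?vs)"
    have "bounded (u ` T)"
      using Cons.prems(3) by (intro bounded_signed_sums[OF u]) auto
    then show "rad_avg (\<lambda>v. exp (SUP t\<in>T. (\<psi> t + u t) + v t)) [\<phi> x]
        \<le> rad_avg (\<lambda>v. exp (SUP t\<in>T. (\<psi> t + u t) + v t)) (W x)"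
      using Cons.prems by (intro contraction_step T bounded_plus_comp) auto
  qed
  also have "\<dots> = rad_avg (\<lambda>v. rad_avg (\<lambda>u. exp (SUP t\<in>T. (\<psi> t + u t) + v t)) ?vs) (W x)"
    by (rule rad_avg_swap)
  also have "\<dots> = rad_avg (\<lambda>u. exp (SUP t\<in>T. \<psi> t + u t)) (concat (map W (x # xs)))"
    by (simp add: rad_avg_append algebra_simps)
  finally show ?case .
qed simp

subsection \<open>Path norms of residual networks\<close>

definition layer_matrix :: "((real^'D^'m) \<times> (real^'m^'D::finite)) list \<Rightarrow> real^'D^'D" where
  "layer_matrix Ls = foldr (\<lambda>(W, U) P. P ** (mat 1 + 3 *\<^sub>R (absm U ** absm W))) Ls (mat 1)"

text \<open>The weighted path sums that end in the individual coordinates of the last hidden state;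
  here \<open>1\<close> is the all-ones vector. The output vector is kept apart because the
  recursion over the layers replaces it by rows of \<open>W\<close>.\<close>

definition path_weight :: "(real^'d^'D::finite) \<Rightarrow> ((real^'D^'m) \<times> (real^'m^'D)) list \<Rightarrow> real^'D" where
  "path_weight V Ls = layer_matrix Ls *v (absm V *v 1)"

text \<open>Appending a last layer changes the initial accumulator of the \<open>foldr\<close>; this
  moves it out as a left factor.\<close>

lemma foldr_matrix_mult:
  fixes P :: "real^'D^'D::finite"
  shows "foldr (\<lambda>x P. P ** f x) Ls P = P ** foldr (\<lambda>x P. P ** f x) Ls (mat 1)"
proof (induction Ls)
  case (Cons x Ls)
  show ?case by (simp add: Cons[of] matrix_mul_assoc)
qed simp

lemma layer_matrix_snoc:
  "layer_matrix (Ls @ [(W, U)]) = (mat 1 + 3 *\<^sub>R (absm U ** absm W)) ** layer_matrix Ls"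
  unfolding layer_matrix_def
  using foldr_matrix_mult[of "\<lambda>x. mat 1 + 3 *\<^sub>R (absm (snd x) ** absm (fst x))" Ls
      "mat 1 + 3 *\<^sub>R (absm U ** absm W)"]
  by (simp add: case_prod_unfold)

lemma path_weight_snoc:
  "path_weight V (Ls @ [(W, U)])
    = path_weight V Ls + 3 *\<^sub>R (absm U *v (absm W *v path_weight V Ls))"
  by (simp add: path_weight_def layer_matrix_snoc matrix_vector_mul_assoc[symmetric]
      matrix_vector_mult_add_rdistrib scaleR_matrix_vector_assoc[symmetric])

lemma path_weight_nonneg: "0 \<le> path_weight V Ls $ i"
proof (induction Ls arbitrary: i rule: rev_induct)
  case Nil
  show ?case
    by (auto simp: path_weight_def layer_matrix_def)
      (auto simp: matrix_vector_mult_def absm_def intro!: sum_nonneg)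
next
  case (snoc x Ls)
  then show ?case
    by (cases x) (auto simp: path_weight_snoc matrix_vector_mult_def absm_def
        intro!: add_nonneg_nonneg sum_nonneg mult_nonneg_nonneg)
qed

lemma layer_matrix_nonneg: "0 \<le> layer_matrix Ls $ i $ j"
proof (induction Ls arbitrary: i j rule: rev_induct)
  case Nil
  show ?case by (simp add: layer_matrix_def mat_def)
next
  case (snoc x Ls)
  then show ?case
    by (cases x) (auto simp: layer_matrix_snoc matrix_matrix_mult_def absm_def mat_def
        intro!: add_nonneg_nonneg sum_nonneg mult_nonneg_nonneg)
qed

text \<open>All entries of the row vector are nonnegative, so its 1-norm is the pairing with the
  all-ones vector, and the matrix product can be evaluated from the input side.\<close>

lemma path_norm_eq: "path_norm (u, V, Ls) = absv u \<bullet> path_weight V Ls"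
proof -
  let ?z = "(absv u v* layer_matrix Ls) v* absm V"
  have nonneg: "0 \<le> ?z $ j" for j
    by (auto simp: vector_matrix_mult_def absm_def absv_def intro!: sum_nonneg mult_nonneg_nonneg
        layer_matrix_nonneg)
  have "path_norm (u, V, Ls) = (\<Sum>j\<in>UNIV. ?z $ j)"
    unfolding path_norm_def layer_matrix_def[symmetric]
    using nonneg by simp
  also have "\<dots> = ?z \<bullet> 1"
    by (simp add: inner_vec_def)
  also have "\<dots> = absv u \<bullet> path_weight V Ls"
    by (simp add: path_weight_def dot_lmul_matrix)
  finally show ?thesis .
qed

lemma path_norm_nonneg: "0 \<le> path_norm \<theta>"
  by (cases \<theta>) (auto simp: path_norm_eq inner_vec_def absv_def path_weight_nonneg intro!: sum_nonneg)

lemma path_norm_scale: "path_norm (c *\<^sub>R u, V, Ls) = \<bar>c\<bar> * path_norm (u, V, Ls)"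
  by (simp add: path_norm_eq inner_vec_def absv_def abs_mult sum_distrib_left mult.assoc)

lemma resnet_scale: "resnet (c *\<^sub>R u, V, Ls) x = c * resnet (u, V, Ls) x"
  by (simp add: resnet_def)

lemma inner_matrix_vector_mult:
  fixes u :: "real^'n::finite"
  shows "u \<bullet> (U *v z) = (\<Sum>k\<in>UNIV. (u v* U) $ k * z $ k)"
  unfolding dot_lmul_matrix[symmetric] by (simp add: inner_vec_def)

text \<open>Each row \<open>W $ k\<close> is the output vector of a network on the earlier layers.
  The path norm therefore follows the recursion of the network itself in \<open>resnet_snoc\<close>,
  with weight 3 on the rectified terms.\<close>

lemma path_norm_snoc:
  "path_norm (u, V, Ls @ [(W, U)]) = path_norm (u, V, Ls)
    + 3 * (\<Sum>k\<in>UNIV. (absv u v* absm U) $ k * path_norm (W $ k, V, Ls))"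
proof -
  have row: "(absm W *v p) $ k = absv (W $ k) \<bullet> p" for p k
    by (simp add: matrix_vector_mult_def inner_vec_def absm_def absv_def)
  show ?thesis
    by (simp add: path_norm_eq path_weight_snoc inner_add_right row inner_matrix_vector_mult)
qed

lemma resnet_snoc:
  "resnet (u, V, Ls @ [(W, U)]) x = resnet (u, V, Ls) x
    + (\<Sum>k\<in>UNIV. (u v* U) $ k * max (resnet (W $ k, V, Ls) x) 0)"
proof -
  have row: "(W *v p) $ k = W $ k \<bullet> p" for p k
    by (simp add: matrix_vector_mult_def inner_vec_def)
  show ?thesis
    by (simp add: resnet_def inner_add_right relu_vec_def row inner_matrix_vector_mult)
qed

lemma abs_vector_matrix_mult_le: "\<bar>(u v* U) $ k\<bar> \<le> (absv u v* absm U) $ k"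
  unfolding vector_matrix_mult_def absv_def absm_def
  by (auto intro!: order_trans[OF sum_abs] sum_mono simp: abs_mult)

text \<open>The factor 3 in the path norm leaves room for the weak bound on rectified networks.\<close>
lemma abs_functional_resnet_le:
  fixes F :: "(real^'d::finite \<Rightarrow> real) \<Rightarrow> real" and \<theta> :: "('d, 'm::finite, 'D::finite) rparams"
  assumes add: "\<And>f g. F (\<lambda>x. f x + g x) = F f + F g"
    and scale: "\<And>c f. F (\<lambda>x. c * f x) = c * F f"
    and coord: "\<And>j. \<bar>F (\<lambda>x. x $ j)\<bar> \<le> X"
    and relu: "\<And>\<theta> :: ('d, 'm, 'D) rparams. \<bar>F (resnet \<theta>)\<bar> \<le> X * path_norm \<theta> \<Longrightarrow>
        \<bar>F (\<lambda>x. max (resnet \<theta> x) 0)\<bar> \<le> 3 * X * path_norm \<theta>"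
  shows "\<bar>F (resnet \<theta>)\<bar> \<le> X * path_norm \<theta>"
proof -
  have zero: "F (\<lambda>x. 0) = 0"
    using scale[of 0] by simp
  have F_sum: "F (\<lambda>x. \<Sum>k\<in>I. c k * f k x) = (\<Sum>k\<in>I. c k * F (f k))" if "finite I"
    for I :: "'i set" and c f
    using that by (induction I) (simp_all add: zero add scale)
  have "0 \<le> X" using coord[of undefined] by linarith
  have "\<bar>F (resnet (u, V, Ls))\<bar> \<le> X * path_norm (u, V, Ls)"
    for u :: "real^'D" and V :: "real^'d^'D" and Ls :: "((real^'D^'m) \<times> (real^'m^'D)) list"
  \<comment> \<open>The output vector varies because the induction hypothesis is also used for the
    rows \<open>W $ k\<close>, as the input required by \<open>relu\<close>.\<close>
  proof (induction Ls arbitrary: u rule: rev_induct)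
    case Nil
    have eq: "resnet (u, V, []) = (\<lambda>x. \<Sum>j\<in>UNIV. (u v* V) $ j * x $ j)"
      by (simp add: resnet_def inner_matrix_vector_mult fun_eq_iff)
    have "\<bar>F (resnet (u, V, []))\<bar> \<le> (\<Sum>j\<in>UNIV. \<bar>(u v* V) $ j\<bar> * \<bar>F (\<lambda>x. x $ j)\<bar>)"
      unfolding eq by (subst F_sum) (auto intro!: order_trans[OF sum_abs] simp: abs_mult)
    also have "\<dots> \<le> (\<Sum>j\<in>UNIV. (absv u v* absm V) $ j * X)"
      by (intro sum_mono mult_mono coord abs_vector_matrix_mult_le)
        (auto simp: vector_matrix_mult_def absv_def absm_def intro!: sum_nonneg)
    also have "\<dots> = X * ((absv u v* absm V) \<bullet> 1)"
      by (simp add: inner_vec_def sum_distrib_left mult.commute)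
    finally show ?case
      by (simp add: path_norm_eq path_weight_def layer_matrix_def dot_lmul_matrix)
  next
    case (snoc l Ls)
    obtain W U where l: "l = (W, U)" by (cases l)
    define w where "w k = (absv u v* absm U) $ k" for k
    have eq: "resnet (u, V, Ls @ [l]) = (\<lambda>x. resnet (u, V, Ls) x
        + (\<Sum>k\<in>UNIV. (u v* U) $ k * max (resnet (W $ k, V, Ls) x) 0))"
      by (simp add: l resnet_snoc fun_eq_iff)
    have "\<bar>F (resnet (u, V, Ls @ [l]))\<bar> \<le> \<bar>F (resnet (u, V, Ls))\<bar>
        + (\<Sum>k\<in>UNIV. \<bar>(u v* U) $ k\<bar> * \<bar>F (\<lambda>x. max (resnet (W $ k, V, Ls) x) 0)\<bar>)"
      unfolding eq add
      by (subst F_sum) (auto intro!: order_trans[OF abs_triangle_ineq] order_trans[OF sum_abs]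
          simp: abs_mult)
    also have "\<dots> \<le> X * path_norm (u, V, Ls)
        + (\<Sum>k\<in>UNIV. w k * (3 * X * path_norm (W $ k, V, Ls)))"
      unfolding w_def
      by (intro add_mono snoc sum_mono mult_mono abs_vector_matrix_mult_le relu)
        (auto simp: vector_matrix_mult_def absv_def absm_def intro!: sum_nonneg)
    also have "\<dots> = X * path_norm (u, V, Ls @ [l])"
      by (simp add: l path_norm_snoc w_def algebra_simps sum_distrib_left)
    finally show ?case .
  qed
  then show ?thesis by (cases \<theta>) auto
qed

text \<open>The functional is evaluation at a point, with bound 1 on every coordinate. Rectification
  does not increase absolute values, well within the allowed factor 3.\<close>

lemma abs_resnet_le:
  assumes "\<And>j. \<bar>x $ j\<bar> \<le> 1"
  shows "\<bar>resnet (\<theta> :: ('a::finite, 'b::finite, 'c::finite) rparams) x\<bar> \<le> path_norm \<theta>"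
proof -
  have "\<bar>(\<lambda>f. f x) (resnet \<theta>)\<bar> \<le> 1 * path_norm \<theta>"
  proof (rule abs_functional_resnet_le)
    fix \<theta> :: "('a, 'b, 'c) rparams"
    assume "\<bar>resnet \<theta> x\<bar> \<le> 1 * path_norm \<theta>"
    then show "\<bar>max (resnet \<theta> x) 0\<bar> \<le> 3 * 1 * path_norm \<theta>"
      using path_norm_nonneg[of \<theta>] by auto
  qed (use assms in auto)
  then show ?thesis by simp
qed

text \<open>The depth is left free: unrolling a layer produces networks on a shorter list of layers,
  and the class can only bound itself if it contains their normalizations.\<close>

definition unit_resnets :: "('d::finite, 'm::finite, 'D::finite) rparams itself \<Rightarrow> (real^'d \<Rightarrow> real) set" where
  "unit_resnets _ = resnet ` {\<theta> :: ('d, 'm, 'D) rparams. path_norm \<theta> \<le> 1}"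

lemma unit_resnets_nonempty: "unit_resnets TYPE(('d::finite, 'm::finite, 'D::finite) rparams) \<noteq> {}"
proof -
  have "path_norm (0 :: real^'D, 0 :: real^'d^'D, [] :: ((real^'D^'m) \<times> (real^'m^'D)) list) \<le> 1"
    by (simp add: path_norm_eq absv_def inner_vec_def)
  then show ?thesis unfolding unit_resnets_def by blast
qed

lemma unit_resnets_le:
  assumes "g \<in> unit_resnets TYPE(('d::finite, 'm::finite, 'D::finite) rparams)" "\<And>j. \<bar>x $ j\<bar> \<le> 1"
  shows "\<bar>g x\<bar> \<le> 1"
  using assms by (auto simp: unit_resnets_def intro!: order_trans[OF abs_resnet_le])

text \<open>Homogeneity in the output vector. If the path norm is 0, no rescaling is possible, but
  then the network vanishes on \<open>X\<close> by \<open>abs_resnet_le\<close> and can serve as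
  \<open>g\<close> itself; this is why the identity is stated on \<open>X\<close>.\<close>

lemma resnet_normalize:
  fixes \<theta> :: "('d::finite, 'm::finite, 'D::finite) rparams"
  assumes "\<And>x j. x \<in> X \<Longrightarrow> \<bar>x $ j\<bar> \<le> 1"
  obtains g where "g \<in> unit_resnets TYPE(('d, 'm, 'D) rparams)"
    "\<And>x. x \<in> X \<Longrightarrow> resnet \<theta> x = path_norm \<theta> * g x"
proof (cases "path_norm \<theta> = 0")
  case True
  then have "resnet \<theta> \<in> unit_resnets TYPE(('d, 'm, 'D) rparams)"
    by (auto simp: unit_resnets_def)
  moreover have "resnet \<theta> x = path_norm \<theta> * resnet \<theta> x" if "x \<in> X" for x
    using True abs_resnet_le[of x \<theta>] assms[OF that] by auto
  ultimately show thesis by (rule that)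
next
  case False
  obtain u V Ls where \<theta>: "\<theta> = (u, V, Ls)" by (cases \<theta>)
  let ?\<theta> = "(inverse (path_norm \<theta>) *\<^sub>R u, V, Ls)"
  have "path_norm ?\<theta> \<le> 1"
    using False path_norm_nonneg[of \<theta>] by (simp add: path_norm_scale \<theta>)
  then have "resnet ?\<theta> \<in> unit_resnets TYPE(('d, 'm, 'D) rparams)"
    unfolding unit_resnets_def by blast
  moreover have "resnet \<theta> x = path_norm \<theta> * resnet ?\<theta> x" for x
    using False by (simp add: resnet_scale) (simp add: \<theta>)
  ultimately show thesis by (rule that)
qed

section \<open>Signed sums of point evaluations as linear functionals\<close>

lemma signed_evals_repr:
  assumes "u \<in> set (signed_sums (map (\<lambda>x f. f x) xs))"
  obtains \<epsilon> :: "nat \<Rightarrow> real" where "\<And>i. \<bar>\<epsilon> i\<bar> = 1" "\<And>f. u f = (\<Sum>i<length xs. \<epsilon> i * f (xs ! i))"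
proof -
  obtain \<epsilon> :: "nat \<Rightarrow> real" where \<epsilon>: "\<forall>i. \<bar>\<epsilon> i\<bar> = 1"
    "u = (\<lambda>f. \<Sum>i<length xs. \<epsilon> i * (map (\<lambda>x f. f x) xs ! i) f)"
    using signed_sums_repr[OF assms] by auto
  show thesis
    by (rule that[of \<epsilon>]) (use \<epsilon> in auto)
qed

lemma signed_evals_add:
  assumes "u \<in> set (signed_sums (map (\<lambda>x f. f x) xs))"
  shows "u (\<lambda>x. f x + g x) = u f + u g"
  using assms by (elim signed_evals_repr) (simp add: distrib_left sum.distrib)

lemma signed_evals_scale:
  assumes "u \<in> set (signed_sums (map (\<lambda>x f. f x) xs))"
  shows "u (\<lambda>x. c * f x) = c * u f"
  using assms by (elim signed_evals_repr) (simp add: sum_distrib_left mult.left_commute)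

lemma signed_evals_cong:
  assumes "u \<in> set (signed_sums (map (\<lambda>x f. f x) xs))" "\<And>x. x \<in> set xs \<Longrightarrow> f x = g x"
  shows "u f = u g"
  using assms(1)
proof (elim signed_evals_repr)
  fix \<epsilon> :: "nat \<Rightarrow> real" assume "\<And>f. u f = (\<Sum>i<length xs. \<epsilon> i * f (xs ! i))"
  then show ?thesis using assms(2) by simp
qed

lemma abs_signed_evals_le:
  assumes "u \<in> set (signed_sums (map (\<lambda>x f. f x) xs))" "\<And>x. x \<in> set xs \<Longrightarrow> \<bar>f x\<bar> \<le> 1"
  shows "\<bar>u f\<bar> \<le> length xs"
  using assms(1)
proof (elim signed_evals_repr)
  fix \<epsilon> :: "nat \<Rightarrow> real"
  assume \<epsilon>: "\<And>i. \<bar>\<epsilon> i\<bar> = 1" "\<And>f. u f = (\<Sum>i<length xs. \<epsilon> i * f (xs ! i))"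
  have "\<bar>u f\<bar> \<le> (\<Sum>i<length xs. 1)"
    unfolding \<epsilon>(2) by (intro order_trans[OF sum_abs] sum_mono) (use \<epsilon>(1) assms(2) in \<open>auto simp: abs_mult\<close>)
  then show ?thesis by simp
qed

subsection \<open>Exponential moments for networks of bounded path norm\<close>

text \<open>The inequality between arithmetic and geometric mean for e^x, 1 and 1.\<close>

lemma exp_third_le: "exp (x / 3) \<le> (exp (x :: real) + 2) / 3"
proof -
  define z where "z = exp (x / 3)"
  have "exp x = z ^ 3"
    by (simp add: z_def flip: exp_of_nat_mult)
  moreover have "0 \<le> (z - 1)\<^sup>2 * (z + 2)"
    unfolding z_def by (simp add: add_nonneg_nonneg)
  moreover have "(z - 1)\<^sup>2 * (z + 2) = z ^ 3 + 2 - 3 * z"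
    by (simp add: power2_eq_square power3_eq_cube algebra_simps)
  ultimately show ?thesis
    unfolding z_def[symmetric] by simp
qed

text \<open>The class of networks of path norm at most 1 bounds itself: every signed sum over it is
  dominated by a signed sum of coordinates or by a third of a signed sum over rectified members,
  and contraction brings the latter back to the class.  Since $e^{x/3} \<le> (e^x + 2)/3$, the
  exponential moment $M$ satisfies $M \<le> B + \frac23 M + \frac43$.\<close>
lemma rad_avg_unit_resnets:
  fixes xs :: "(real^'d::finite) list"
  assumes xs: "\<And>x j. x \<in> set xs \<Longrightarrow> \<bar>x $ j\<bar> \<le> 1" and \<mu>: "0 \<le> \<mu>"
  defines "K \<equiv> unit_resnets TYPE(('d, 'm::finite, 'D::finite) rparams)"
  shows "rad_avg (\<lambda>u. exp (SUP g\<in>K. \<mu> * \<bar>u g\<bar>)) (map (\<lambda>x f. f x) xs)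
    \<le> 5 * (2 * CARD('d) * exp (\<mu>\<^sup>2 / 2 * length xs))"
proof -
  define E where "E = map (\<lambda>x (f :: real^'d \<Rightarrow> real). f x) xs"
  define relu where "relu g = (\<lambda>x. max (g x) 0)" for g :: "real^'d \<Rightarrow> real"
  define c where "c = \<mu> / 3"
  define B where "B = 2 * CARD('d) * exp (\<mu>\<^sup>2 / 2 * length xs)"
  define Z where "Z u = (SUP g\<in>K. \<mu> * \<bar>u g\<bar>)" for u
  define Y where "Y u = (SUP g\<in>K. c * \<bar>u (relu g)\<bar>)" for u
  define M where "M = rad_avg (\<lambda>u. exp (Z u)) E"
  have "0 \<le> c" using \<mu> by (simp add: c_def)
  have K_ne: "K \<noteq> {}"
    unfolding K_def by (rule unit_resnets_nonempty)
  have K_le: "\<bar>g x\<bar> \<le> 1" if "g \<in> K" "x \<in> set xs" for g x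
    by (rule unit_resnets_le[OF that(1)[unfolded K_def] xs[OF that(2)]])
  have relu_le: "\<bar>relu g x\<bar> \<le> 1" if "g \<in> K" "x \<in> set xs" for g x
    using K_le[OF that] unfolding relu_def by linarith
  have u_le: "\<bar>u g\<bar> \<le> length xs" "\<bar>u (relu g)\<bar> \<le> length xs"
    if "u \<in> set (signed_sums E)" "g \<in> K" for u g
    using abs_signed_evals_le[OF that(1)[unfolded E_def]] K_le[OF that(2)] relu_le[OF that(2)] by blast+
  have bdd: "bdd_above ((\<lambda>g. \<mu> * \<bar>u g\<bar>) ` K)" "bdd_above ((\<lambda>g. c * \<bar>u (relu g)\<bar>) ` K)"
     "bdd_above ((\<lambda>g. c * u (relu g)) ` K)" "bdd_above ((\<lambda>g. - (c * u (relu g))) ` K)"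
    if "u \<in> set (signed_sums E)" for u
  proof -
    have *: "\<mu> * \<bar>u g\<bar> \<le> \<mu> * length xs" "c * \<bar>u (relu g)\<bar> \<le> c * length xs"
       "c * u (relu g) \<le> c * length xs" "- (c * u (relu g)) \<le> c * length xs" if "g \<in> K" for g
    proof -
      note u = u_le[OF \<open>u \<in> set (signed_sums E)\<close> that]
      show "\<mu> * \<bar>u g\<bar> \<le> \<mu> * length xs" "c * \<bar>u (relu g)\<bar> \<le> c * length xs"
        by (rule mult_left_mono[OF u(1) \<mu>], rule mult_left_mono[OF u(2) \<open>0 \<le> c\<close>])
      show "c * u (relu g) \<le> c * length xs"
        by (rule mult_left_mono[OF abs_le_D1[OF u(2)] \<open>0 \<le> c\<close>])
      show "- (c * u (relu g)) \<le> c * length xs"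
        using mult_left_mono[OF abs_le_D2[OF u(2)] \<open>0 \<le> c\<close>] by simp
    qed
    show "bdd_above ((\<lambda>g. \<mu> * \<bar>u g\<bar>) ` K)" "bdd_above ((\<lambda>g. c * \<bar>u (relu g)\<bar>) ` K)"
     "bdd_above ((\<lambda>g. c * u (relu g)) ` K)" "bdd_above ((\<lambda>g. - (c * u (relu g))) ` K)"
      by (rule bdd_aboveI2, erule *)+
  qed
  have Z_le: "exp (Z u) \<le> (\<Sum>j\<in>UNIV. exp (\<mu> * \<bar>u (\<lambda>x. x $ j)\<bar>)) + exp (Y u)"
    if u: "u \<in> set (signed_sums E)" for u
  proof -
    note u' = u[unfolded E_def]
    \<comment> \<open>The bound \<open>X\<close> for \<open>abs_functional_resnet_le\<close>: it
      covers the coordinates directly, and since \<open>c\<close> is a third of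
      \<open>\<mu>\<close>, a bound \<open>m\<close> on \<open>Y u\<close> is a bound
      \<open>3 * m\<close> on the rectified members.\<close>
    define m where "m = max (MAX j. \<mu> * \<bar>u (\<lambda>x. x $ j)\<bar>) (Y u)"
    have coord: "\<bar>\<mu> * u (\<lambda>x. x $ j)\<bar> \<le> m" for j
      unfolding m_def abs_mult using \<mu> by (auto intro!: max.coboundedI1 Max_ge)
    have "0 \<le> m" using coord[of undefined] by linarith
    have relu: "\<bar>\<mu> * u (relu (resnet \<theta>))\<bar> \<le> 3 * m * path_norm \<theta>" for \<theta> :: "('d, 'm, 'D) rparams"
    proof -
      \<comment> \<open>\<open>Y\<close> controls only rectified members of \<open>K\<close>. As
        \<open>max\<close> with 0 is positively homogeneous, normalizing commutes with
        rectifying.\<close>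
      obtain g where g: "g \<in> K" "\<And>x. x \<in> set xs \<Longrightarrow> resnet \<theta> x = path_norm \<theta> * g x"
        unfolding K_def using resnet_normalize[of "set xs" \<theta>] xs by metis
      have "u (relu (resnet \<theta>)) = u (\<lambda>x. path_norm \<theta> * relu g x)"
      proof (rule signed_evals_cong[OF u'])
        fix x assume "x \<in> set xs"
        then show "relu (resnet \<theta>) x = path_norm \<theta> * relu g x"
          using path_norm_nonneg[of \<theta>] g(2)[of x]
          by (auto simp: relu_def max_def mult_le_0_iff zero_le_mult_iff)
      qed
      then have eq: "u (relu (resnet \<theta>)) = path_norm \<theta> * u (relu g)"
        using signed_evals_scale[OF u', of "path_norm \<theta>" "relu g"] by simp
      have "c * \<bar>u (relu g)\<bar> \<le> m"
        unfolding m_def Y_def by (intro max.coboundedI2 cSUP_upper bdd u g)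
      then have "\<bar>\<mu> * u (relu g)\<bar> \<le> 3 * m"
        using \<mu> by (simp add: c_def abs_mult)
      from mult_right_mono[OF this path_norm_nonneg[of \<theta>]] show ?thesis
        using path_norm_nonneg[of \<theta>] by (simp add: eq abs_mult mult_ac)
    qed
    have "\<bar>\<mu> * u (resnet \<theta>)\<bar> \<le> m * path_norm \<theta>" for \<theta> :: "('d, 'm, 'D) rparams"
    proof (rule abs_functional_resnet_le[where F = "\<lambda>f. \<mu> * u f"])
      show "\<mu> * u (\<lambda>x. f x + g x) = \<mu> * u f + \<mu> * u g" for f g
        using signed_evals_add[OF u', of f g] by (simp add: distrib_left)
      show "\<mu> * u (\<lambda>x. a * f x) = a * (\<mu> * u f)" for a f
        using signed_evals_scale[OF u', of a f] by simp
      show "\<bar>\<mu> * u (\<lambda>x. max (resnet \<theta> x) 0)\<bar> \<le> 3 * m * path_norm \<theta>" for \<theta> :: "('d, 'm, 'D) rparams"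
        using relu[of \<theta>] unfolding relu_def .
    qed (rule coord)
    then have "\<mu> * \<bar>u g\<bar> \<le> m" if "g \<in> K" for g
    proof -
      obtain \<theta> :: "('d, 'm, 'D) rparams" where \<theta>: "g = resnet \<theta>" "path_norm \<theta> \<le> 1"
        using \<open>g \<in> K\<close> unfolding K_def unit_resnets_def by blast
      have "\<bar>\<mu> * u (resnet \<theta>)\<bar> \<le> m * path_norm \<theta>" by fact
      also have "\<dots> \<le> m * 1"
        using \<theta> \<open>0 \<le> m\<close> by (intro mult_left_mono) auto
      finally show ?thesis
        using \<theta> \<mu> by (simp add: abs_mult)
    qed
    then have "Z u \<le> m"
      unfolding Z_def by (intro cSUP_least K_ne)
    \<comment> \<open>The maximum \<open>m\<close> is attained, and \<open>exp\<close> of the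
      attaining quantity is one of the nonnegative summands.\<close>
    have "m \<in> insert (Y u) (range (\<lambda>j. \<mu> * \<bar>u (\<lambda>x. x $ j)\<bar>))"
      unfolding m_def using Max_in[of "range (\<lambda>j. \<mu> * \<bar>u (\<lambda>x. x $ j)\<bar>)"] by (auto simp: max_def)
    then have "exp m \<le> (\<Sum>j\<in>UNIV. exp (\<mu> * \<bar>u (\<lambda>x. x $ j)\<bar>)) + exp (Y u)"
    proof (elim insertE rangeE)
      fix j assume "m = \<mu> * \<bar>u (\<lambda>x. x $ j)\<bar>"
      then have "exp m \<le> (\<Sum>j\<in>UNIV. exp (\<mu> * \<bar>u (\<lambda>x. x $ j)\<bar>))"
        by (simp only:) (rule member_le_sum; simp)
      then show ?thesis by (simp add: add_increasing2)
    qed (simp add: sum_nonneg)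
    then show ?thesis
      using \<open>Z u \<le> m\<close> by (meson exp_le_cancel_iff order_trans)
  qed
  \<comment> \<open>Contraction concerns suprema without absolute value, so the absolute value is
    first split into two signed suprema. Reversing all signs shows later that both have the same
    average.\<close>
  have Y_le: "exp (Y u) \<le> exp (SUP g\<in>K. c * u (relu g)) + exp (SUP g\<in>K. - (c * u (relu g)))"
    if u: "u \<in> set (signed_sums E)" for u
    unfolding Y_def
  proof (rule exp_cSUP_le[OF K_ne])
    fix g assume g: "g \<in> K"
    have 1: "exp (c * u (relu g)) \<le> exp (SUP g\<in>K. c * u (relu g))"
      unfolding exp_le_cancel_iff by (intro cSUP_upper bdd u g)
    have 2: "exp (- (c * u (relu g))) \<le> exp (SUP g\<in>K. - (c * u (relu g)))"
      unfolding exp_le_cancel_iff by (intro cSUP_upper bdd u g)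
    have "c * \<bar>u (relu g)\<bar> = c * u (relu g) \<or> c * \<bar>u (relu g)\<bar> = - (c * u (relu g))"
      by (auto simp: abs_if)
    then show "exp (c * \<bar>u (relu g)\<bar>)
        \<le> exp (SUP g\<in>K. c * u (relu g)) + exp (SUP g\<in>K. - (c * u (relu g)))"
    proof (elim disjE)
      assume "c * \<bar>u (relu g)\<bar> = c * u (relu g)"
      then show ?thesis using add_mono[OF 1 exp_ge_zero] by (simp only: add_0_right)
    next
      assume "c * \<bar>u (relu g)\<bar> = - (c * u (relu g))"
      then show ?thesis using add_mono[OF exp_ge_zero 2] by (simp only: add_0_left)
    qed
  qed
  \<comment> \<open>Rectification is 1-Lipschitz and fixes 0, so a single feature per point suffices
    here and the average over its one sign is just the absolute value.\<close>
  have contr: "rad_avg (\<lambda>u. exp (SUP g\<in>K. c * u (relu g))) E \<le> rad_avg (\<lambda>u. exp (SUP g\<in>K. c * u g)) E"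
  proof -
    have bd: "bounded ((\<lambda>g. c * h g) ` K)" if "\<And>g. g \<in> K \<Longrightarrow> \<bar>h g\<bar> \<le> 1" for h :: "(real^'d \<Rightarrow> real) \<Rightarrow> real"
    proof -
      have "\<bar>c * h g\<bar> \<le> c * 1" if "g \<in> K" for g
        using \<open>0 \<le> c\<close> \<open>\<And>g. g \<in> K \<Longrightarrow> \<bar>h g\<bar> \<le> 1\<close>[OF that] unfolding abs_mult
        by (intro mult_mono) auto
      then show ?thesis by (auto intro!: boundedI)
    qed
    have "rad_avg (\<lambda>u. exp (SUP g\<in>K. c * u (relu g))) E
        = rad_avg (\<lambda>u. exp (SUP g\<in>K. 0 + u g)) (map (\<lambda>x g. c * relu g x) xs)"
    proof -
      have "map (\<lambda>x g. c * relu g x) xs = map (\<lambda>w g. c * w (relu g)) E"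
        by (simp add: E_def)
      then show ?thesis
        using rad_avg_map[of "\<lambda>u. exp (SUP g\<in>K. 0 + u g)" c relu E] by simp
    qed
    also have "\<dots> \<le> rad_avg (\<lambda>u. exp (SUP g\<in>K. 0 + u g)) (concat (map (\<lambda>x. [\<lambda>g. c * g x]) xs))"
    proof (rule rad_avg_contraction[OF K_ne])
      show "bounded ((\<lambda>g. c * relu g x) ` K)" if "x \<in> set xs" for x
        using relu_le that by (intro bd) auto
      show "bounded (w ` K)" if "x \<in> set xs" "w \<in> set [\<lambda>g. c * g x]" for x w
        using that K_le by (auto intro!: bd)
      show "\<bar>c * relu t x - c * relu t' x\<bar> \<le> rad_avg (\<lambda>u. \<bar>u t - u t'\<bar>) [\<lambda>g. c * g x]" for x t t'
      proof -
        have "\<bar>c * (relu t x - relu t' x)\<bar> \<le> \<bar>c * (t x - t' x)\<bar>"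
          unfolding abs_mult relu_def by (intro mult_left_mono) auto
        then show ?thesis by (simp add: rad_avg_Cons algebra_simps abs_minus_commute)
      qed
      show "\<bar>c * relu t x\<bar> \<le> rad_avg (\<lambda>u. \<bar>u t\<bar>) [\<lambda>g. c * g x]" for x t
      proof -
        have "\<bar>c * relu t x\<bar> \<le> \<bar>c * t x\<bar>"
          unfolding abs_mult relu_def by (intro mult_left_mono) auto
        then show ?thesis by (simp add: rad_avg_Cons)
      qed
    qed (simp add: image_constant_conv)
    also have "concat (map (\<lambda>x. [\<lambda>g. c * g x]) xs) = map (\<lambda>w g. c * w (id g)) E"
      by (simp add: E_def)
    also have "rad_avg (\<lambda>u. exp (SUP g\<in>K. 0 + u g)) \<dots> = rad_avg (\<lambda>u. exp (SUP g\<in>K. c * u g)) E"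
      using rad_avg_map[of "\<lambda>u. exp (SUP g\<in>K. 0 + u g)" c id E] by simp
    finally show ?thesis .
  qed
  have third: "rad_avg (\<lambda>u. exp (SUP g\<in>K. c * u g)) E \<le> (M + 2) / 3"
  proof -
    have "exp (SUP g\<in>K. c * u g) \<le> (exp (Z u) + 2) / 3" if u: "u \<in> set (signed_sums E)" for u
    proof (rule order_trans[OF _ exp_third_le], rule exp_cSUP_le[OF K_ne])
      fix g assume "g \<in> K"
      have "\<mu> * \<bar>u g\<bar> \<le> Z u"
        unfolding Z_def by (intro cSUP_upper bdd u) fact
      moreover have "\<mu> * u g \<le> \<mu> * \<bar>u g\<bar>"
        using \<mu> by (intro mult_left_mono) auto
      ultimately show "exp (c * u g) \<le> exp (Z u / 3)"
        by (simp add: c_def)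
    qed
    from rad_avg_mono[OF this] show ?thesis
      by (simp add: M_def rad_avg_add rad_avg_divide rad_avg_const)
  qed
  have coords: "rad_avg (\<lambda>u. \<Sum>j\<in>UNIV. exp (\<mu> * \<bar>u (\<lambda>x. x $ j)\<bar>)) E \<le> B"
  proof -
    have "rad_avg (\<lambda>u. exp (\<mu> * \<bar>u (\<lambda>x. x $ j)\<bar>)) E \<le> 2 * exp (\<mu>\<^sup>2 / 2 * length E)" for j
      by (intro rad_avg_exp_abs) (use xs in \<open>auto simp: E_def\<close>)
    then have "(\<Sum>j\<in>UNIV. rad_avg (\<lambda>u. exp (\<mu> * \<bar>u (\<lambda>x. x $ j)\<bar>)) E)
        \<le> (\<Sum>j\<in>(UNIV :: 'd set). 2 * exp (\<mu>\<^sup>2 / 2 * length E))"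
      by (intro sum_mono)
    then show ?thesis
      by (simp add: rad_avg_sum B_def E_def)
  qed
  have "M \<le> rad_avg (\<lambda>u. (\<Sum>j\<in>UNIV. exp (\<mu> * \<bar>u (\<lambda>x. x $ j)\<bar>))
      + (exp (SUP g\<in>K. c * u (relu g)) + exp (SUP g\<in>K. - (c * u (relu g))))) E"
    unfolding M_def by (intro rad_avg_mono order_trans[OF Z_le] add_left_mono Y_le)
  also have "\<dots> \<le> B + ((M + 2) / 3 + (M + 2) / 3)"
    using coords contr third rad_avg_minus[of "\<lambda>u. exp (SUP g\<in>K. c * u (relu g))" E]
    unfolding rad_avg_add mult_minus_right by linarith
  finally have "M \<le> 3 * B + 4" by (simp add: field_simps)
  \<comment> \<open>Solving the self-bound gives 3 B + 4, and 4 <= 2 B turns this into the constant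
    5 of the statement.\<close>
  moreover have "2 \<le> B"
  proof -
    have "1 * 1 \<le> real CARD('d) * exp (\<mu>\<^sup>2 / 2 * length xs)"
      by (intro mult_mono) (auto simp: Suc_le_eq)
    then show ?thesis by (simp add: B_def)
  qed
  ultimately show ?thesis
    by (simp add: M_def Z_def E_def B_def)
qed

text \<open>A function that is identically 0 contributes the same under either sign, so its sign
  averages out.\<close>

lemma rad_avg_filter:
  "rad_avg \<Phi> (map (\<lambda>x t. if P x then e x t else 0) xs) = rad_avg \<Phi> (map e (filter P xs))"
proof (induction xs arbitrary: \<Phi>)
  case (Cons x xs)
  show ?case by (simp add: rad_avg_Cons Cons)
qed simp

text \<open>The index 0 is not an action; it carries a constant feature that accounts for the reward.\<close>
definition net_family :: "(nat \<Rightarrow> ('d::finite, 'm::finite, 'D::finite) rparams) \<Rightarrow> nat \<Rightarrow> real^'d \<Rightarrow> real" where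
  "net_family \<Theta> b = (if b = 0 then (\<lambda>_. 1/2) else resnet (\<Theta> b))"

lemma net_family_0: "net_family \<Theta> 0 = (\<lambda>_. 1/2)"
  by (simp add: net_family_def)

text \<open>The path norms and the weight 1/2 of the constant feature add up to at most
  \<open>q + 1/2\<close>. Up to this factor a signed sum over the family is a combination, with
  nonnegative weights of total at most 1, of signed sums for one label each; so it is at most the
  largest of them. The suprema over different labels separate, and each sees at most
  \<open>N\<close> points. The final constant is 5 per action plus 1 for the constant feature, at
  most 6 per action.\<close>

lemma rad_avg_net_family:
  fixes ps :: "(nat \<times> (real^'d::finite)) list"
    and \<Theta> :: "'t \<Rightarrow> nat \<Rightarrow> ('d, 'm::finite, 'D::finite) rparams"
  assumes A: "finite A" "A \<noteq> {}" "0 \<notin> A" and T: "T \<noteq> {}"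
    and ps: "\<And>p. p \<in> set ps \<Longrightarrow> fst p \<in> insert 0 A" "\<And>p j. p \<in> set ps \<Longrightarrow> \<bar>snd p $ j\<bar> \<le> 1"
    and N: "\<And>b. b \<in> insert 0 A \<Longrightarrow> length (filter (\<lambda>p. fst p = b) ps) \<le> N"
    and q: "\<And>t. t \<in> T \<Longrightarrow> family_path_norm A (\<Theta> t) \<le> q"
    and \<beta>: "0 \<le> \<beta>"
  shows "rad_avg (\<lambda>u. exp (SUP t\<in>T. u t)) (map (\<lambda>(b, x) t. \<beta> * net_family (\<Theta> t) b x) ps)
    \<le> 6 * card A * (2 * CARD('d) * exp ((\<beta> * (q + 1/2))\<^sup>2 / 2 * N))"
proof -
  define \<mu> where "\<mu> = \<beta> * (q + 1/2)"
  define E where "E = map (\<lambda>p (f :: nat \<Rightarrow> real^'d \<Rightarrow> real). f (fst p) (snd p)) ps"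
  define K where "K = unit_resnets TYPE(('d, 'm, 'D) rparams)"
  \<comment> \<open>The family supported on one label. Applying a signed sum to it keeps only the
    points with that label.\<close>
  define emb where "emb b g = (\<lambda>b'. if b' = b then g else (\<lambda>_. 0))" for b :: nat and g :: "real^'d \<Rightarrow> real"
  define Z where "Z b u = (SUP g\<in>K. \<mu> * \<bar>u (emb b g)\<bar>)" for b u
  define Z0 where "Z0 u = \<mu> * \<bar>u (emb 0 (\<lambda>_. 1))\<bar>" for u
  define B where "B = 2 * CARD('d) * exp (\<mu>\<^sup>2 / 2 * N)"
  obtain t0 where "t0 \<in> T" using T by blast
  have fam_nonneg: "0 \<le> family_path_norm A \<Theta>'" for \<Theta>' :: "nat \<Rightarrow> ('d, 'm, 'D) rparams"
    unfolding family_path_norm_def by (intro sum_nonneg path_norm_nonneg)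
  have "0 \<le> q" using q[OF \<open>t0 \<in> T\<close>] fam_nonneg[of "\<Theta> t0"] by linarith
  have "0 \<le> \<mu>" using \<beta> \<open>0 \<le> q\<close> by (simp add: \<mu>_def)
  have K_ne: "K \<noteq> {}" unfolding K_def by (rule unit_resnets_nonempty)
  have K_le: "\<bar>g (snd p)\<bar> \<le> 1" if "g \<in> K" "p \<in> set ps" for g p
    by (rule unit_resnets_le[OF that(1)[unfolded K_def] ps(2)[OF that(2)]])
  have main: "exp (SUP t\<in>T. \<beta> * u (net_family (\<Theta> t))) \<le> (\<Sum>b\<in>A. exp (Z b u)) + exp (Z0 u)"
    if u: "u \<in> set (signed_sums E)" for u
  proof -
    obtain \<epsilon> :: "nat \<Rightarrow> real" where \<epsilon>: "\<And>i. \<bar>\<epsilon> i\<bar> = 1"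
      "\<And>f. u f = (\<Sum>i<length ps. \<epsilon> i * f (fst (ps ! i)) (snd (ps ! i)))"
    proof -
      obtain \<epsilon> :: "nat \<Rightarrow> real" where \<epsilon>: "\<forall>i. \<bar>\<epsilon> i\<bar> = 1" "u = (\<lambda>t. \<Sum>i<length E. \<epsilon> i * (E ! i) t)"
        using signed_sums_repr[OF u] by blast
      show thesis by (rule that[of \<epsilon>]) (use \<epsilon> in \<open>auto simp: E_def\<close>)
    qed
    have u_emb: "u (emb b g) = (\<Sum>i<length ps. if fst (ps ! i) = b then \<epsilon> i * g (snd (ps ! i)) else 0)" for b g
      unfolding \<epsilon>(2) emb_def by (intro sum.cong) auto
    have u_le: "\<bar>u (emb b g)\<bar> \<le> length ps" if "g \<in> K" for b g
    proof -
      have "\<bar>u (emb b g)\<bar> \<le> (\<Sum>i<length ps. 1)"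
        unfolding u_emb
        by (intro order_trans[OF sum_abs] sum_mono) (use \<epsilon>(1) K_le[OF that] in \<open>auto simp: abs_mult\<close>)
      then show ?thesis by simp
    qed
    have bdd: "bdd_above ((\<lambda>g. \<mu> * \<bar>u (emb b g)\<bar>) ` K)" for b
      by (rule bdd_aboveI2, rule mult_left_mono[OF u_le \<open>0 \<le> \<mu>\<close>])
    have decomp: "u f = (\<Sum>b\<in>insert 0 A. u (emb b (f b)))" for f
    proof -
      have "(\<Sum>b\<in>insert 0 A. u (emb b (f b)))
          = (\<Sum>i<length ps. \<Sum>b\<in>insert 0 A. if fst (ps ! i) = b then \<epsilon> i * f b (snd (ps ! i)) else 0)"
        unfolding u_emb by (rule sum.swap)
      also have "\<dots> = u f"
        unfolding \<epsilon>(2) using A(1) ps(1) by (intro sum.cong) (auto simp: sum.delta)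
      finally show ?thesis by simp
    qed
    have u_scale: "u (emb b (\<lambda>x. c * g x)) = c * u (emb b g)" for b c g
      unfolding u_emb sum_distrib_left by (intro sum.cong) auto
    have u_cong: "u (emb b f) = u (emb b g)" if "\<And>p. p \<in> set ps \<Longrightarrow> f (snd p) = g (snd p)" for b f g
      unfolding u_emb using that by (intro sum.cong) auto
    define m where "m = Max (insert (Z0 u) ((\<lambda>b. Z b u) ` A))"
    have m_ge: "Z0 u \<le> m" "\<And>b. b \<in> A \<Longrightarrow> Z b u \<le> m"
      unfolding m_def using A(1) by (auto intro!: Max_ge)
    have "0 \<le> m"
      using m_ge(1) \<open>0 \<le> \<mu>\<close> unfolding Z0_def by (meson abs_ge_zero mult_nonneg_nonneg order_trans)
    have net: "\<beta> * (q + 1/2) * u (emb b (resnet (\<Theta> t b))) \<le> path_norm (\<Theta> t b) * m" if "b \<in> A" for b t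
    proof -
      obtain g where g: "g \<in> K" "\<And>x. x \<in> snd ` set ps \<Longrightarrow> resnet (\<Theta> t b) x = path_norm (\<Theta> t b) * g x"
        unfolding K_def using resnet_normalize[of "snd ` set ps" "\<Theta> t b"] ps(2) by (metis imageE)
      have eq: "u (emb b (resnet (\<Theta> t b))) = path_norm (\<Theta> t b) * u (emb b g)"
        unfolding u_scale[symmetric] by (rule u_cong) (use g in auto)
      have "\<mu> * u (emb b g) \<le> \<mu> * \<bar>u (emb b g)\<bar>"
        using \<open>0 \<le> \<mu>\<close> by (intro mult_left_mono) auto
      also have "\<dots> \<le> Z b u"
        unfolding Z_def by (rule cSUP_upper[OF g(1) bdd])
      also have "\<dots> \<le> m" by (rule m_ge(2)[OF that])
      finally have "\<mu> * u (emb b g) \<le> m" .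
      from mult_left_mono[OF this path_norm_nonneg[of "\<Theta> t b"]] show ?thesis
        by (simp add: eq \<mu>_def mult_ac)
    qed
    have const: "\<beta> * (q + 1/2) * u (emb 0 (\<lambda>_. 1/2)) \<le> 1/2 * m"
    proof -
      have "\<mu> * u (emb 0 (\<lambda>_. 1/2)) = 1/2 * (\<mu> * u (emb 0 (\<lambda>_. 1)))"
        using u_scale[of 0 "1/2" "\<lambda>_. 1"] by simp
      moreover have "\<mu> * u (emb 0 (\<lambda>_. 1)) \<le> \<mu> * \<bar>u (emb 0 (\<lambda>_. 1))\<bar>"
        using \<open>0 \<le> \<mu>\<close> by (intro mult_left_mono) auto
      ultimately show ?thesis
        using m_ge(1) unfolding Z0_def \<mu>_def[symmetric] by linarith
    qed
    have "exp (SUP t\<in>T. \<beta> * u (net_family (\<Theta> t))) \<le> exp m"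
    proof (rule exp_cSUP_le[OF T])
      fix t assume t: "t \<in> T"
      have "u (net_family (\<Theta> t)) = u (emb 0 (\<lambda>_. 1/2)) + (\<Sum>b\<in>A. u (emb b (resnet (\<Theta> t b))))"
      proof -
        have "u (net_family (\<Theta> t)) = u (emb 0 (net_family (\<Theta> t) 0)) + (\<Sum>b\<in>A. u (emb b (net_family (\<Theta> t) b)))"
          using A by (subst decomp) simp
        also have "(\<Sum>b\<in>A. u (emb b (net_family (\<Theta> t) b))) = (\<Sum>b\<in>A. u (emb b (resnet (\<Theta> t b))))"
          using A(3) by (intro sum.cong refl arg_cong[of _ _ u] arg_cong2[of _ _ _ _ emb])
            (auto simp: net_family_def)
        finally show ?thesis by (simp only: net_family_0)
      qed
      \<comment> \<open>Both sides carry the factor \<open>q + 1/2\<close>, so that the weights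
        (path norms and 1/2) can be compared with \<open>q + 1/2\<close> before it is
        cancelled.\<close>
      then have "(q + 1/2) * (\<beta> * u (net_family (\<Theta> t)))
          = \<beta> * (q + 1/2) * u (emb 0 (\<lambda>_. 1/2)) + (\<Sum>b\<in>A. \<beta> * (q + 1/2) * u (emb b (resnet (\<Theta> t b))))"
        by (simp add: algebra_simps sum_distrib_left sum.distrib)
      also have "\<dots> \<le> 1/2 * m + (\<Sum>b\<in>A. path_norm (\<Theta> t b) * m)"
        by (intro add_mono const sum_mono net)
      also have "\<dots> = (family_path_norm A (\<Theta> t) + 1/2) * m"
        by (simp add: family_path_norm_def sum_distrib_right distrib_right)
      also have "\<dots> \<le> (q + 1/2) * m"
        using q[OF t] \<open>0 \<le> m\<close> by (intro mult_right_mono) auto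
      finally show "exp (\<beta> * u (net_family (\<Theta> t))) \<le> exp m"
        using \<open>0 \<le> q\<close> by (simp add: mult_le_cancel_left)
    qed
    also have "exp m \<le> (\<Sum>b\<in>A. exp (Z b u)) + exp (Z0 u)"
    proof -
      have "m \<in> insert (Z0 u) ((\<lambda>b. Z b u) ` A)"
        unfolding m_def using A(1) by (intro Max_in) auto
      then consider "m = Z0 u" | b where "b \<in> A" "m = Z b u" by blast
      then show ?thesis
      proof cases
        case 1
        then show ?thesis by (simp add: sum_nonneg)
      next
        case 2
        have "exp (Z b u) \<le> (\<Sum>b\<in>A. exp (Z b u))"
          using 2(1) A(1) by (intro member_le_sum) auto
        then show ?thesis using 2(2) by (simp add: add_increasing2)
      qed
    qed
    finally show ?thesis .
  qed
  \<comment> \<open>Points with a foreign label become zero entries, which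
    \<open>rad_avg_filter\<close> removes; this is how the exponent shrinks from the length of
    \<open>ps\<close> to \<open>N\<close>.\<close>
  have emb_E: "map (\<lambda>w g. 1 * w (emb b g)) E = map (\<lambda>p g. if fst p = b then g (snd p) else 0) ps" for b
    by (simp add: E_def emb_def fun_eq_iff)
  have exp_N: "exp (\<mu>\<^sup>2 / 2 * length (filter (\<lambda>p. fst p = b) ps)) \<le> exp (\<mu>\<^sup>2 / 2 * N)" if "b \<in> insert 0 A" for b
    using N[OF that] unfolding exp_le_cancel_iff by (intro mult_left_mono) auto
  have Z_avg: "rad_avg (\<lambda>u. exp (Z b u)) E \<le> 5 * B" if "b \<in> A" for b
  proof -
    define xs where "xs = map snd (filter (\<lambda>p. fst p = b) ps)"
    have "rad_avg (\<lambda>u. exp (Z b u)) E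
        = rad_avg (\<lambda>u. exp (SUP g\<in>K. \<mu> * \<bar>u g\<bar>)) (map (\<lambda>w g. 1 * w (emb b g)) E)"
      unfolding Z_def by (subst rad_avg_map) simp
    also have "\<dots> = rad_avg (\<lambda>u. exp (SUP g\<in>K. \<mu> * \<bar>u g\<bar>)) (map (\<lambda>x f. f x) xs)"
      unfolding emb_E rad_avg_filter by (simp add: xs_def comp_def)
    also have "\<dots> \<le> 5 * (2 * CARD('d) * exp (\<mu>\<^sup>2 / 2 * length xs))"
      unfolding K_def by (intro rad_avg_unit_resnets \<open>0 \<le> \<mu>\<close>) (use ps(2) in \<open>auto simp: xs_def\<close>)
    also have "\<dots> \<le> 5 * B"
      unfolding B_def xs_def length_map using exp_N[of b] that by (intro mult_left_mono) auto
    finally show ?thesis .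
  qed
  have Z0_avg: "rad_avg (\<lambda>u. exp (Z0 u)) E \<le> B"
  proof -
    define xs where "xs = map snd (filter (\<lambda>p. fst p = 0) ps)"
    have "rad_avg (\<lambda>u. exp (Z0 u)) E
        = rad_avg (\<lambda>u. exp (\<mu> * \<bar>u (\<lambda>_. 1)\<bar>)) (map (\<lambda>w g. 1 * w (emb 0 g)) E)"
      unfolding Z0_def by (subst rad_avg_map) simp
    also have "\<dots> = rad_avg (\<lambda>u. exp (\<mu> * \<bar>u (\<lambda>_. 1)\<bar>)) (map (\<lambda>x f. f x) xs)"
      unfolding emb_E rad_avg_filter by (simp add: xs_def comp_def)
    also have "\<dots> \<le> 2 * exp (\<mu>\<^sup>2 / 2 * length (map (\<lambda>x (f :: real^'d \<Rightarrow> real). f x) xs))"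
      by (intro rad_avg_exp_abs) auto
    also have "\<dots> = 2 * (1 * exp (\<mu>\<^sup>2 / 2 * length (filter (\<lambda>p. fst p = 0) ps)))"
      by (simp add: xs_def)
    also have "\<dots> \<le> 2 * (real CARD('d) * exp (\<mu>\<^sup>2 / 2 * N))"
      using exp_N[of 0] by (intro mult_left_mono mult_mono) (auto simp: Suc_le_eq)
    finally show ?thesis by (simp add: B_def)
  qed
  have "map (\<lambda>(b, x) t. \<beta> * net_family (\<Theta> t) b x) ps = map (\<lambda>w t. \<beta> * w (net_family (\<Theta> t))) E"
    by (simp add: E_def case_prod_unfold)
  then have "rad_avg (\<lambda>u. exp (SUP t\<in>T. u t)) (map (\<lambda>(b, x) t. \<beta> * net_family (\<Theta> t) b x) ps)
      = rad_avg (\<lambda>u. exp (SUP t\<in>T. \<beta> * u (net_family (\<Theta> t)))) E"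
    using rad_avg_map[of "\<lambda>u. exp (SUP t\<in>T. u t)" \<beta> "\<lambda>t. net_family (\<Theta> t)" E] by simp
  also have "\<dots> \<le> rad_avg (\<lambda>u. (\<Sum>b\<in>A. exp (Z b u)) + exp (Z0 u)) E"
    by (rule rad_avg_mono) (rule main)
  also have "\<dots> \<le> (\<Sum>b\<in>A. 5 * B) + B"
    unfolding rad_avg_add rad_avg_sum by (intro add_mono sum_mono Z_avg Z0_avg)
  also have "\<dots> \<le> 6 * card A * B"
  proof -
    have "1 \<le> card A" using A by (simp add: Suc_le_eq card_gt_0_iff)
    then have "1 * B \<le> card A * B"
      by (intro mult_right_mono) (auto simp: B_def)
    then show ?thesis by (simp add: mult_ac)
  qed
  finally show ?thesis by (simp add: B_def \<mu>_def)
qed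

subsection \<open>Symmetrization\<close>

lemma integral_rad_avg:
  assumes "\<And>u. u \<in> set (signed_sums vs) \<Longrightarrow> integrable M (\<lambda>x. \<Phi> x u)"
  shows "integrable M (\<lambda>x. rad_avg (\<Phi> x) vs)"
    and "(\<integral>x. rad_avg (\<Phi> x) vs \<partial>M) = rad_avg (\<lambda>u. \<integral>x. \<Phi> x u \<partial>M) vs"
proof -
  have "integrable M (\<lambda>x. sum_list (map (\<Phi> x) us)) \<and>
      (\<integral>x. sum_list (map (\<Phi> x) us) \<partial>M) = sum_list (map (\<lambda>u. \<integral>x. \<Phi> x u \<partial>M) us)"
    if "set us \<subseteq> set (signed_sums vs)" for us
    using that by (induction us) (auto simp: assms)
  from this[of "signed_sums vs"]
  show "integrable M (\<lambda>x. rad_avg (\<Phi> x) vs)"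
    and "(\<integral>x. rad_avg (\<Phi> x) vs \<partial>M) = rad_avg (\<lambda>u. \<integral>x. \<Phi> x u \<partial>M) vs"
    by (simp_all add: rad_avg_def)
qed

text \<open>Countability of \<open>T\<close> makes the supremum measurable, and the uniform bound
  makes its exponential bounded.\<close>

lemma (in prob_space) integrable_exp_cSUP:
  fixes h :: "'t \<Rightarrow> 'a \<Rightarrow> real"
  assumes T: "countable T" "T \<noteq> {}"
    and meas: "\<And>t. t \<in> T \<Longrightarrow> h t \<in> borel_measurable M"
    and bound: "\<And>t x. t \<in> T \<Longrightarrow> x \<in> space M \<Longrightarrow> \<bar>h t x\<bar> \<le> c"
  shows "integrable M (\<lambda>x. exp (SUP t\<in>T. h t x))"
proof (rule integrable_const_bound)
  show "AE x in M. norm (exp (SUP t\<in>T. h t x)) \<le> exp c"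
  proof (rule AE_I2)
    fix x assume "x \<in> space M"
    then have "(SUP t\<in>T. h t x) \<le> c"
      using bound by (intro cSUP_least T) (auto dest: abs_le_D1)
    then show "norm (exp (SUP t\<in>T. h t x)) \<le> exp c" by simp
  qed
  have "(\<lambda>x. SUP t\<in>T. h t x) \<in> borel_measurable M"
  proof (rule borel_measurable_cSUP[OF T(1) meas])
    fix x assume "x \<in> space M"
    then show "bdd_above ((\<lambda>t. h t x) ` T)"
      using bound by (intro bdd_aboveI2) (auto dest: abs_le_D1)
  qed
  then show "(\<lambda>x. exp (SUP t\<in>T. h t x)) \<in> borel_measurable M"
    by measurable
qed

text \<open>Symmetrization of one coordinate: halving the supremum as
  $\psi + (E\ell - \ell) = \frac12 (\psi + 2 E\ell) + \frac12 (\psi - 2\ell)$ avoids a ghost sample.\<close>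
lemma (in prob_space) exp_cSUP_centered_le:
  fixes l :: "'t \<Rightarrow> 'a \<Rightarrow> real"
  assumes T: "countable T" "T \<noteq> {}"
    and l: "\<And>t. t \<in> T \<Longrightarrow> l t \<in> borel_measurable M"
    and b: "\<And>t x. t \<in> T \<Longrightarrow> x \<in> space M \<Longrightarrow> \<bar>l t x\<bar> \<le> b"
    and \<psi>: "\<And>t. t \<in> T \<Longrightarrow> \<bar>\<psi> t\<bar> \<le> c"
  shows "expectation (\<lambda>y. exp (SUP t\<in>T. \<psi> t + (expectation (l t) - l t y)))
    \<le> expectation (\<lambda>y. rad_avg (\<lambda>u. exp (SUP t\<in>T. \<psi> t + u t)) [\<lambda>t. 2 * l t y])"
proof -
  have l_int: "integrable M (l t)" if "t \<in> T" for t
    using l b that by (intro integrable_const_bound[of _ b]) (auto intro!: AE_I2)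
  have E_le: "\<bar>expectation (l t)\<bar> \<le> b" if "t \<in> T" for t
  proof -
    have "norm (expectation (l t)) \<le> expectation (\<lambda>x. norm (l t x))"
      by (rule integral_norm_bound)
    also have "\<dots> \<le> expectation (\<lambda>_. b)"
      using b that l_int by (intro integral_mono_AE) (auto intro!: AE_I2)
    finally show ?thesis by (simp add: prob_space)
  qed
  have int1: "integrable M (\<lambda>y. exp (SUP t\<in>T. \<psi> t + (expectation (l t) - l t y)))"
  proof (rule integrable_exp_cSUP[OF T])
    show "\<bar>\<psi> t + (expectation (l t) - l t x)\<bar> \<le> c + 2 * b" if "t \<in> T" "x \<in> space M" for t x
      using \<psi>[of t] E_le[of t] b[of t x] that by linarith
  qed (use l in measurable)
  have int2: "integrable M (\<lambda>y. exp (SUP t\<in>T. \<psi> t + 2 * l t y))"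
  proof (rule integrable_exp_cSUP[OF T])
    show "\<bar>\<psi> t + 2 * l t x\<bar> \<le> c + 2 * b" if "t \<in> T" "x \<in> space M" for t x
      using \<psi>[of t] b[of t x] that by linarith
  qed (use l in measurable)
  have int3: "integrable M (\<lambda>y. exp (SUP t\<in>T. \<psi> t - 2 * l t y))"
  proof (rule integrable_exp_cSUP[OF T])
    show "\<bar>\<psi> t - 2 * l t x\<bar> \<le> c + 2 * b" if "t \<in> T" "x \<in> space M" for t x
      using \<psi>[of t] b[of t x] that by linarith
  qed (use l in measurable)
  define J where "J = exp (SUP t\<in>T. \<psi> t + 2 * expectation (l t))"
  have bdd1: "bdd_above ((\<lambda>t. \<psi> t + 2 * expectation (l t)) ` T)"
  proof (rule bdd_aboveI2)
    show "\<psi> t + 2 * expectation (l t) \<le> c + 2 * b" if "t \<in> T" for t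
      using \<psi>[OF that] E_le[OF that] by linarith
  qed
  have bdd2: "bdd_above ((\<lambda>t. \<psi> t + 2 * l t y) ` T)" "bdd_above ((\<lambda>t. \<psi> t - 2 * l t y) ` T)"
    if "y \<in> space M" for y
  proof -
    have *: "\<psi> t + 2 * l t y \<le> c + 2 * b" "\<psi> t - 2 * l t y \<le> c + 2 * b" if "t \<in> T" for t
      using \<psi>[OF that] b[OF that \<open>y \<in> space M\<close>] by linarith+
    show "bdd_above ((\<lambda>t. \<psi> t + 2 * l t y) ` T)" "bdd_above ((\<lambda>t. \<psi> t - 2 * l t y) ` T)"
      by (rule bdd_aboveI2, erule *)+
  qed
  \<comment> \<open>Jensen's inequality is applied for each fixed \<open>t\<close>; only then is the
    integrand enlarged to the supremum, and the resulting bound is uniform in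
    \<open>t\<close>.\<close>
  have J: "J \<le> expectation (\<lambda>y. exp (SUP t\<in>T. \<psi> t + 2 * l t y))"
    unfolding J_def
  proof (rule exp_cSUP_le[OF T(2)])
    fix t assume t: "t \<in> T"
    have int: "integrable M (\<lambda>y. exp (1 * (\<psi> t + 2 * l t y)))"
      using integrable_exp_cSUP[of "{t}" "\<lambda>t y. \<psi> t + 2 * l t y" "c + 2 * b"] l[OF t] \<psi>[OF t] b[OF t]
      by (fastforce simp: abs_le_iff)
    have "exp (1 * expectation (\<lambda>y. \<psi> t + 2 * l t y)) \<le> expectation (\<lambda>y. exp (1 * (\<psi> t + 2 * l t y)))"
      using int by (intro jensens_inequality[where I = UNIV] convex_on_exp) (auto intro!: l_int t)
    also have "expectation (\<lambda>y. \<psi> t + 2 * l t y) = \<psi> t + 2 * expectation (l t)"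
      using l_int[OF t] by (simp add: prob_space)
    also have "expectation (\<lambda>y. exp (1 * (\<psi> t + 2 * l t y)))
        \<le> expectation (\<lambda>y. exp (SUP t\<in>T. \<psi> t + 2 * l t y))"
    proof (rule integral_mono[OF int int2])
      fix y assume "y \<in> space M"
      then show "exp (1 * (\<psi> t + 2 * l t y)) \<le> exp (SUP t\<in>T. \<psi> t + 2 * l t y)"
        using cSUP_upper[OF t bdd2(1)] by simp
    qed
    finally show "exp (\<psi> t + 2 * expectation (l t))
        \<le> expectation (\<lambda>y. exp (SUP t\<in>T. \<psi> t + 2 * l t y))" by simp
  qed
  have "expectation (\<lambda>y. exp (SUP t\<in>T. \<psi> t + (expectation (l t) - l t y)))
      \<le> expectation (\<lambda>y. (J + exp (SUP t\<in>T. \<psi> t - 2 * l t y)) / 2)"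
  proof (rule integral_mono[OF int1])
    fix y assume y: "y \<in> space M"
    define X Y where "X = (SUP t\<in>T. \<psi> t + 2 * expectation (l t))" and "Y = (SUP t\<in>T. \<psi> t - 2 * l t y)"
    have "(SUP t\<in>T. \<psi> t + (expectation (l t) - l t y)) \<le> (X + Y) / 2"
    proof (rule cSUP_least[OF T(2)])
      fix t assume t: "t \<in> T"
      have "\<psi> t + 2 * expectation (l t) \<le> X" "\<psi> t - 2 * l t y \<le> Y"
        unfolding X_def Y_def by (rule cSUP_upper[OF t bdd1], rule cSUP_upper[OF t bdd2(2)[OF y]])
      then show "\<psi> t + (expectation (l t) - l t y) \<le> (X + Y) / 2"
        by (simp add: field_simps)
    qed
    then have "exp (SUP t\<in>T. \<psi> t + (expectation (l t) - l t y)) \<le> exp ((X + Y) / 2)" by simp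
    also have "\<dots> \<le> (exp X + exp Y) / 2"
    proof -
      have "exp ((X + Y) / 2) = exp (X / 2) * exp (Y / 2)"
        by (simp add: add_divide_distrib exp_add)
      moreover have "exp X = (exp (X / 2))\<^sup>2" "exp Y = (exp (Y / 2))\<^sup>2"
        by (simp_all flip: exp_double)
      ultimately show ?thesis
        using sum_squares_bound[of "exp (X / 2)" "exp (Y / 2)"] by simp
    qed
    finally show "exp (SUP t\<in>T. \<psi> t + (expectation (l t) - l t y))
        \<le> (J + exp (SUP t\<in>T. \<psi> t - 2 * l t y)) / 2"
      by (simp add: J_def X_def Y_def)
  qed (use int3 in simp)
  also have "\<dots> = (J + expectation (\<lambda>y. exp (SUP t\<in>T. \<psi> t - 2 * l t y))) / 2"
    using int3 by (simp add: prob_space)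
  also have "\<dots> \<le> (expectation (\<lambda>y. exp (SUP t\<in>T. \<psi> t + 2 * l t y))
      + expectation (\<lambda>y. exp (SUP t\<in>T. \<psi> t - 2 * l t y))) / 2"
    using J by simp
  \<comment> \<open>The two halves are the two values of one random sign in front of
    \<open>2 * l t y\<close>.\<close>
  also have "\<dots> = expectation (\<lambda>y. rad_avg (\<lambda>u. exp (SUP t\<in>T. \<psi> t + u t)) [\<lambda>t. 2 * l t y])"
    using int2 int3 by (simp add: rad_avg_Cons)
  finally show ?thesis .
qed

text \<open>The coordinates receive their signs one at a time, the last one first, hence
  \<open>rev\<close>. \<open>pre\<close> collects the terms that already carry a sign, at frozen
  sample points. Fubini lets the last coordinate be the inner variable while it is symmetrized and
  the outer one when the induction hypothesis is applied with its term moved into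
  \<open>pre\<close>.\<close>

lemma (in prob_space) symmetrization:
  fixes l :: "'t \<Rightarrow> 'a \<Rightarrow> real"
  assumes T: "countable T" "T \<noteq> {}"
    and l: "\<And>t. t \<in> T \<Longrightarrow> l t \<in> borel_measurable M"
    and b: "\<And>t x. t \<in> T \<Longrightarrow> x \<in> space M \<Longrightarrow> \<bar>l t x\<bar> \<le> b"
    and pre: "\<And>v. v \<in> set pre \<Longrightarrow> bounded (v ` T)"
    and C: "\<And>x. (\<And>i. i < n \<Longrightarrow> x i \<in> space M) \<Longrightarrow>
      rad_avg (\<lambda>u. exp (SUP t\<in>T. u t)) (pre @ map (\<lambda>i t. 2 * l t (x i)) (rev [0..<n])) \<le> C"
  shows "(\<integral>x. rad_avg (\<lambda>u. exp (SUP t\<in>T. u t + (\<Sum>i<n. expectation (l t) - l t (x i)))) pre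
      \<partial>PiM {..<n} (\<lambda>_. M)) \<le> C"
  using pre C
proof (induction n arbitrary: pre)
  case 0
  interpret P: prob_space "PiM {..<0::nat} (\<lambda>_. M)"
    by (intro prob_space_PiM prob_space_axioms)
  show ?case
    using 0(2)[of "\<lambda>_. undefined"] P.prob_space by (simp add: measure_def P.emeasure_space_1)
next
  case (Suc n)
  define S where "S t x = (\<Sum>i<n. expectation (l t) - l t (x i))" for t and x :: "nat \<Rightarrow> 'a"
  define P where "P = PiM {..<n} (\<lambda>_. M)"
  interpret product_sigma_finite "\<lambda>_::nat. M" ..
  interpret P: prob_space P
    unfolding P_def by (intro prob_space_PiM prob_space_axioms)
  interpret P': prob_space "PiM (insert n {..<n}) (\<lambda>_. M)"
    by (intro prob_space_PiM prob_space_axioms)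
  interpret PM: pair_prob_space P M ..
  define b' where "b' = (\<Sum>i<n. 2 * b)"
  have l_int: "integrable M (l t)" if "t \<in> T" for t
    using l b that by (intro integrable_const_bound[of _ b]) (auto intro!: AE_I2)
  have E_le: "\<bar>expectation (l t)\<bar> \<le> b" if "t \<in> T" for t
  proof -
    have "norm (expectation (l t)) \<le> expectation (\<lambda>x. norm (l t x))"
      by (rule integral_norm_bound)
    also have "\<dots> \<le> expectation (\<lambda>_. b)"
      using b that l_int by (intro integral_mono_AE) (auto intro!: AE_I2)
    finally show ?thesis by (simp add: prob_space)
  qed
  have cent_le: "\<bar>expectation (l t) - l t y\<bar> \<le> 2 * b" if "t \<in> T" "y \<in> space M" for t y
    using E_le[of t] b[of t y] that by linarith
  have S_le: "\<bar>S t x\<bar> \<le> b'" if "t \<in> T" "\<And>i. i < n \<Longrightarrow> x i \<in> space M" for t x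
    unfolding S_def b'_def by (intro order_trans[OF sum_abs] sum_mono cent_le that) auto
  have space_P: "x i \<in> space M" if "x \<in> space P" "i < n" for x i
    using that unfolding P_def by (auto simp: space_PiM)
  have S_meas: "S t \<in> borel_measurable P" if "t \<in> T" for t
  proof -
    have "(\<lambda>x. l t (x i)) \<in> borel_measurable P" if "i < n" for i
      unfolding P_def
      by (rule measurable_compose[OF _ l[OF \<open>t \<in> T\<close>]], rule measurable_component_singleton) (use that in simp)
    then show ?thesis unfolding S_def by (intro borel_measurable_sum) auto
  qed
  have u_bound: "\<exists>c. \<forall>t\<in>T. \<bar>u t\<bar> \<le> c" if "u \<in> set (signed_sums pre)" for u
    using bounded_signed_sums[OF that Suc.prems(1)] unfolding bounded_iff by auto
  define f where "f x = rad_avg (\<lambda>u. exp (SUP t\<in>T. u t + (\<Sum>i<Suc n. expectation (l t) - l t (x i)))) pre" for x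
  \<comment> \<open>The integrand after the centered loss at the last point has been traded for a
    random sign times \<open>2 * l t y\<close>; the earlier coordinates are still centered losses
    inside \<open>S\<close>.\<close>
  define G where "G x y = rad_avg (\<lambda>u. rad_avg (\<lambda>v. exp (SUP t\<in>T. (u t + S t x) + v t)) [\<lambda>t. 2 * l t y]) pre" for x y
  have f_int: "integrable (PiM (insert n {..<n}) (\<lambda>_. M)) f"
    unfolding f_def
  proof (rule integral_rad_avg(1))
    fix u assume "u \<in> set (signed_sums pre)"
    then obtain c where c: "\<And>t. t \<in> T \<Longrightarrow> \<bar>u t\<bar> \<le> c" using u_bound by blast
    show "integrable (PiM (insert n {..<n}) (\<lambda>_. M))
        (\<lambda>x. exp (SUP t\<in>T. u t + (\<Sum>i<Suc n. expectation (l t) - l t (x i))))"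
    proof (rule P'.integrable_exp_cSUP[OF T])
      fix t assume t: "t \<in> T"
      have "(\<lambda>x. l t (x i)) \<in> borel_measurable (PiM (insert n {..<n}) (\<lambda>_. M))" if "i < Suc n" for i
        by (rule measurable_compose[OF _ l[OF t]], rule measurable_component_singleton) (use that in auto)
      then show "(\<lambda>x. u t + (\<Sum>i<Suc n. expectation (l t) - l t (x i)))
          \<in> borel_measurable (PiM (insert n {..<n}) (\<lambda>_. M))"
        by (intro borel_measurable_add borel_measurable_sum borel_measurable_diff) auto
      fix x assume x: "x \<in> space (PiM (insert n {..<n}) (\<lambda>_. M))"
      then have "x i \<in> space M" if "i < Suc n" for i
        using that by (auto simp: space_PiM less_Suc_eq)
      then have "\<bar>\<Sum>i<Suc n. expectation (l t) - l t (x i)\<bar> \<le> (\<Sum>i<Suc n. 2 * b)"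
        by (intro order_trans[OF sum_abs] sum_mono cent_le t) auto
      then show "\<bar>u t + (\<Sum>i<Suc n. expectation (l t) - l t (x i))\<bar> \<le> c + (\<Sum>i<Suc n. 2 * b)"
        using c[OF t] by linarith
    qed
  qed
  have G_eq: "G x y = rad_avg (\<lambda>u. exp (SUP t\<in>T. u t + S t x)) (pre @ [\<lambda>t. 2 * l t y])" for x y
    unfolding G_def by (simp add: rad_avg_append rad_avg_Cons algebra_simps)
  have G_int: "integrable (P \<Otimes>\<^sub>M M) (\<lambda>(x, y). G x y)"
    unfolding G_def case_prod_unfold
  proof (rule integral_rad_avg(1))
    fix u assume "u \<in> set (signed_sums pre)"
    then obtain c where c: "\<And>t. t \<in> T \<Longrightarrow> \<bar>u t\<bar> \<le> c" using u_bound by blast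
    have "integrable (P \<Otimes>\<^sub>M M) (\<lambda>p. exp (SUP t\<in>T. (u t + S t (fst p)) + s * (2 * l t (snd p))))"
      if s: "\<bar>s\<bar> = 1" for s
    proof (rule PM.integrable_exp_cSUP[OF T])
      fix t assume t: "t \<in> T"
      show "(\<lambda>p. (u t + S t (fst p)) + s * (2 * l t (snd p))) \<in> borel_measurable (P \<Otimes>\<^sub>M M)"
        using S_meas[OF t] l[OF t] by measurable
      fix p assume "p \<in> space (P \<Otimes>\<^sub>M M)"
      then have p: "fst p \<in> space P" "snd p \<in> space M" by (auto simp: space_pair_measure)
      have "\<bar>s * (2 * l t (snd p))\<bar> \<le> 2 * b"
        using b[OF t p(2)] s by (simp add: abs_mult)
      then show "\<bar>(u t + S t (fst p)) + s * (2 * l t (snd p))\<bar> \<le> c + b' + 2 * b"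
        using c[OF t] S_le[OF t, of "fst p", OF space_P[OF p(1)]] by linarith
    qed
    from this[of 1] this[of "- 1"]
    show "integrable (P \<Otimes>\<^sub>M M)
        (\<lambda>p. rad_avg (\<lambda>v. exp (SUP t\<in>T. (u t + S t (fst p)) + v t)) [\<lambda>t. 2 * l t (snd p)])"
      by (simp add: rad_avg_Cons)
  qed
  have f_upd: "f (x(n := y)) = rad_avg (\<lambda>u. exp (SUP t\<in>T. (u t + S t x) + (expectation (l t) - l t y))) pre" for x y
  proof -
    have "(\<Sum>i<Suc n. expectation (l t) - l t ((x(n := y)) i)) = S t x + (expectation (l t) - l t y)" for t
      unfolding S_def by (auto intro!: sum.cong)
    then show ?thesis unfolding f_def by (simp add: add.assoc)
  qed
  have f_upd_int: "integrable (P \<Otimes>\<^sub>M M) (\<lambda>p. f ((fst p)(n := snd p)))"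
    unfolding f_upd
  proof (rule integral_rad_avg(1))
    fix u assume "u \<in> set (signed_sums pre)"
    then obtain c where c: "\<And>t. t \<in> T \<Longrightarrow> \<bar>u t\<bar> \<le> c" using u_bound by blast
    show "integrable (P \<Otimes>\<^sub>M M)
        (\<lambda>p. exp (SUP t\<in>T. (u t + S t (fst p)) + (expectation (l t) - l t (snd p))))"
    proof (rule PM.integrable_exp_cSUP[OF T])
      fix t assume t: "t \<in> T"
      show "(\<lambda>p. (u t + S t (fst p)) + (expectation (l t) - l t (snd p))) \<in> borel_measurable (P \<Otimes>\<^sub>M M)"
        using S_meas[OF t] l[OF t] by measurable
      fix p assume "p \<in> space (P \<Otimes>\<^sub>M M)"
      then have p: "fst p \<in> space P" "snd p \<in> space M" by (auto simp: space_pair_measure)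
      show "\<bar>(u t + S t (fst p)) + (expectation (l t) - l t (snd p))\<bar> \<le> c + b' + 2 * b"
        using c[OF t] S_le[OF t, of "fst p", OF space_P[OF p(1)]] cent_le[OF t p(2)] by linarith
    qed
  qed
  have inner: "(\<integral>y. f (x(n := y)) \<partial>M) \<le> (\<integral>y. G x y \<partial>M)" if x: "x \<in> space P" for x
  proof -
    have b_ex: "\<exists>c. \<forall>t\<in>T. \<bar>u t + S t x\<bar> \<le> c" if u: "u \<in> set (signed_sums pre)" for u
    proof -
      obtain c where c: "\<And>t. t \<in> T \<Longrightarrow> \<bar>u t\<bar> \<le> c" using u_bound[OF u] by blast
      have "\<bar>u t + S t x\<bar> \<le> c + b'" if "t \<in> T" for t
        using c[OF that] S_le[OF that, of x, OF space_P[OF x]] by linarith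
      then show ?thesis by blast
    qed
    have int1: "integrable M (\<lambda>y. exp (SUP t\<in>T. (u t + S t x) + (expectation (l t) - l t y)))"
      if u: "u \<in> set (signed_sums pre)" for u
    proof -
      obtain c where c: "\<And>t. t \<in> T \<Longrightarrow> \<bar>u t + S t x\<bar> \<le> c" using b_ex[OF u] by blast
      show ?thesis
      proof (rule integrable_exp_cSUP[OF T])
        show "\<bar>(u t + S t x) + (expectation (l t) - l t y)\<bar> \<le> c + 2 * b" if "t \<in> T" "y \<in> space M" for t y
          using c[OF that(1)] cent_le[OF that] by linarith
      qed (use l in measurable)
    qed
    have int2: "integrable M (\<lambda>y. rad_avg (\<lambda>v. exp (SUP t\<in>T. (u t + S t x) + v t)) [\<lambda>t. 2 * l t y])"
      if u: "u \<in> set (signed_sums pre)" for u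
    proof -
      obtain c where c: "\<And>t. t \<in> T \<Longrightarrow> \<bar>u t + S t x\<bar> \<le> c" using b_ex[OF u] by blast
      have "integrable M (\<lambda>y. exp (SUP t\<in>T. (u t + S t x) + s * (2 * l t y)))" if s: "\<bar>s\<bar> = 1" for s
      proof (rule integrable_exp_cSUP[OF T])
        fix t y assume t: "t \<in> T" and y: "y \<in> space M"
        have "\<bar>s * (2 * l t y)\<bar> \<le> 2 * b"
          using b[OF t y] s by (simp add: abs_mult)
        then show "\<bar>(u t + S t x) + s * (2 * l t y)\<bar> \<le> c + 2 * b"
          using c[OF t] by linarith
      qed (use l in measurable)
      from this[of 1] this[of "- 1"] show ?thesis by (simp add: rad_avg_Cons)
    qed
    have "(\<integral>y. f (x(n := y)) \<partial>M)
        = rad_avg (\<lambda>u. expectation (\<lambda>y. exp (SUP t\<in>T. (u t + S t x) + (expectation (l t) - l t y)))) pre"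
      unfolding f_upd by (rule integral_rad_avg(2)[OF int1])
    also have "\<dots> \<le> rad_avg (\<lambda>u. expectation (\<lambda>y.
        rad_avg (\<lambda>v. exp (SUP t\<in>T. (u t + S t x) + v t)) [\<lambda>t. 2 * l t y])) pre"
    proof (rule rad_avg_mono)
      fix u assume "u \<in> set (signed_sums pre)"
      then obtain c where c: "\<And>t. t \<in> T \<Longrightarrow> \<bar>u t + S t x\<bar> \<le> c" using b_ex by blast
      show "expectation (\<lambda>y. exp (SUP t\<in>T. (u t + S t x) + (expectation (l t) - l t y)))
        \<le> expectation (\<lambda>y. rad_avg (\<lambda>v. exp (SUP t\<in>T. (u t + S t x) + v t)) [\<lambda>t. 2 * l t y])"
        by (rule exp_cSUP_centered_le[OF T l b c])
    qed
    also have "\<dots> = (\<integral>y. G x y \<partial>M)"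
      unfolding G_def by (rule integral_rad_avg(2)[OF int2, symmetric])
    finally show ?thesis .
  qed
  have G_le: "(\<integral>x. G x y \<partial>P) \<le> C" if y: "y \<in> space M" for y
    unfolding G_eq P_def S_def
  proof (rule Suc.IH)
    fix v assume "v \<in> set (pre @ [\<lambda>t. 2 * l t y])"
    moreover have "bounded ((\<lambda>t. 2 * l t y) ` T)"
      using b[OF _ y] by (auto intro!: boundedI[of _ "2 * b"] simp: abs_mult)
    ultimately show "bounded (v ` T)"
      using Suc.prems(1) by auto
  next
    fix x assume x: "\<And>i. i < n \<Longrightarrow> x i \<in> space M"
    have le: "rad_avg (\<lambda>u. exp (SUP t\<in>T. u t))
        (pre @ map (\<lambda>i t. 2 * l t ((x(n := y)) i)) (rev [0..<Suc n])) \<le> C"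
      using x y by (intro Suc.prems(2)) auto
    \<comment> \<open>The reversed index list starts with \<open>n\<close>, so the term of
      \<open>y\<close> stands right after \<open>pre\<close>, and the update at \<open>n\<close>
      does not affect the remaining entries.\<close>
    have eq: "pre @ map (\<lambda>i t. 2 * l t ((x(n := y)) i)) (rev [0..<Suc n])
        = (pre @ [\<lambda>t. 2 * l t y]) @ map (\<lambda>i t. 2 * l t (x i)) (rev [0..<n])"
      by auto
    show "rad_avg (\<lambda>u. exp (SUP t\<in>T. u t))
        ((pre @ [\<lambda>t. 2 * l t y]) @ map (\<lambda>i t. 2 * l t (x i)) (rev [0..<n])) \<le> C"
      using le unfolding eq .
  qed
  have "(\<integral>x. f x \<partial>PiM {..<Suc n} (\<lambda>_. M)) = (\<integral>x. f x \<partial>PiM (insert n {..<n}) (\<lambda>_. M))"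
    by (simp add: lessThan_Suc)
  also have "\<dots> = (\<integral>x. (\<integral>y. f (x(n := y)) \<partial>M) \<partial>P)"
    unfolding P_def by (rule product_integral_insert[OF _ _ f_int]) auto
  also have "\<dots> \<le> (\<integral>x. (\<integral>y. G x y \<partial>M) \<partial>P)"
  proof (rule integral_mono)
    show "integrable P (\<lambda>x. \<integral>y. f (x(n := y)) \<partial>M)"
      using PM.integrable_fst'[OF f_upd_int] by simp
    show "integrable P (\<lambda>x. \<integral>y. G x y \<partial>M)"
      using PM.integrable_fst'[OF G_int] by simp
  qed (rule inner)
  also have "\<dots> = (\<integral>y. (\<integral>x. G x y \<partial>P) \<partial>M)"
    by (rule PM.Fubini_integral[OF G_int, symmetric])
  also have "\<dots> \<le> (\<integral>y. C \<partial>M)"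
    using PM.integrable_snd[OF G_int] by (intro integral_mono G_le) auto
  also have "\<dots> = C" by (simp add: prob_space)
  finally show ?case by (simp add: f_def)
qed

text \<open>Markov's inequality for the exponential of the supremum, with
  \<open>symmetrization\<close> started from an empty \<open>pre\<close>. The exponential parameter
  is part of \<open>l\<close>.\<close>

lemma (in prob_space) exp_moment_tail:
  fixes l :: "'t \<Rightarrow> 'a \<Rightarrow> real" and v :: real and n :: nat
  assumes T: "countable T" "T \<noteq> {}"
    and l: "\<And>t. t \<in> T \<Longrightarrow> l t \<in> borel_measurable M"
    and b: "\<And>t x. t \<in> T \<Longrightarrow> x \<in> space M \<Longrightarrow> \<bar>l t x\<bar> \<le> b"
    and C: "\<And>x. (\<And>i. i < n \<Longrightarrow> x i \<in> space M) \<Longrightarrow>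
      rad_avg (\<lambda>u. exp (SUP t\<in>T. u t)) (map (\<lambda>i t. 2 * l t (x i)) (rev [0..<n])) \<le> C"
  defines "P \<equiv> PiM {..<n} (\<lambda>_. M)"
  defines "E \<equiv> {x \<in> space P. \<exists>t\<in>T. v < (\<Sum>i<n. expectation (l t) - l t (x i))}"
  shows "E \<in> sets P" "measure P E \<le> C * exp (- v)"
proof -
  interpret P: prob_space P
    unfolding P_def by (intro prob_space_PiM prob_space_axioms)
  define S where "S t x = (\<Sum>i<n. expectation (l t) - l t (x i))" for t and x :: "nat \<Rightarrow> 'a"
  have S_meas: "S t \<in> borel_measurable P" if "t \<in> T" for t
  proof -
    have "(\<lambda>x. l t (x i)) \<in> borel_measurable P" if "i < n" for i
      unfolding P_def
      by (rule measurable_compose[OF _ l[OF \<open>t \<in> T\<close>]], rule measurable_component_singleton) (use that in simp)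
    then show ?thesis unfolding S_def by (intro borel_measurable_sum) auto
  qed
  have E_eq: "E = (\<Union>t\<in>T. {x \<in> space P. v < S t x})"
    by (auto simp: E_def S_def)
  show E_sets: "E \<in> sets P"
    unfolding E_eq using T(1) S_meas by (intro sets.countable_UN' borel_measurable_less) auto
  have S_le: "\<bar>S t x\<bar> \<le> (\<Sum>i<n. 2 * b)" if t: "t \<in> T" and x: "x \<in> space P" for t x
  proof -
    have l_int: "integrable M (l t)"
      using l b t by (intro integrable_const_bound[of _ b]) (auto intro!: AE_I2)
    have "norm (expectation (l t)) \<le> expectation (\<lambda>x. norm (l t x))"
      by (rule integral_norm_bound)
    also have "\<dots> \<le> expectation (\<lambda>_. b)"
      using b t l_int by (intro integral_mono_AE) (auto intro!: AE_I2)
    finally have "\<bar>expectation (l t)\<bar> \<le> b" by (simp add: prob_space)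
    moreover have "\<bar>l t (x i)\<bar> \<le> b" if "i < n" for i
      using x that by (intro b t) (auto simp: P_def space_PiM)
    ultimately show ?thesis
      unfolding S_def by (intro order_trans[OF sum_abs] sum_mono) (fastforce simp: abs_le_iff)
  qed
  have int: "integrable P (\<lambda>x. exp (SUP t\<in>T. S t x))"
    by (rule P.integrable_exp_cSUP[OF T S_meas S_le])
  have bound: "exp v * indicator E x \<le> exp (SUP t\<in>T. S t x)" if x: "x \<in> space P" for x
  proof (cases "x \<in> E")
    case True
    then obtain t where t: "t \<in> T" "v < S t x" by (auto simp: E_eq)
    have "bdd_above ((\<lambda>t. S t x) ` T)"
    proof (rule bdd_aboveI2)
      show "S t x \<le> (\<Sum>i<n. 2 * b)" if "t \<in> T" for t
        using S_le[OF that x] by linarith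
    qed
    from cSUP_upper[OF t(1) this] t(2) True show ?thesis by simp
  qed simp
  have "exp v * measure P E = (\<integral>x. exp v * indicator E x \<partial>P)"
    using E_sets by simp
  also have "\<dots> \<le> (\<integral>x. exp (SUP t\<in>T. S t x) \<partial>P)"
    using E_sets by (intro integral_mono int bound) (auto simp: P.emeasure_eq_measure)
  also have "\<dots> \<le> C"
    using symmetrization[OF T l b, where pre = "[]" and n = n and C = C] C by (simp add: P_def S_def)
  finally show "measure P E \<le> C * exp (- v)"
    by (simp add: exp_minus field_simps)
qed

subsection \<open>The Bellman loss\<close>

lemma abs_Max_diff_le:
  fixes F G :: "'a \<Rightarrow> real"
  assumes "finite A" "A \<noteq> {}" "\<And>a. a \<in> A \<Longrightarrow> \<bar>F a - G a\<bar> \<le> w"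
  shows "\<bar>Max (F ` A) - Max (G ` A)\<bar> \<le> w"
proof -
  have *: "Max (F ` A) \<le> Max (G ` A) + w" if "\<And>a. a \<in> A \<Longrightarrow> F a \<le> G a + w" for F G :: "'a \<Rightarrow> real"
  proof -
    have "F a \<le> Max (G ` A) + w" if "a \<in> A" for a
    proof -
      have "G a \<le> Max (G ` A)" using assms(1) that by simp
      then show ?thesis
        using \<open>\<And>a. a \<in> A \<Longrightarrow> F a \<le> G a + w\<close>[OF that] by linarith
    qed
    then show ?thesis using assms(1,2) by simp
  qed
  show ?thesis
    using *[of F G] *[of G F] assms(3) by (smt (verit, best))
qed

lemma abs_Max_le:
  fixes F :: "'a \<Rightarrow> real"
  assumes "finite A" "A \<noteq> {}" "\<And>a. a \<in> A \<Longrightarrow> \<bar>F a\<bar> \<le> w"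
  shows "\<bar>Max (F ` A)\<bar> \<le> w"
  using abs_Max_diff_le[of A F "\<lambda>_. 0" w] assms by (simp add: image_constant_conv)

text \<open>The condition \<open>0 \<notin> A\<close> reserves the label 0 for the constant feature
  of \<open>net_family\<close>.\<close>

locale bellman_setting =
  fixes S :: "(real^'d::finite) set" and A :: "nat set" and \<gamma> dt :: real
    and r :: "real^'d \<Rightarrow> nat \<Rightarrow> real" and g :: "real^'d \<Rightarrow> nat \<Rightarrow> real \<Rightarrow> real^'d"
  assumes S_compact: "compact S"
    and S_cube: "\<And>s i. s \<in> S \<Longrightarrow> 0 \<le> s $ i \<and> s $ i \<le> 1"
    and S_pos: "emeasure lebesgue S > 0"
    and A: "finite A" "A \<noteq> {}" "0 \<notin> A"
    and \<gamma>: "0 < \<gamma>" "\<gamma> < 1"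
    and r_cont: "\<And>a. a \<in> A \<Longrightarrow> continuous_on S (\<lambda>s. r s a)"
    and r_bound: "\<And>s a. s \<in> S \<Longrightarrow> a \<in> A \<Longrightarrow> \<bar>r s a\<bar> \<le> 1"
    and g_maps: "\<And>s a. s \<in> S \<Longrightarrow> a \<in> A \<Longrightarrow> g s a dt \<in> S"
    and g_meas: "\<And>a. a \<in> A \<Longrightarrow> (\<lambda>s. g s a dt) \<in> borel_measurable (restrict_space lebesgue S)"
begin

definition residual :: "(nat \<Rightarrow> ('d, 'm::finite, 'D::finite) rparams) \<Rightarrow> (real^'d) \<times> nat \<Rightarrow> real" where
  "residual \<Theta> sa = resnet (\<Theta> (snd sa)) (fst sa) - r (fst sa) (snd sa)
     - \<gamma> * Max ((\<lambda>a'. resnet (\<Theta> a') (g (fst sa) (snd sa) dt)) ` A)"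

lemma bellman_sq_eq: "bellman_sq A r g dt \<gamma> \<Theta> sa = (residual \<Theta> sa)\<^sup>2"
  by (simp add: bellman_sq_def residual_def case_prod_unfold)

lemma abs_cube_le: "s \<in> S \<Longrightarrow> \<bar>s $ i\<bar> \<le> 1"
  using S_cube[of s i] by simp

lemma abs_resnet_le_family:
  assumes "b \<in> A" "s \<in> S"
  shows "\<bar>resnet (\<Theta> b) s\<bar> \<le> family_path_norm A \<Theta>"
proof -
  have "\<bar>resnet (\<Theta> b) s\<bar> \<le> path_norm (\<Theta> b)"
    by (rule abs_resnet_le[OF abs_cube_le[OF assms(2)]])
  also have "\<dots> \<le> family_path_norm A \<Theta>"
    unfolding family_path_norm_def using A(1) assms(1) by (intro member_le_sum path_norm_nonneg)
  finally show ?thesis .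
qed

text \<open>The network output and the discounted maximum contribute at most \<open>q\<close> each,
  the reward 1. This range of the residual also gives the Lipschitz constant of its square.\<close>

lemma abs_residual_le:
  assumes "s \<in> S" "a \<in> A" "family_path_norm A \<Theta> \<le> q"
  shows "\<bar>residual \<Theta> (s, a)\<bar> \<le> 2 * q + 1"
proof -
  define m where "m = Max ((\<lambda>a'. resnet (\<Theta> a') (g s a dt)) ` A)"
  have "\<bar>m\<bar> \<le> q"
    unfolding m_def
    by (intro abs_Max_le A order_trans[OF abs_resnet_le_family assms(3)] g_maps assms)
  then have "\<bar>\<gamma> * m\<bar> \<le> 1 * q"
    unfolding abs_mult using \<gamma> by (intro mult_mono) auto
  moreover have "\<bar>resnet (\<Theta> a) s\<bar> \<le> q"
    using abs_resnet_le_family[OF assms(2,1), of \<Theta>] assms(3) by linarith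
  ultimately show ?thesis
    using r_bound[OF assms(1,2)] unfolding residual_def m_def[symmetric] fst_conv snd_conv by linarith
qed

text \<open>The factor 4 is 2 times 2: the sum y + y' in the difference of squares is at most twice
  \<open>2 * q + 1\<close>, and the residuals differ by at most two feature differences, one at
  \<open>s\<close> and one for the maximum at the next state. So \<open>w\<close> may be the maximum
  over all features rather than their sum.\<close>

lemma residual_sq_diff_le:
  fixes \<Theta> \<Theta>' :: "nat \<Rightarrow> ('d, 'm::finite, 'D::finite) rparams"
  assumes sa: "s \<in> S" "a \<in> A"
    and q: "family_path_norm A \<Theta> \<le> q" "family_path_norm A \<Theta>' \<le> q"
    and lam: "0 \<le> lam"
    and w0: "4 * lam * (2 * q + 1) * \<bar>resnet (\<Theta> a) s - resnet (\<Theta>' a) s\<bar> \<le> w"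
    and w: "\<And>b. b \<in> A \<Longrightarrow>
      4 * lam * (2 * q + 1) * \<bar>resnet (\<Theta> b) (g s a dt) - resnet (\<Theta>' b) (g s a dt)\<bar> \<le> w"
  shows "lam * \<bar>(residual \<Theta> (s, a))\<^sup>2 - (residual \<Theta>' (s, a))\<^sup>2\<bar> \<le> w"
proof -
  define \<beta> where "\<beta> = 4 * lam * (2 * q + 1)"
  define m where "m \<Theta> = Max ((\<lambda>a'. resnet (\<Theta> a') (g s a dt)) ` A)"
    for \<Theta> :: "nat \<Rightarrow> ('d, 'm, 'D) rparams"
  have "0 \<le> q"
    using abs_resnet_le_family[OF sa(2,1), of \<Theta>] q by linarith
  then have "0 \<le> \<beta>" using lam by (simp add: \<beta>_def)
  have "0 \<le> w" using w0 \<open>0 \<le> \<beta>\<close> unfolding \<beta>_def by (smt (verit) mult_nonneg_nonneg abs_ge_zero)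
  \<comment> \<open>The hypotheses bound scaled differences, so the nonnegative scale is moved
    inside the maximum.\<close>
  have Max_scale: "\<beta> * m \<Theta> = Max ((\<lambda>a'. \<beta> * resnet (\<Theta> a') (g s a dt)) ` A)" for \<Theta>
    unfolding m_def using A \<open>0 \<le> \<beta>\<close>
    by (subst mono_Max_commute[where f = "\<lambda>x. \<beta> * x"]) (auto simp: image_image intro!: monoI mult_left_mono)
  have "\<bar>\<beta> * m \<Theta> - \<beta> * m \<Theta>'\<bar> \<le> w"
    unfolding Max_scale using w \<open>0 \<le> \<beta>\<close>
    by (intro abs_Max_diff_le A) (simp add: \<beta>_def[symmetric] abs_mult flip: right_diff_distrib)
  then have m_le: "\<beta> * \<bar>m \<Theta> - m \<Theta>'\<bar> \<le> w"
    using \<open>0 \<le> \<beta>\<close> by (simp add: abs_mult flip: right_diff_distrib)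
  define y y' where "y = residual \<Theta> (s, a)" and "y' = residual \<Theta>' (s, a)"
  have y: "\<bar>y\<bar> \<le> 2 * q + 1" "\<bar>y'\<bar> \<le> 2 * q + 1"
    unfolding y_def y'_def using abs_residual_le[OF sa] q by auto
  have "y - y' = (resnet (\<Theta> a) s - resnet (\<Theta>' a) s) - \<gamma> * (m \<Theta> - m \<Theta>')"
    by (simp add: y_def y'_def residual_def m_def algebra_simps)
  then have "\<bar>y - y'\<bar> \<le> \<bar>resnet (\<Theta> a) s - resnet (\<Theta>' a) s\<bar> + \<gamma> * \<bar>m \<Theta> - m \<Theta>'\<bar>"
    using \<gamma> by (simp add: abs_mult order_trans[OF abs_triangle_ineq4])
  also have "\<dots> \<le> \<bar>resnet (\<Theta> a) s - resnet (\<Theta>' a) s\<bar> + 1 * \<bar>m \<Theta> - m \<Theta>'\<bar>"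
    using \<gamma> by (intro add_left_mono mult_right_mono) auto
  finally have "\<beta> * \<bar>y - y'\<bar> \<le> \<beta> * (\<bar>resnet (\<Theta> a) s - resnet (\<Theta>' a) s\<bar> + 1 * \<bar>m \<Theta> - m \<Theta>'\<bar>)"
    using \<open>0 \<le> \<beta>\<close> by (rule mult_left_mono)
  also have "\<dots> \<le> 2 * w"
    using w0[folded \<beta>_def] m_le by (simp add: distrib_left)
  finally have *: "\<beta> * \<bar>y - y'\<bar> \<le> 2 * w" .
  have "lam * \<bar>y\<^sup>2 - y'\<^sup>2\<bar> = lam * (\<bar>y + y'\<bar> * \<bar>y - y'\<bar>)"
    by (simp add: power2_eq_square square_diff_square_factored flip: abs_mult)
  also have "\<dots> \<le> lam * ((2 * (2 * q + 1)) * \<bar>y - y'\<bar>)"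
    using y lam by (intro mult_left_mono mult_right_mono) auto
  also have "\<dots> = \<beta> * \<bar>y - y'\<bar> / 2"
    by (simp add: \<beta>_def)
  also have "\<dots> \<le> w" using * by simp
  finally show ?thesis by (simp add: y_def y'_def)
qed

text \<open>The hypothesis with 1/2, the value of the constant feature, pays for the reward.\<close>
lemma residual_sq_le:
  fixes \<Theta> :: "nat \<Rightarrow> ('d, 'm::finite, 'D::finite) rparams"
  assumes sa: "s \<in> S" "a \<in> A"
    and q: "family_path_norm A \<Theta> \<le> q"
    and lam: "0 \<le> lam"
    and w1: "4 * lam * (2 * q + 1) * (1/2) \<le> w"
    and w0: "4 * lam * (2 * q + 1) * \<bar>resnet (\<Theta> a) s\<bar> \<le> w"
    and w: "\<And>b. b \<in> A \<Longrightarrow> 4 * lam * (2 * q + 1) * \<bar>resnet (\<Theta> b) (g s a dt)\<bar> \<le> w"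
  shows "lam * (residual \<Theta> (s, a))\<^sup>2 \<le> w"
proof -
  define \<beta> where "\<beta> = 4 * lam * (2 * q + 1)"
  define m where "m = Max ((\<lambda>a'. resnet (\<Theta> a') (g s a dt)) ` A)"
  have "0 \<le> q"
    using abs_resnet_le_family[OF sa(2,1), of \<Theta>] q by linarith
  then have "0 \<le> \<beta>" using lam by (simp add: \<beta>_def)
  have "m \<in> (\<lambda>a'. resnet (\<Theta> a') (g s a dt)) ` A"
    unfolding m_def using A by (intro Max_in) auto
  then have m_le: "\<beta> * \<bar>m\<bar> \<le> w" using w by (auto simp: \<beta>_def)
  define y where "y = residual \<Theta> (s, a)"
  have y: "\<bar>y\<bar> \<le> 2 * q + 1"
    unfolding y_def by (rule abs_residual_le[OF sa q])
  have "\<bar>\<gamma> * m\<bar> \<le> 1 * \<bar>m\<bar>"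
    unfolding abs_mult using \<gamma> by (intro mult_right_mono) auto
  then have "\<bar>y\<bar> \<le> \<bar>resnet (\<Theta> a) s\<bar> + 1 + \<bar>m\<bar>"
    using r_bound[OF sa] unfolding y_def residual_def m_def[symmetric] fst_conv snd_conv by linarith
  then have "\<beta> * \<bar>y\<bar> \<le> \<beta> * (\<bar>resnet (\<Theta> a) s\<bar> + 1 + \<bar>m\<bar>)"
    using \<open>0 \<le> \<beta>\<close> by (rule mult_left_mono)
  \<comment> \<open>The reward bound 1 is twice the constant feature 1/2 and costs
    \<open>2 * w\<close>. The total \<open>4 * w\<close> is compensated below: the square is at most
    \<open>2 * q + 1\<close> times the absolute value, without the factor 4 contained in
    \<open>\<beta>\<close>.\<close>
  also have "\<dots> \<le> w + 2 * w + w"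
    using w0[folded \<beta>_def] w1[folded \<beta>_def] m_le by (simp add: distrib_left)
  finally have *: "\<beta> * \<bar>y\<bar> \<le> 4 * w" by simp
  have "lam * y\<^sup>2 = lam * (\<bar>y\<bar> * \<bar>y\<bar>)"
    by (simp add: power2_eq_square)
  also have "\<dots> \<le> lam * ((2 * q + 1) * \<bar>y\<bar>)"
    using y lam by (intro mult_left_mono mult_right_mono) auto
  also have "\<dots> = \<beta> * \<bar>y\<bar> / 4"
    by (simp add: \<beta>_def)
  also have "\<dots> \<le> w" using * by simp
  finally show ?thesis by (simp add: y_def)
qed

end

text \<open>Layer lists of fixed length become sequences, so that families of networks form a
  second countable metric space.\<close>
type_synonym ('d, 'm, 'D) param_seq =
  "nat \<Rightarrow> (real^'D) \<times> (real^'d^'D) \<times> (nat \<Rightarrow> (real^'D^'m) \<times> (real^'m^'D))"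

definition seq_family :: "nat \<Rightarrow> ('d::finite, 'm::finite, 'D::finite) param_seq \<Rightarrow> nat \<Rightarrow> ('d, 'm, 'D) rparams" where
  "seq_family L p a = (fst (p a), fst (snd (p a)), map (snd (snd (p a))) [0..<L])"

section \<open>Continuity of networks in their parameters and inputs\<close>

lemma tendsto_fun_apply:
  fixes f :: "nat \<Rightarrow> 'a \<Rightarrow> 'b::topological_space"
  assumes "f \<longlonglongrightarrow> l"
  shows "(\<lambda>j. f j a) \<longlonglongrightarrow> l a"
  using continuous_on_tendsto_compose[OF continuous_on_product_coordinates assms] by simp

lemma tendsto_matrix_vector_mult:
  fixes M :: "'x \<Rightarrow> real^'n^'m"
  assumes "(M \<longlongrightarrow> M0) F" "(v \<longlongrightarrow> v0) F"
  shows "((\<lambda>j. M j *v v j) \<longlongrightarrow> M0 *v v0) F"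
  unfolding matrix_vector_mult_def
  by (intro vec_tendstoI) (auto intro!: tendsto_sum tendsto_mult tendsto_vec_nth assms)

lemma tendsto_relu_vec:
  assumes "(v \<longlongrightarrow> v0) F"
  shows "((\<lambda>j. relu_vec (v j)) \<longlongrightarrow> relu_vec v0) F"
  unfolding relu_vec_def
  by (intro vec_tendstoI) (auto intro!: tendsto_max tendsto_vec_nth assms)

text \<open>Layers and hidden state vary together: varying the layers gives continuity in the
  parameters, fixing them gives continuity in the input. The hidden state is generalized because
  each layer replaces it.\<close>

lemma tendsto_fold_layers:
  fixes P :: "'x \<Rightarrow> 'i \<Rightarrow> (real^'D^'m) \<times> (real^'m^'D)"
  assumes P: "\<And>i. ((\<lambda>j. P j i) \<longlongrightarrow> P0 i) F" and h: "(h \<longlongrightarrow> h0) F"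
  shows "((\<lambda>j. fold (\<lambda>(W, U) h. h + U *v relu_vec (W *v h)) (map (P j) ks) (h j))
    \<longlongrightarrow> fold (\<lambda>(W, U) h. h + U *v relu_vec (W *v h)) (map P0 ks) h0) F"
  using h
proof (induction ks arbitrary: h h0)
  case (Cons i ks)
  have "((\<lambda>j. h j + snd (P j i) *v relu_vec (fst (P j i) *v h j))
      \<longlongrightarrow> h0 + snd (P0 i) *v relu_vec (fst (P0 i) *v h0)) F"
    by (rule tendsto_add[OF Cons.prems tendsto_matrix_vector_mult[OF tendsto_snd[OF P]
          tendsto_relu_vec[OF tendsto_matrix_vector_mult[OF tendsto_fst[OF P] Cons.prems]]]])
  from Cons.IH[OF this] show ?case by (simp add: case_prod_unfold)
qed simp

lemma tendsto_resnet_seq_family: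
  fixes p :: "nat \<Rightarrow> ('d::finite, 'm::finite, 'D::finite) param_seq"
  assumes "p \<longlonglongrightarrow> p0"
  shows "(\<lambda>j. resnet (seq_family L (p j) a) x) \<longlonglongrightarrow> resnet (seq_family L p0 a) x"
proof -
  have pa: "(\<lambda>j. p j a) \<longlonglongrightarrow> p0 a"
    by (rule tendsto_fun_apply[OF assms])
  have layer: "(\<lambda>j. snd (snd (p j a)) i) \<longlonglongrightarrow> snd (snd (p0 a)) i" for i
    by (rule tendsto_fun_apply[OF tendsto_snd[OF tendsto_snd[OF pa]]])
  have "(\<lambda>j. fst (snd (p j a)) *v x) \<longlonglongrightarrow> fst (snd (p0 a)) *v x"
    by (rule tendsto_matrix_vector_mult[OF tendsto_fst[OF tendsto_snd[OF pa]] tendsto_const])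
  from tendsto_inner[OF tendsto_fst[OF pa] tendsto_fold_layers[OF layer this]] show ?thesis
    by (simp add: seq_family_def resnet_def)
qed

lemma continuous_on_resnet:
  fixes \<theta> :: "('d::finite, 'm::finite, 'D::finite) rparams"
  shows "continuous_on UNIV (resnet \<theta>)"
  unfolding continuous_on_def
proof
  fix x :: "real^'d"
  obtain u V Ls where \<theta>: "\<theta> = (u, V, Ls)" by (cases \<theta>)
  have "((\<lambda>y. V *v y) \<longlongrightarrow> V *v x) (at x)"
    by (rule tendsto_matrix_vector_mult[OF tendsto_const tendsto_ident_at])
  then have "((\<lambda>y. fold (\<lambda>(W, U) h. h + U *v relu_vec (W *v h)) (map ((!) Ls) [0..<length Ls]) (V *v y))
      \<longlongrightarrow> fold (\<lambda>(W, U) h. h + U *v relu_vec (W *v h)) (map ((!) Ls) [0..<length Ls]) (V *v x)) (at x)"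
    by (rule tendsto_fold_layers[OF tendsto_const])
  moreover have "resnet \<theta> = (\<lambda>y. u \<bullet> fold (\<lambda>(W, U) h. h + U *v relu_vec (W *v h)) Ls (V *v y))"
    by (simp add: \<theta> resnet_def fun_eq_iff)
  ultimately show "(resnet \<theta> \<longlongrightarrow> resnet \<theta> x) (at x within UNIV)"
    by (simp add: map_nth tendsto_inner)
qed

lemma tendsto_Max:
  fixes f :: "'a \<Rightarrow> 'x \<Rightarrow> real"
  assumes "finite A" "A \<noteq> {}" "\<And>a. a \<in> A \<Longrightarrow> (f a \<longlongrightarrow> l a) F"
  shows "((\<lambda>j. Max ((\<lambda>a. f a j) ` A)) \<longlongrightarrow> Max (l ` A)) F"
  using assms
proof (induction A rule: finite_ne_induct)
  case (insert a A)
  then show ?case by (auto intro!: tendsto_max)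
qed simp

section \<open>Measurability of the Bellman loss, limits of the risks, and the exponential moment of
  the loss\<close>

context bellman_setting
begin

lemma S_lebesgue: "S \<in> sets lebesgue"
  using S_compact by (simp add: borel_compact)

lemma prob_space_state_dist: "prob_space (state_dist S)"
  unfolding state_dist_def
proof (rule prob_space_uniform_measure)
  have eq: "emeasure (restrict_space lebesgue S) S = emeasure lebesgue S"
    using S_lebesgue by (intro emeasure_restrict_space) auto
  show "emeasure (restrict_space lebesgue S) S \<noteq> 0"
    using S_pos unfolding eq by auto
  have "emeasure lborel S < \<infinity>"
    by (rule emeasure_compact_finite[OF S_compact])
  then show "emeasure (restrict_space lebesgue S) S \<noteq> \<infinity>"
    unfolding eq using S_compact by (simp add: borel_compact)
qed

lemma prob_space_pair_dist: "prob_space (pair_dist S A)"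
proof -
  interpret S: prob_space "state_dist S" by (rule prob_space_state_dist)
  interpret A: prob_space "uniform_count_measure A"
    using A by (intro prob_space_uniform_count_measure)
  interpret pair_prob_space "state_dist S" "uniform_count_measure A" ..
  show ?thesis unfolding pair_dist_def by (rule prob_space_axioms)
qed

lemma space_pair_dist: "space (pair_dist S A) = S \<times> A"
  by (simp add: pair_dist_def state_dist_def space_pair_measure space_restrict_space
      space_uniform_count_measure)

text \<open>The action set is finite, so measurability can be checked for each action separately.
  The transition is Lebesgue measurable with Borel target, which matches the Borel measurability of
  the networks composed with it.\<close>

lemma bellman_sq_measurable:
  fixes \<Theta> :: "nat \<Rightarrow> ('d, 'm::finite, 'D::finite) rparams"
  shows "bellman_sq A r g dt \<gamma> \<Theta> \<in> borel_measurable (pair_dist S A)"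
proof -
  let ?N = "restrict_space lebesgue S"
  have net: "resnet (\<Theta> a) \<in> borel_measurable borel" for a
    by (rule borel_measurable_continuous_onI[OF continuous_on_resnet])
  have slice: "(\<lambda>s. bellman_sq A r g dt \<gamma> \<Theta> (s, a)) \<in> borel_measurable ?N" if a: "a \<in> A" for a
  proof -
    have [measurable]: "resnet (\<Theta> a) \<in> borel_measurable ?N"
      by (rule continuous_imp_measurable_on_sets_lebesgue[OF
            continuous_on_subset[OF continuous_on_resnet subset_UNIV] S_lebesgue])
    have [measurable]: "(\<lambda>s. r s a) \<in> borel_measurable ?N"
      by (rule continuous_imp_measurable_on_sets_lebesgue[OF r_cont[OF a] S_lebesgue])
    have [measurable]: "(\<lambda>s. resnet (\<Theta> a') (g s a dt)) \<in> borel_measurable ?N" for a'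
      by (rule measurable_compose[OF g_meas[OF a] net])
    have [measurable]: "(\<lambda>s. Max ((\<lambda>a'. resnet (\<Theta> a') (g s a dt)) ` A)) \<in> borel_measurable ?N"
      using A(1) by (intro borel_measurable_Max) auto
    show ?thesis unfolding bellman_sq_def prod.case by measurable
  qed
  have "(\<lambda>(a, s). bellman_sq A r g dt \<gamma> \<Theta> (s, a)) \<in> borel_measurable (count_space A \<Otimes>\<^sub>M ?N)"
    using A(1) slice by (intro measurable_pair_measure_countable1) (auto intro: countable_finite)
  from measurable_pair_swap[OF this]
  have "bellman_sq A r g dt \<gamma> \<Theta> \<in> borel_measurable (?N \<Otimes>\<^sub>M count_space A)"
    by (simp add: case_prod_unfold)
  moreover have sets_eq: "sets (pair_dist S A) = sets (?N \<Otimes>\<^sub>M count_space A)"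
    unfolding pair_dist_def state_dist_def
    by (intro sets_pair_measure_cong) (simp_all add: sets_uniform_count_measure_count_space)
  ultimately show ?thesis
    unfolding measurable_cong_sets[OF sets_eq refl] by simp
qed

lemma bellman_sq_le:
  assumes "sa \<in> S \<times> A" "family_path_norm A \<Theta> \<le> q"
  shows "\<bar>bellman_sq A r g dt \<gamma> \<Theta> sa\<bar> \<le> (2 * q + 1)\<^sup>2"
proof -
  have "\<bar>residual \<Theta> sa\<bar> \<le> 2 * q + 1"
    using abs_residual_le[of "fst sa" "snd sa" \<Theta> q] assms by auto
  then have "\<bar>residual \<Theta> sa\<bar>\<^sup>2 \<le> (2 * q + 1)\<^sup>2"
    by (intro power_mono) auto
  then show ?thesis by (simp add: bellman_sq_eq)
qed

lemma tendsto_bellman_sq: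
  fixes p :: "nat \<Rightarrow> ('d, 'm::finite, 'D::finite) param_seq"
  assumes "p \<longlonglongrightarrow> p0"
  shows "(\<lambda>j. bellman_sq A r g dt \<gamma> (seq_family L (p j)) sa) \<longlonglongrightarrow> bellman_sq A r g dt \<gamma> (seq_family L p0) sa"
  unfolding bellman_sq_eq residual_def
  by (intro tendsto_intros tendsto_Max A tendsto_resnet_seq_family assms)

text \<open>Dominated convergence: the common norm bound along the sequence makes a constant the
  dominating function.\<close>

lemma tendsto_bellman_risk:
  fixes p :: "nat \<Rightarrow> ('d, 'm::finite, 'D::finite) param_seq"
  assumes "p \<longlonglongrightarrow> p0" "\<And>j. family_path_norm A (seq_family L (p j)) \<le> q"
  shows "(\<lambda>j. bellman_risk S A r g dt \<gamma> (seq_family L (p j))) \<longlonglongrightarrow> bellman_risk S A r g dt \<gamma> (seq_family L p0)"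
proof -
  interpret prob_space "pair_dist S A" by (rule prob_space_pair_dist)
  have "(\<lambda>j. \<integral>sa. bellman_sq A r g dt \<gamma> (seq_family L (p j)) sa \<partial>pair_dist S A)
      \<longlonglongrightarrow> (\<integral>sa. bellman_sq A r g dt \<gamma> (seq_family L p0) sa \<partial>pair_dist S A)"
    by (rule integral_dominated_convergence[where w = "\<lambda>_. (2 * q + 1)\<^sup>2"])
      (auto intro!: bellman_sq_measurable tendsto_bellman_sq assms bellman_sq_le AE_I2 simp: space_pair_dist)
  then show ?thesis
    unfolding bellman_risk_def by (intro tendsto_mult_left)
qed

lemma tendsto_empirical_risk:
  fixes p :: "nat \<Rightarrow> ('d, 'm::finite, 'D::finite) param_seq"
  assumes "p \<longlonglongrightarrow> p0"
  shows "(\<lambda>j. empirical_risk A r g dt \<gamma> n x (seq_family L (p j))) \<longlonglongrightarrow> empirical_risk A r g dt \<gamma> n x (seq_family L p0)"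
  unfolding empirical_risk_def
  by (intro tendsto_mult_left tendsto_sum tendsto_bellman_sq assms)

text \<open>The features of a sample point are the network of the chosen action at the state, and
  all networks and the constant at the next state. \<open>\<beta>\<close> is the Lipschitz weight of
  \<open>residual_sq_diff_le\<close>. \<open>c\<close> may have either sign, for the two directions
  of deviation.\<close>

lemma rad_avg_bellman:
  fixes \<Theta> :: "'t \<Rightarrow> nat \<Rightarrow> ('d, 'm::finite, 'D::finite) rparams"
  assumes T: "T \<noteq> {}" and q: "\<And>t. t \<in> T \<Longrightarrow> family_path_norm A (\<Theta> t) \<le> q"
    and x: "\<And>i. i < n \<Longrightarrow> x i \<in> S \<times> A"
  shows "rad_avg (\<lambda>u. exp (SUP t\<in>T. u t))
      (map (\<lambda>i t. c * bellman_sq A r g dt \<gamma> (\<Theta> t) (x i)) (rev [0..<n]))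
    \<le> 6 * card A * (2 * CARD('d) * exp ((4 * \<bar>c\<bar> * (2 * q + 1) * (q + 1/2))\<^sup>2 / 2 * (2 * n)))"
proof -
  define \<beta> where "\<beta> = 4 * \<bar>c\<bar> * (2 * q + 1)"
  define feats where "feats i = (snd (x i), fst (x i)) #
    map (\<lambda>b. (b, g (fst (x i)) (snd (x i)) dt)) (0 # sorted_list_of_set A)" for i
  define W where "W i = map (\<lambda>(b, y) t. \<beta> * net_family (\<Theta> t) b y) (feats i)" for i
  obtain t0 where t0: "t0 \<in> T" using T by blast
  have "0 \<le> family_path_norm A (\<Theta> t0)"
    unfolding family_path_norm_def by (intro sum_nonneg path_norm_nonneg)
  then have "0 \<le> q" using q[OF t0] by linarith
  then have "0 \<le> \<beta>" by (simp add: \<beta>_def)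
  have x': "fst (x i) \<in> S" "snd (x i) \<in> A" "g (fst (x i)) (snd (x i)) dt \<in> S" if "i < n" for i
  proof -
    show *: "fst (x i) \<in> S" "snd (x i) \<in> A" using x[OF that] by auto
    show "g (fst (x i)) (snd (x i)) dt \<in> S" by (rule g_maps[OF *])
  qed
  have feats: "b \<in> insert 0 A" "y \<in> S" if "i < n" "(b, y) \<in> set (feats i)" for i b y
    using that x'[OF that(1)] A(1) by (auto simp: feats_def)
  have net: "\<beta> * net_family \<Theta>' b y = \<beta> * resnet (\<Theta>' b) y" if "b \<in> A"
    for b y and \<Theta>' :: "nat \<Rightarrow> ('d, 'm, 'D) rparams"
    using that A(3) by (auto simp: net_family_def)
  have in_W: "(\<lambda>t. \<beta> * net_family (\<Theta> t) b y) \<in> set (W i)" if "(b, y) \<in> set (feats i)" for b y i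
    unfolding W_def using that by force
  have "rad_avg (\<lambda>u. exp (SUP t\<in>T. 0 + u t))
      (map (\<lambda>i t. c * bellman_sq A r g dt \<gamma> (\<Theta> t) (x i)) (rev [0..<n]))
    \<le> rad_avg (\<lambda>u. exp (SUP t\<in>T. 0 + u t)) (concat (map W (rev [0..<n])))"
  proof (rule rad_avg_contraction[OF T])
    fix i assume "i \<in> set (rev [0..<n])"
    then have i: "i < n" by simp
    define s a where "s = fst (x i)" and "a = snd (x i)"
    have xi: "x i = (s, a)" by (simp add: s_def a_def)
    have sa: "s \<in> S" "a \<in> A" "g s a dt \<in> S" using x'[OF i] by (auto simp: s_def a_def)
    have f0: "(a, s) \<in> set (feats i)" and f1: "b \<in> insert 0 A \<Longrightarrow> (b, g s a dt) \<in> set (feats i)" for b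
      using A(1) by (auto simp: feats_def s_def a_def)
    show "bounded ((\<lambda>t. c * bellman_sq A r g dt \<gamma> (\<Theta> t) (x i)) ` T)"
    proof (rule boundedI[of _ "\<bar>c\<bar> * (2 * q + 1)\<^sup>2"], elim imageE)
      fix y t assume "y = c * bellman_sq A r g dt \<gamma> (\<Theta> t) (x i)" "t \<in> T"
      then show "norm y \<le> \<bar>c\<bar> * (2 * q + 1)\<^sup>2"
        using mult_left_mono[OF bellman_sq_le[OF x[OF i] q[OF \<open>t \<in> T\<close>]] abs_ge_zero[of c]]
        by (simp add: abs_mult)
    qed
    show "bounded (w ` T)" if w_in: "w \<in> set (W i)" for w
    proof -
      obtain b y where w: "w = (\<lambda>t. \<beta> * net_family (\<Theta> t) b y)" and mem: "(b, y) \<in> set (feats i)"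
      proof -
        obtain z where z: "z \<in> set (feats i)" "w = (case z of (b, y) \<Rightarrow> \<lambda>t. \<beta> * net_family (\<Theta> t) b y)"
          using w_in unfolding W_def set_map by blast
        show thesis by (rule that[of "fst z" "snd z"]) (use z in \<open>auto simp: case_prod_unfold\<close>)
      qed
      have le: "\<bar>net_family (\<Theta> t) b y\<bar> \<le> q + 1" if "t \<in> T" for t
      proof (cases "b = 0")
        case False
        then have "b \<in> A" using feats(1)[OF i mem] by simp
        then show ?thesis
          using abs_resnet_le_family[OF _ feats(2)[OF i mem], of b "\<Theta> t"] q[OF that] False
          by (simp add: net_family_def)
      qed (use \<open>0 \<le> q\<close> in \<open>simp add: net_family_def\<close>)
      show ?thesis
        unfolding w
      proof (rule boundedI[of _ "\<beta> * (q + 1)"], elim imageE)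
        fix z t assume "z = \<beta> * net_family (\<Theta> t) b y" "t \<in> T"
        then show "norm z \<le> \<beta> * (q + 1)"
          using mult_left_mono[OF le[OF \<open>t \<in> T\<close>] \<open>0 \<le> \<beta>\<close>] \<open>0 \<le> \<beta>\<close> by (simp add: abs_mult)
      qed
    qed
    show "\<bar>c * bellman_sq A r g dt \<gamma> (\<Theta> t) (x i) - c * bellman_sq A r g dt \<gamma> (\<Theta> t') (x i)\<bar>
        \<le> rad_avg (\<lambda>u. \<bar>u t - u t'\<bar>) (W i)" if t: "t \<in> T" "t' \<in> T" for t t'
    proof -
      have le: "\<bar>\<beta> * net_family (\<Theta> t) b y - \<beta> * net_family (\<Theta> t') b y\<bar> \<le> rad_avg (\<lambda>u. \<bar>u t - u t'\<bar>) (W i)"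
        if "(b, y) \<in> set (feats i)" for b y
        by (rule abs_le_rad_avg[where F = "\<lambda>u. u t - u t'", OF _ _ in_W[OF that]]) auto
      have le': "\<beta> * \<bar>resnet (\<Theta> t b) y - resnet (\<Theta> t' b) y\<bar> \<le> rad_avg (\<lambda>u. \<bar>u t - u t'\<bar>) (W i)"
        if "b \<in> A" "(b, y) \<in> set (feats i)" for b y
        using le[OF that(2)] \<open>0 \<le> \<beta>\<close> unfolding net[OF that(1)]
        by (simp add: abs_mult flip: right_diff_distrib)
      have "\<bar>c\<bar> * \<bar>(residual (\<Theta> t) (s, a))\<^sup>2 - (residual (\<Theta> t') (s, a))\<^sup>2\<bar> \<le> rad_avg (\<lambda>u. \<bar>u t - u t'\<bar>) (W i)"
        by (rule residual_sq_diff_le[OF sa(1,2) q[OF t(1)] q[OF t(2)]])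
          (use le'[OF sa(2) f0] le'[OF _ f1] in \<open>auto simp: \<beta>_def\<close>)
      then show ?thesis
        by (simp add: bellman_sq_eq xi abs_mult flip: right_diff_distrib)
    qed
    show "\<bar>c * bellman_sq A r g dt \<gamma> (\<Theta> t) (x i)\<bar> \<le> rad_avg (\<lambda>u. \<bar>u t\<bar>) (W i)" if t: "t \<in> T" for t
    proof -
      have le: "\<bar>\<beta> * net_family (\<Theta> t) b y\<bar> \<le> rad_avg (\<lambda>u. \<bar>u t\<bar>) (W i)"
        if "(b, y) \<in> set (feats i)" for b y
        by (rule abs_le_rad_avg[where F = "\<lambda>u. u t", OF _ _ in_W[OF that]]) auto
      have le': "\<beta> * \<bar>resnet (\<Theta> t b) y\<bar> \<le> rad_avg (\<lambda>u. \<bar>u t\<bar>) (W i)"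
        if "b \<in> A" "(b, y) \<in> set (feats i)" for b y
        using le[OF that(2)] \<open>0 \<le> \<beta>\<close> unfolding net[OF that(1)] by (simp add: abs_mult)
      have le0: "\<beta> * (1/2) \<le> rad_avg (\<lambda>u. \<bar>u t\<bar>) (W i)"
        using le[OF f1[of 0]] \<open>0 \<le> \<beta>\<close> by (simp add: net_family_def abs_mult)
      have "\<bar>c\<bar> * (residual (\<Theta> t) (s, a))\<^sup>2 \<le> rad_avg (\<lambda>u. \<bar>u t\<bar>) (W i)"
        by (rule residual_sq_le[OF sa(1,2) q[OF t]])
          (use le0 le'[OF sa(2) f0] le'[OF _ f1] in \<open>auto simp: \<beta>_def\<close>)
      then show ?thesis
        by (simp add: bellman_sq_eq xi abs_mult)
    qed
  qed (simp add: image_constant_conv)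
  also have "concat (map W (rev [0..<n]))
      = map (\<lambda>(b, y) t. \<beta> * net_family (\<Theta> t) b y) (concat (map feats (rev [0..<n])))"
    unfolding W_def by (simp add: map_concat comp_def)
  also have "rad_avg (\<lambda>u. exp (SUP t\<in>T. 0 + u t)) \<dots>
      \<le> 6 * card A * (2 * CARD('d) * exp ((\<beta> * (q + 1/2))\<^sup>2 / 2 * (2 * n)))"
    unfolding add_0_left
  proof (rule rad_avg_net_family[OF A T _ _ _ q \<open>0 \<le> \<beta>\<close>, where N = "2 * n"])
    fix p assume "p \<in> set (concat (map feats (rev [0..<n])))"
    then obtain i where i: "i < n" "p \<in> set (feats i)" by auto
    then show "fst p \<in> insert 0 A" "\<And>j. \<bar>snd p $ j\<bar> \<le> 1"
      using feats[OF i(1), of "fst p" "snd p"] by (auto intro: abs_cube_le)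
  next
    fix b
    \<comment> \<open>Within one sample point a label occurs once at the next state and at most once
      more as the chosen action, which gives \<open>N = 2 * n\<close>.\<close>
    have "length (filter (\<lambda>p. fst p = b) (feats i)) \<le> 2" for i
    proof -
      define L where "L = 0 # sorted_list_of_set A"
      have "distinct L" using A by (simp add: L_def)
      then have "distinct (filter (\<lambda>b'. b' = b) L)" by simp
      then have "length (filter (\<lambda>b'. b' = b) L) = card (set (filter (\<lambda>b'. b' = b) L))"
        by (rule distinct_card[symmetric])
      also have "\<dots> \<le> card {b}" by (intro card_mono) auto
      finally have "length (filter (\<lambda>b'. b' = b) L) \<le> 1" by simp
      then show ?thesis
        unfolding feats_def L_def[symmetric] by (simp add: filter_map comp_def)
    qed
    then have "sum_list (map (\<lambda>i. length (filter (\<lambda>p. fst p = b) (feats i))) (rev [0..<n]))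
        \<le> sum_list (map (\<lambda>i. 2) (rev [0..<n]))"
      by (intro sum_list_mono)
    then show "length (filter (\<lambda>p. fst p = b) (concat (map feats (rev [0..<n])))) \<le> 2 * n"
      by (simp add: filter_concat length_concat comp_def map_replicate_const sum_list_replicate
          rev_map[symmetric])
  qed
  finally show ?thesis by (simp add: \<beta>_def)
qed

end

section \<open>One norm level: tail bound, closure, and choice of the scale\<close>

context bellman_setting
begin

text \<open>The two directions of deviation are the cases c = lam and c = - lam, whose union
  accounts for the factor 2. The 1/2 in the definition of the risk cancels the 2 introduced by
  symmetrization.\<close>

lemma level_tail:
  fixes \<Theta> :: "'t \<Rightarrow> nat \<Rightarrow> ('d, 'm::finite, 'D::finite) rparams" and q v lam :: real and n :: nat
  assumes T: "countable T" "T \<noteq> {}" and q: "\<And>t. t \<in> T \<Longrightarrow> family_path_norm A (\<Theta> t) \<le> q"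
    and lam: "0 < lam" and n: "1 \<le> n"
  defines "C \<equiv> 6 * card A * (2 * CARD('d) * exp ((4 * lam * (2 * q + 1) * (q + 1/2))\<^sup>2 / 2 * (2 * n)))"
  defines "E \<equiv> {x \<in> space (sample_dist S A n). \<exists>t\<in>T.
    v < lam * n * \<bar>bellman_risk S A r g dt \<gamma> (\<Theta> t) - empirical_risk A r g dt \<gamma> n x (\<Theta> t)\<bar>}"
  shows "E \<in> sets (sample_dist S A n)" "measure (sample_dist S A n) E \<le> 2 * C * exp (- v)"
proof -
  interpret prob_space "pair_dist S A" by (rule prob_space_pair_dist)
  interpret P: prob_space "sample_dist S A n"
    unfolding sample_dist_def by (intro prob_space_PiM prob_space_pair_dist)
  define F where "F c = {x \<in> space (sample_dist S A n). \<exists>t\<in>T.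
    v < c * n * (bellman_risk S A r g dt \<gamma> (\<Theta> t) - empirical_risk A r g dt \<gamma> n x (\<Theta> t))}" for c :: real
  have F: "F c \<in> sets (sample_dist S A n) \<and> measure (sample_dist S A n) (F c) \<le> C * exp (- v)"
    if c: "\<bar>c\<bar> = lam" for c :: real
  proof -
    define l where "l t z = c / 2 * bellman_sq A r g dt \<gamma> (\<Theta> t) z" for t z
    have l_meas: "l t \<in> borel_measurable (pair_dist S A)" for t
      unfolding l_def using bellman_sq_measurable[of "\<Theta> t"] by simp
    have l_le: "\<bar>l t z\<bar> \<le> lam / 2 * (2 * q + 1)\<^sup>2" if "t \<in> T" "z \<in> space (pair_dist S A)" for t z
      using mult_left_mono[OF bellman_sq_le[OF _ q[OF that(1)], of z], of "lam / 2"] that lam c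
      by (simp add: l_def abs_mult space_pair_dist)
    have E_l: "expectation (l t) = c * bellman_risk S A r g dt \<gamma> (\<Theta> t)" for t
    proof -
      have "expectation (l t) = c / 2 * expectation (bellman_sq A r g dt \<gamma> (\<Theta> t))"
        unfolding l_def by (rule integral_mult_right_zero)
      then show ?thesis by (simp add: bellman_risk_def)
    qed
    have sum_l: "(\<Sum>i<n. expectation (l t) - l t (x i))
        = c * n * (bellman_risk S A r g dt \<gamma> (\<Theta> t) - empirical_risk A r g dt \<gamma> n x (\<Theta> t))" for t x
    proof -
      have "(\<Sum>i<n. l t (x i)) = c / 2 * (\<Sum>i<n. bellman_sq A r g dt \<gamma> (\<Theta> t) (x i))"
        by (simp add: l_def sum_distrib_left)
      also have "\<dots> = c * n * empirical_risk A r g dt \<gamma> n x (\<Theta> t)"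
        using n by (simp add: empirical_risk_def)
      finally show ?thesis
        by (simp add: sum_subtractf E_l right_diff_distrib)
    qed
    have "rad_avg (\<lambda>u. exp (SUP t\<in>T. u t)) (map (\<lambda>i t. 2 * l t (x i)) (rev [0..<n])) \<le> C"
      if "\<And>i. i < n \<Longrightarrow> x i \<in> space (pair_dist S A)" for x
      using rad_avg_bellman[OF T(2) q, where n = n and x = x and c = c] that c
      by (simp add: l_def C_def space_pair_dist)
    from exp_moment_tail[OF T l_meas l_le this, where v = v]
    show ?thesis
      unfolding sum_l F_def sample_dist_def by blast
  qed
  have E_eq: "E = F lam \<union> F (- lam)"
  proof -
    have "v < lam * n * \<bar>y\<bar> \<longleftrightarrow> v < lam * n * y \<or> v < - lam * n * y" for y
    proof -
      have "lam * n * \<bar>y\<bar> = \<bar>lam * n * y\<bar>" using lam by (simp add: abs_mult)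
      then show ?thesis by auto
    qed
    then show ?thesis unfolding E_def F_def by blast
  qed
  have *: "F lam \<in> sets (sample_dist S A n)" "measure (sample_dist S A n) (F lam) \<le> C * exp (- v)"
     "F (- lam) \<in> sets (sample_dist S A n)" "measure (sample_dist S A n) (F (- lam)) \<le> C * exp (- v)"
    using F[of lam] F[of "- lam"] lam by auto
  show "E \<in> sets (sample_dist S A n)"
    unfolding E_eq using * by auto
  have "measure (sample_dist S A n) E \<le> measure (sample_dist S A n) (F lam) + measure (sample_dist S A n) (F (- lam))"
    unfolding E_eq by (rule measure_Un_le[OF *(1,3)])
  then show "measure (sample_dist S A n) E \<le> 2 * C * exp (- v)"
    using * by linarith
qed

text \<open>Along a convergent sequence in \<open>T\<close> both risks converge, so the weak
  inequality survives in the limit. The norm bound on \<open>T\<close> supplies the domination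
  needed for the population risk.\<close>

lemma level_extend:
  fixes T :: "('d, 'm::finite, 'D::finite) param_seq set"
  assumes T: "\<And>p. p \<in> T \<Longrightarrow> family_path_norm A (seq_family L p) \<le> q"
    and p: "p \<in> closure T"
    and le: "\<And>p. p \<in> T \<Longrightarrow> \<bar>bellman_risk S A r g dt \<gamma> (seq_family L p)
      - empirical_risk A r g dt \<gamma> n x (seq_family L p)\<bar> \<le> \<tau>"
  shows "\<bar>bellman_risk S A r g dt \<gamma> (seq_family L p) - empirical_risk A r g dt \<gamma> n x (seq_family L p)\<bar> \<le> \<tau>"
proof -
  obtain ps where ps: "\<And>j. ps j \<in> T" "ps \<longlonglongrightarrow> p"
    using p unfolding closure_sequential by blast
  have "(\<lambda>j. \<bar>bellman_risk S A r g dt \<gamma> (seq_family L (ps j)) - empirical_risk A r g dt \<gamma> n x (seq_family L (ps j))\<bar>)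
      \<longlonglongrightarrow> \<bar>bellman_risk S A r g dt \<gamma> (seq_family L p) - empirical_risk A r g dt \<gamma> n x (seq_family L p)\<bar>"
    by (rule tendsto_rabs[OF tendsto_diff[OF tendsto_bellman_risk[OF ps(2) T[OF ps(1)]]
          tendsto_empirical_risk[OF ps(2)]]])
  then show ?thesis
    by (rule LIMSEQ_le_const2) (use le[OF ps(1)] in blast)
qed

text \<open>Families are functions on all natural numbers, while the encoding by sequences
  reproduces a given family only on \<open>A\<close>.\<close>

lemma risk_cong:
  fixes \<Theta> \<Theta>' :: "nat \<Rightarrow> ('d, 'm::finite, 'D::finite) rparams"
  assumes "\<And>a. a \<in> A \<Longrightarrow> \<Theta> a = \<Theta>' a"
  shows "bellman_risk S A r g dt \<gamma> \<Theta> = bellman_risk S A r g dt \<gamma> \<Theta>'"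
    and "x \<in> space (sample_dist S A n) \<Longrightarrow> empirical_risk A r g dt \<gamma> n x \<Theta> = empirical_risk A r g dt \<gamma> n x \<Theta>'"
    and "family_path_norm A \<Theta> = family_path_norm A \<Theta>'"
proof -
  have eq: "bellman_sq A r g dt \<gamma> \<Theta> sa = bellman_sq A r g dt \<gamma> \<Theta>' sa" if "sa \<in> S \<times> A" for sa
  proof -
    have "(\<lambda>a'. resnet (\<Theta> a') y) ` A = (\<lambda>a'. resnet (\<Theta>' a') y) ` A" for y
      using assms by (intro image_cong) auto
    then show ?thesis
      using that assms by (auto simp: bellman_sq_def)
  qed
  show "bellman_risk S A r g dt \<gamma> \<Theta> = bellman_risk S A r g dt \<gamma> \<Theta>'"
    unfolding bellman_risk_def
    by (intro arg_cong[where f = "(*) (1/2)"] Bochner_Integration.integral_cong refl eq) (simp add: space_pair_dist)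
  show "empirical_risk A r g dt \<gamma> n x \<Theta> = empirical_risk A r g dt \<gamma> n x \<Theta>'"
    if "x \<in> space (sample_dist S A n)"
  proof -
    have "x i \<in> S \<times> A" if "i < n" for i
      using \<open>x \<in> space (sample_dist S A n)\<close> that
      by (auto simp: sample_dist_def space_PiM space_pair_dist[symmetric])
    then show ?thesis
      unfolding empirical_risk_def by (intro arg_cong2[where f = "(*)"] sum.cong refl eq) auto
  qed
  show "family_path_norm A \<Theta> = family_path_norm A \<Theta>'"
    unfolding family_path_norm_def using assms by (intro sum.cong) auto
qed

end

text \<open>With h = q + 1/2 the exponent of the moment is 64 (lam h^2)^2 n, and the chosen
  \<open>lam\<close> makes it 16 s^2. Together with ln (2d) = s^2 / 2 this is 33/2 s^2, and division
  by lam n gives h^2 / sqrt n times 33 s + 2 Y / s, where Y collects the other logarithms.\<close>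

lemma deviation_level_le:
  fixes d N n j :: nat and \<delta> Q s q lam C :: real
  assumes "1 \<le> d" "1 \<le> N" "1 \<le> n" "0 < \<delta>" "\<delta> < 1" "real j \<le> 2 * Q"
  defines "s \<equiv> sqrt (2 * ln (2 * d))" and "q \<equiv> (j + 1) / 2"
  defines "lam \<equiv> s / (2 * sqrt n * (q + 1/2)\<^sup>2)"
  defines "C \<equiv> 6 * N * (2 * d * exp ((4 * lam * (2 * q + 1) * (q + 1/2))\<^sup>2 / 2 * (2 * n)))"
  shows "0 < lam"
    and "ln (2 * C * (real j + 1) * (real j + 2) / \<delta>) / (lam * n)
      \<le> (Q + 1)\<^sup>2 / sqrt n * (36 * N ^ 3 * s + 9/2 * (ln (4 * (Q + 1)) + ln (N / \<delta>)))"
proof -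
  have "0 \<le> Q" using assms(6) by linarith
  have d: "1 \<le> real d" and N: "1 \<le> real N" and n: "1 \<le> real n" using assms(1-3) by auto
  have ln2: "2/3 \<le> ln (2::real)" "ln (2::real) \<le> 1"
    using ln2_ge_two_thirds ln_2_less_1 by auto
  have s2: "s\<^sup>2 = 2 * ln (2 * d)"
    unfolding s_def using d by simp
  have "ln 2 \<le> ln (2 * d)" using d by simp
  then have "1 \<le> s\<^sup>2" using s2 ln2 by linarith
  moreover have "0 \<le> s" unfolding s_def using d by simp
  ultimately have s: "1 \<le> s"
    by (metis abs_le_square_iff abs_of_nonneg one_power2 zero_le_one)
  \<comment> \<open>The constant feature contributes the 1/2, and the grid makes h equal to (j + 2)
    / 2; with j <= 2 Q this fits under Q + 1 exactly.\<close>
  define h where "h = q + 1/2"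
  have "h = (real j + 2) / 2"
    unfolding h_def q_def by (simp add: field_simps)
  then have h: "0 < h" "h \<le> Q + 1"
    using assms(6) by auto
  have sn: "0 < sqrt n" "sqrt n * sqrt n = n" using n by auto
  show lam: "0 < lam"
    unfolding lam_def h_def[symmetric] using s h sn by simp
  have lam_h: "lam * h\<^sup>2 = s / (2 * sqrt n)"
    unfolding lam_def h_def[symmetric] using h(1) by simp
  have "(4 * lam * (2 * q + 1) * (q + 1/2))\<^sup>2 / 2 * (2 * n) = 64 * (lam * h\<^sup>2)\<^sup>2 * n"
  proof -
    have eq: "4 * lam * (2 * q + 1) * (q + 1/2) = 8 * (lam * h\<^sup>2)"
      by (simp add: h_def power2_eq_square algebra_simps)
    show ?thesis unfolding eq power_mult_distrib by simp
  qed
  also have "\<dots> = 16 * s\<^sup>2"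
    unfolding lam_h using n by (simp add: power_divide power_mult_distrib)
  finally have C: "C = 12 * N * (d * exp (16 * s\<^sup>2))"
    by (simp add: C_def)
  define Y where "Y = ln 12 + ln (N / \<delta>) + ln ((real j + 1) * (real j + 2))"
  have N\<delta>: "1 \<le> N / \<delta>" using N assms(4,5) by (simp add: le_divide_eq)
  have "0 \<le> Y"
    unfolding Y_def using N\<delta> mult_mono[of 1 "real j + 1" 1 "real j + 2"]
    by (intro add_nonneg_nonneg ln_ge_zero) auto
  have pos: "0 < (real j + 1) * (real j + 2)" by (simp add: add_pos_nonneg)
  \<comment> \<open>The numerical factor 24 is split as 12 times 2 so that the logarithm of the
    dimension factor is ln (2d), that is, s^2 / 2.\<close>
  have "2 * C * (real j + 1) * (real j + 2) / \<delta> = 12 * (N / \<delta>) * ((real j + 1) * (real j + 2)) * (2 * d * exp (16 * s\<^sup>2))"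
    by (simp add: C)
  also have "ln \<dots> = Y + (ln (2 * d) + 16 * s\<^sup>2)"
  proof -
    have "ln (x * y * z * (w * exp t)) = ln x + ln y + ln z + (ln w + t)"
      if "0 < x" "0 < y" "0 < z" "0 < w" for x y z w t :: real
      using that by (simp add: ln_mult_pos)
    from this[of 12 "N / \<delta>" "(real j + 1) * (real j + 2)" "2 * d"] show ?thesis
      unfolding Y_def using N\<delta> d pos by simp
  qed
  also have "\<dots> = Y + 33/2 * s\<^sup>2"
    using s2 by simp
  finally have v: "ln (2 * C * (real j + 1) * (real j + 2) / \<delta>) = Y + 33/2 * s\<^sup>2" .
  have "ln (2 * C * (real j + 1) * (real j + 2) / \<delta>) / (lam * n) = h\<^sup>2 / sqrt n * (2 * (Y + 33/2 * s\<^sup>2) / s)"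
  proof -
    have "h\<^sup>2 / sqrt n * (2 * (Y + 33/2 * s\<^sup>2) / s) * (lam * n) = (lam * h\<^sup>2) * n * (2 * (Y + 33/2 * s\<^sup>2)) / (s * sqrt n)"
      by (simp add: mult_ac)
    also have "\<dots> = Y + 33/2 * s\<^sup>2"
    proof -
      have "s / (2 * t) * (t * t) * (2 * Z) / (s * t) = Z" if "0 < t" for t Z :: real
        using that s by simp
      from this[OF sn(1), of "Y + 33/2 * s\<^sup>2"] show ?thesis
        unfolding lam_h sn(2) .
    qed
    finally show ?thesis
      unfolding v using lam n by (subst divide_eq_eq) auto
  qed
  also have "\<dots> \<le> (Q + 1)\<^sup>2 / sqrt n * (36 * N ^ 3 * s + 9/2 * (ln (4 * (Q + 1)) + ln (N / \<delta>)))"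
  proof (rule mult_mono)
    show "h\<^sup>2 / sqrt n \<le> (Q + 1)\<^sup>2 / sqrt n"
      using h sn by (intro divide_right_mono power_mono) auto
    have "ln ((real j + 1) * (real j + 2)) \<le> ln ((2 * (Q + 1)) * (2 * (Q + 1)))"
    proof -
      have "(real j + 1) * (real j + 2) \<le> (2 * (Q + 1)) * (2 * (Q + 1))"
        using assms(6) by (intro mult_mono) auto
      then show ?thesis using pos by (intro ln_mono)
    qed
    also have "\<dots> = 2 * ln 2 + 2 * ln (Q + 1)"
    proof -
      have "ln (2 * (Q + 1) * (2 * (Q + 1))) = ln (2 * (Q + 1)) + ln (2 * (Q + 1))"
        using \<open>0 \<le> Q\<close> by (intro ln_mult_pos) auto
      moreover have "ln (2 * (Q + 1)) = ln 2 + ln (Q + 1)"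
        using \<open>0 \<le> Q\<close> by (intro ln_mult_pos) auto
      ultimately show ?thesis by linarith
    qed
    finally have j_le: "ln ((real j + 1) * (real j + 2)) \<le> 2 * ln 2 + 2 * ln (Q + 1)" .
    have ln12: "ln (12::real) \<le> 4 * ln 2"
    proof -
      have "ln (12::real) \<le> ln 16" by simp
      also have "ln (16::real) = 4 * ln 2"
        using ln_realpow[of 2 4] by simp
      finally show ?thesis .
    qed
    have ln4: "ln (4 * (Q + 1)) = 2 * ln 2 + ln (Q + 1)"
    proof -
      have "ln (4 * (Q + 1)) = ln 4 + ln (Q + 1)"
        using \<open>0 \<le> Q\<close> by (intro ln_mult_pos) auto
      moreover have "ln (4::real) = 2 * ln 2"
        using ln_realpow[of 2 2] by simp
      ultimately show ?thesis by linarith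
    qed
    have nonneg: "0 \<le> ln (Q + 1)" "0 \<le> ln (N / \<delta>)"
      using \<open>0 \<le> Q\<close> N\<delta> by auto
    have "2 * (Y + 33/2 * s\<^sup>2) / s = 2 * Y / s + 33 * s"
      using s by (simp add: field_simps power2_eq_square)
    also have "\<dots> \<le> 2 * Y + 33 * s"
      using s \<open>0 \<le> Y\<close> by (simp add: divide_le_eq mult_le_cancel_left1)
    also have "\<dots> \<le> 36 * 1 * s + 9/2 * (ln (4 * (Q + 1)) + ln (N / \<delta>))"
    proof -
      \<comment> \<open>Here l is ln 2 and w is ln (Q + 1). The constants amount to 12 l: the term
        9/2 ln 4 pays for 9 l, and the spare 3 s for the rest, since l <= 1 <= s. The coefficients
        of w and y leave room.\<close>
      have "2 * (x + y + z) + 33 * s \<le> 36 * 1 * s + 9/2 * (2 * l + w + y)"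
        if "z \<le> 2 * l + 2 * w" "x \<le> 4 * l" "l \<le> 1" "0 \<le> w" "0 \<le> y" for x y z w l :: real
      proof -
        have "2 * (x + y + z) \<le> 12 * l + 4 * w + 2 * y" using that by (simp add: algebra_simps)
        moreover have "12 * l \<le> 9 * l + 3 * s" using that s by linarith
        moreover have "9/2 * (2 * l + w + y) = 9 * l + 9/2 * w + 9/2 * y" by (simp add: field_simps)
        moreover have "4 * w \<le> 9/2 * w" "2 * y \<le> 9/2 * y" using that by auto
        ultimately show ?thesis unfolding mult_1_right by linarith
      qed
      from this[OF j_le ln12 ln2(2) nonneg] show ?thesis
        unfolding Y_def ln4 .
    qed
    also have "\<dots> \<le> 36 * N ^ 3 * s + 9/2 * (ln (4 * (Q + 1)) + ln (N / \<delta>))"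
      using s N one_le_power[OF N, of 3] by (intro add_right_mono mult_right_mono) auto
    finally show "2 * (Y + 33/2 * s\<^sup>2) / s \<le> 36 * N ^ 3 * s + 9/2 * (ln (4 * (Q + 1)) + ln (N / \<delta>))" .
    show "0 \<le> 2 * (Y + 33/2 * s\<^sup>2) / s"
      using s \<open>0 \<le> Y\<close> by simp
  qed (use sn in simp)
  finally show "ln (2 * C * (real j + 1) * (real j + 2) / \<delta>) / (lam * n)
      \<le> (Q + 1)\<^sup>2 / sqrt n * (36 * N ^ 3 * s + 9/2 * (ln (4 * (Q + 1)) + ln (N / \<delta>)))" .
qed

section \<open>All norm levels at once\<close>

lemma (in bellman_setting) uniform_deviation:
  fixes \<delta> :: real and n L :: nat
  assumes \<delta>: "0 < \<delta>" "\<delta> < 1" and n: "1 \<le> n"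
  shows "\<exists>E \<in> sets (sample_dist S A n). 1 - \<delta> \<le> measure (sample_dist S A n) E \<and>
    (\<forall>x\<in>E. \<forall>\<Theta> :: nat \<Rightarrow> ('d, 'm::finite, 'D::finite) rparams. (\<forall>a\<in>A. length (rlayers (\<Theta> a)) = L) \<longrightarrow>
      \<bar>bellman_risk S A r g dt \<gamma> \<Theta> - empirical_risk A r g dt \<gamma> n x \<Theta>\<bar>
        \<le> (family_path_norm A \<Theta> + 1)\<^sup>2 / sqrt n * (36 * card A ^ 3 * sqrt (2 * ln (2 * CARD('d)))
          + 9/2 * (ln (4 * (family_path_norm A \<Theta> + 1)) + ln (card A / \<delta>))))"
proof -
  define P where "P = sample_dist S A n"
  interpret P: prob_space P
    unfolding P_def sample_dist_def by (intro prob_space_PiM prob_space_pair_dist)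
  define dev where "dev x \<Theta> = \<bar>bellman_risk S A r g dt \<gamma> \<Theta> - empirical_risk A r g dt \<gamma> n x \<Theta>\<bar>"
    for x and \<Theta> :: "nat \<Rightarrow> ('d, 'm, 'D) rparams"
  define s where "s = sqrt (2 * ln (2 * CARD('d)))"
  define q where "q j = (real j + 1) / 2" for j :: nat
  define lam where "lam j = s / (2 * sqrt n * (q j + 1/2)\<^sup>2)" for j
  define C where "C j = 6 * card A * (2 * CARD('d) *
    exp ((4 * lam j * (2 * q j + 1) * (q j + 1/2))\<^sup>2 / 2 * (2 * n)))" for j
  define v where "v j = ln (2 * C j * (real j + 1) * (real j + 2) / \<delta>)" for j
  have cards: "1 \<le> CARD('d)" "1 \<le> card A"
    using A by (auto simp: Suc_le_eq card_gt_0_iff)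
  have level: "0 < lam j" "real j \<le> 2 * Q \<Longrightarrow> v j / (lam j * n)
      \<le> (Q + 1)\<^sup>2 / sqrt n * (36 * card A ^ 3 * s + 9/2 * (ln (4 * (Q + 1)) + ln (card A / \<delta>)))" for j Q
    \<comment> \<open>Positivity of \<open>lam j\<close> does not involve Q, so any Q with j <= 2 Q
      may be inserted; \<open>real j\<close> is one.\<close>
    using deviation_level_le(1)[OF cards n \<delta>, of j "real j"] deviation_level_le(2)[OF cards n \<delta>, of j Q]
    unfolding v_def C_def lam_def q_def s_def by (simp_all add: add.commute mult.assoc)
  \<comment> \<open>The dense set is chosen inside the level set itself, not in the whole parameter
    space, so that its members obey the norm bound of the level.\<close>
  have "\<exists>T :: ('d, 'm, 'D) param_seq set. countable T
      \<and> T \<subseteq> {p. family_path_norm A (seq_family L p) \<le> q j}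
      \<and> {p. family_path_norm A (seq_family L p) \<le> q j} \<subseteq> closure T" for j
    using separable by metis
  then obtain T :: "nat \<Rightarrow> ('d, 'm, 'D) param_seq set" where T: "\<And>j. countable (T j)"
      "\<And>j p. p \<in> T j \<Longrightarrow> family_path_norm A (seq_family L p) \<le> q j"
      "\<And>j p. family_path_norm A (seq_family L p) \<le> q j \<Longrightarrow> p \<in> closure (T j)"
    by (metis (mono_tags, lifting) mem_Collect_eq subsetD)
  have T_ne: "T j \<noteq> {}" for j
  proof -
    \<comment> \<open>The zero network has path norm 0 and belongs to every level.\<close>
    have "path_norm (seq_family L ((\<lambda>_. (0, 0, \<lambda>_. (0, 0))) :: ('d, 'm, 'D) param_seq) a) = 0" for a
      by (simp add: seq_family_def path_norm_eq absv_def inner_vec_def)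
    then have "(\<lambda>_. (0, 0, \<lambda>_. (0, 0))) \<in> closure (T j)"
      by (intro T(3)) (simp add: family_path_norm_def q_def)
    then show ?thesis by auto
  qed
  \<comment> \<open>The bad event of level \<open>j\<close>. The summand ln ((j+1)(j+2) / \<delta>)
    in \<open>v j\<close> reduces its probability to \<delta> / ((j+1)(j+2)), and these telescope to
    \<delta>.\<close>
  define B where "B j = {x \<in> space P. \<exists>p\<in>T j. v j < lam j * n * dev x (seq_family L p)}" for j
  have B: "B j \<in> sets P" "measure P (B j) \<le> \<delta> / (real j + 1) - \<delta> / (real j + 2)" for j
  proof -
    have Tj: "\<And>p. p \<in> T j \<Longrightarrow> family_path_norm A (seq_family L p) \<le> q j"
      by (rule T(2))
    show "B j \<in> sets P"
      using level_tail(1)[OF T(1)[of j] T_ne[of j] Tj level(1)[of j] n, where v = "v j"]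
      by (simp add: B_def P_def dev_def)
    have "0 < C j"
      using cards by (simp add: C_def)
    then have pos: "0 < 2 * C j * (real j + 1) * (real j + 2) / \<delta>"
      using \<delta> by simp
    have "measure P (B j) \<le> 2 * C j * exp (- v j)"
      using level_tail(2)[OF T(1)[of j] T_ne[of j] Tj level(1)[of j] n, where v = "v j"]
      by (simp add: B_def P_def dev_def C_def)
    also have "\<dots> = \<delta> / ((real j + 1) * (real j + 2))"
    proof -
      have "exp (- v j) = inverse (2 * C j * (real j + 1) * (real j + 2) / \<delta>)"
        unfolding v_def exp_minus exp_ln[OF pos] ..
      then show ?thesis using \<open>0 < C j\<close> by simp
    qed
    also have "\<dots> = \<delta> / (real j + 1) - \<delta> / (real j + 2)"
      by (simp add: field_simps)
    finally show "measure P (B j) \<le> \<delta> / (real j + 1) - \<delta> / (real j + 2)" .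
  qed
  have sums: "(\<lambda>j. \<delta> / (real j + 1) - \<delta> / (real j + 2)) sums \<delta>"
  proof -
    have "(\<lambda>j. \<delta> / (real j + 1)) \<longlonglongrightarrow> 0"
      by real_asymp
    from telescope_sums'[OF this] show ?thesis by (simp add: add.commute)
  qed
  have summ: "summable (\<lambda>j. measure P (B j))"
    by (rule summable_comparison_test'[OF sums_summable[OF sums], of 0]) (use B(2) in auto)
  have "measure P (\<Union>j. B j) \<le> (\<Sum>j. measure P (B j))"
    using B(1) summ by (intro P.finite_measure_subadditive_countably) auto
  also have "\<dots> \<le> \<delta>"
    using suminf_le[OF B(2) summ sums_summable[OF sums]] sums_unique[OF sums] by simp
  finally have "1 - \<delta> \<le> measure P (space P - (\<Union>j. B j))"
    using B(1) by (subst P.prob_compl) auto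
  moreover have "space P - (\<Union>j. B j) \<in> sets P"
    using B(1) by auto
  moreover have "dev x \<Theta> \<le> (family_path_norm A \<Theta> + 1)\<^sup>2 / sqrt n * (36 * card A ^ 3 * s
        + 9/2 * (ln (4 * (family_path_norm A \<Theta> + 1)) + ln (card A / \<delta>)))"
    if x: "x \<in> space P - (\<Union>j. B j)" and len: "\<forall>a\<in>A. length (rlayers (\<Theta> a)) = L"
    for x and \<Theta> :: "nat \<Rightarrow> ('d, 'm, 'D) rparams"
  proof -
    \<comment> \<open>Entries of the layer sequence from index \<open>L\<close> on are unspecified,
      but \<open>seq_family L\<close> never reads them.\<close>
    define p :: "('d, 'm, 'D) param_seq" where "p a = (fst (\<Theta> a), fst (snd (\<Theta> a)), (!) (rlayers (\<Theta> a)))" for a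
    have p: "seq_family L p a = \<Theta> a" if "a \<in> A" for a
      using len that by (auto simp: seq_family_def p_def rlayers_def map_nth)
    define Q where "Q = family_path_norm A \<Theta>"
    have "0 \<le> Q" unfolding Q_def family_path_norm_def by (intro sum_nonneg path_norm_nonneg)
    \<comment> \<open>The level belonging to the norm Q: 2 Q < j + 1 places the family in the level
      set, and j <= 2 Q is what the bound in terms of Q requires.\<close>
    define j where "j = nat \<lfloor>2 * Q\<rfloor>"
    have j: "real j \<le> 2 * Q" "2 * Q < real j + 1"
      unfolding j_def using \<open>0 \<le> Q\<close> by linarith+
    have "family_path_norm A (seq_family L p) = Q"
      unfolding Q_def using p by (intro risk_cong(3))
    then have "p \<in> closure (T j)"
      using j by (intro T(3)) (simp add: q_def)
    have "dev x (seq_family L p) \<le> v j / (lam j * n)"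
      unfolding dev_def
    proof (rule level_extend[OF T(2) \<open>p \<in> closure (T j)\<close>])
      fix p' assume "p' \<in> T j"
      then have "lam j * n * dev x (seq_family L p') \<le> v j"
        using x by (auto simp: B_def not_less)
      then show "\<bar>bellman_risk S A r g dt \<gamma> (seq_family L p') - empirical_risk A r g dt \<gamma> n x (seq_family L p')\<bar>
          \<le> v j / (lam j * n)"
        using level(1)[of j] n by (simp add: dev_def field_simps)
    qed
    moreover have "dev x (seq_family L p) = dev x \<Theta>"
      using risk_cong(1)[OF p] risk_cong(2)[OF p, where x = x and n = n] x
      by (simp add: dev_def P_def)
    ultimately show ?thesis
      using level(2)[OF j(1)] unfolding Q_def by linarith
  qed
  ultimately show ?thesis
    unfolding P_def dev_def s_def by blast
qed

theorem theorem3p6: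
  fixes S :: "(real^'d::finite) set"
    and \<alpha> :: nat and A :: "nat set"
    and \<gamma> dt :: real
    and r :: "real^'d \<Rightarrow> nat \<Rightarrow> real"
    and g :: "real^'d \<Rightarrow> nat \<Rightarrow> real \<Rightarrow> real^'d"
    and L :: nat
    and \<delta> :: real and n :: nat
  assumes S_compact: "compact S"
    and S_cube: "\<forall>s\<in>S. \<forall>i. 0 \<le> s $ i \<and> s $ i \<le> 1"
    and S_pos: "emeasure lebesgue S > 0"
    and A_def: "A = {1..2 ^ \<alpha>}"
    and gamma: "0 < \<gamma>" "\<gamma> < 1"
    and r_cont: "\<forall>a\<in>A. continuous_on S (\<lambda>s. r s a)"
    and r_bound: "\<forall>s\<in>S. \<forall>a\<in>A. \<bar>r s a\<bar> \<le> 1"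
    and g_maps: "\<forall>s\<in>S. \<forall>a\<in>A. \<forall>t\<ge>0. g s a t \<in> S"
    and g_meas: "\<forall>a\<in>A. (\<lambda>s. g s a dt) \<in> borel_measurable (restrict_space lebesgue S)"
    and dt: "0 < dt" "dt < 1"
    and L_pos: "L \<ge> 1"
    and delta: "0 < \<delta>" "\<delta> < 1"
    and n_pos: "n \<ge> 1"
  shows "\<exists>E \<in> sets (sample_dist S A n).
           measure (sample_dist S A n) E \<ge> 1 - \<delta> \<and>
           (\<forall>smp\<in>E. \<forall>\<Theta> :: nat \<Rightarrow> ('d, 'm::finite, 'D::finite) rparams.
              (\<forall>a\<in>A. length (rlayers (\<Theta> a)) = L) \<longrightarrow>
              \<bar>bellman_risk S A r g dt \<gamma> \<Theta> - empirical_risk A r g dt \<gamma> n smp \<Theta>\<bar>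
                \<le> (family_path_norm A \<Theta> + 1)\<^sup>2 / sqrt (real n) *
                   (36 * real (card A) ^ 3 * sqrt (2 * ln (2 * real CARD('d)))
                    + 9/2 * (ln (4 * (family_path_norm A \<Theta> + 1)) + ln (real (card A) / \<delta>))))"
proof -
  interpret bellman_setting S A \<gamma> dt r g
  proof
    show "finite A" "A \<noteq> {}" "0 \<notin> A"
      by (auto simp: A_def)
  qed (use assms in auto)
  show ?thesis
    using uniform_deviation[OF delta n_pos] by simp
qed

end
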